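(* Let $E$ be a left $A$-module, $q$ a full quantization for $(E,E)$, and $\hbar\in\Bbbk$. The $\Bbbk$-module $\mathrm{Symb}^\bullet_d(E,E)$ equipped with the star product $\star=\star_\hbar$, given by $\Bbbk$-bilinear extension of $$a\star b=\sum_{k=0}^{n+m}\hbar^k\,[q^n(a)\circ q^m(b)]^{n+m-k}_q,\qquad a\in\mathrm{Symb}^n_d(E,E),\ b\in\mathrm{Symb}^m_d(E,E),$$ forms a unital associative filtered $\Bbbk$-algebra isomorphic to $\mathrm{Symb}^\bullet_d(E,E)[h]/(h-\hbar)$ (the quotient of the algebra $(\mathrm{Symb}^\bullet_d(E,E)[h],\hat\star)$ by the two-sided ideal generated by $h-\hbar$), where the filtration is given by the partial sums $\bigoplus_{k=0}^n\mathrm{Symb}^k_d(E,E)$. In particular, for all $a\in\mathrm{Symb}^n_d(E,E)$ and $b\in\mathrm{Symb}^m_d(E,E)$, we have $$a\star b-a\cdot b\in\hbar\bigoplus_{k=0}^{m+n-1}\mathrm{Symb}^k_d(E,E).$$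
   Context: **Setting.** $\Bbbk$ is a commutative unital ring, $A$ an associative unital $\Bbbk$-algebra, $\otimes=\otimes_\Bbbk$. $(\Omega^\bullet_d,\wedge,d)$ is an exterior algebra over $A$: a differential graded $\Bbbk$-algebra with $\Omega^0_d=A$, generated by $A$ and $dA$, $d$ satisfying the graded Leibniz rule. $\Omega^k_dE=\Omega^k_d\otimes_AE$. **Jets.** For a left $A$-module $E$, $J^1_dE=(A\otimes E)/\{\sum_ia_i\otimes e_i:\sum_ia_ie_i=0,\ \sum_ida_i\otimes_Ae_i=0\}$, with $a[b\otimes e]=[ab\otimes e]$, functorial in $E$; $j^1_{d,E}(e)=[1\otimes e]$. Put $J^0_dE=E$, $l^1=\mathrm{id}$, $j^0=\mathrm{id}$; for $n\ge2$, $l^n_{d,E}\colon J^n_dE\hookrightarrow J^1_dJ^{n-1}_dE$ is the inclusion of the left $A$-submodule of those $x$ such that $J^1_d(l^{n-1}_{d,E})(x)\in J^1_dJ^1_dJ^{n-2}_dE$ is annihilated by both maps $[a\otimes[c\otimes e]]\mapsto a\,dc\otimes_Ae\in\Omega^1_dJ^{n-2}_dE$ and $[a\otimes[c\otimes e]]\mapsto da\wedge dc\otimes_Ae\in\Omega^2_dJ^{n-2}_dE$. The prolongation $j^n_{d,E}\colon E\to J^n_dE$ is the $\Bbbk$-linear map with $l^n_{d,E}\circ j^n_{d,E}=j^1_{d,J^{n-1}_dE}\circ j^{n-1}_{d,E}$. **Differential operators and symbols.** $\mathrm{Diff}^n_d(E,F)$ is the set of $\Bbbk$-linear $\Delta\colon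 E\to F$ for which there is a left $A$-linear $\widetilde\Delta\colon J^n_dE\to F$ with $\widetilde\Delta\circ j^n_{d,E}=\Delta$; $\mathrm{Diff}^{n-1}_d\subseteq\mathrm{Diff}^n_d$, $\mathrm{Diff}^{-1}_d=0$, $\mathrm{Diff}_d=\bigcup_n\mathrm{Diff}^n_d$. The composition of operators of order at most $n$ and $m$ has order at most $n+m$. $\mathrm{Symb}^n_d(E,F)=\mathrm{Diff}^n_d(E,F)/\mathrm{Diff}^{n-1}_d(E,F)$ with quotient map $\varsigma^n_d$; $\mathrm{Symb}^\bullet_d=\bigoplus_n\mathrm{Symb}^n_d$. The symbol multiplication on $\mathrm{Symb}^\bullet_d(E,E)$ is $\varsigma^n_d(\Delta_1)\cdot\varsigma^m_d(\Delta_2)=\varsigma^{n+m}_d(\Delta_1\circ\Delta_2)$. **Quantizations.** An $n$-quantization for $(E,E)$ is an ${}_A\mathrm{Hom}(E,E)$-linear (for postcomposition) map $q^n\colon\mathrm{Symb}^n_d(E,E)\to\mathrm{Diff}^n_d(E,E)$ with $\varsigma^n_d\circ q^n=\mathrm{id}$. A full quantization is $q=\sum_nq^n$ for a collection $\{q^n\}_{n\in\mathbb N}$ of $n$-quantizations. **Truncation.** For $\Delta\in\mathrm{Diff}^n_d(E,E)$ put $\Delta_{\le k}:=\Delta$ for $k\ge n$ and recursively $\Delta_{\le k}:=\Delta_{\le k+1}-q^{k+1}(\varsigma^{k+1}_d(\Delta_{\le k+1}))$ for $0\le k<n$ (independent of the choice of $n$); then $\Delta_{\le k}\in\mathrm{Diff}^k_d(E,E)$.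 Put $[\Delta]^k_q:=\varsigma^k_d(\Delta_{\le k})$. **Formal star product.** For a $\Bbbk$-module $M$, $M[h]=M\otimes\Bbbk[h]$. The formal star product $\hat\star$ on $\mathrm{Symb}^\bullet_d(E,E)[h]$ is the $\Bbbk[h]$-bilinear operation with $a\,\hat\star\,b=\sum_{k=0}^{n+m}h^k[q^n(a)\circ q^m(b)]^{n+m-k}_q$ for $a\in\mathrm{Symb}^n_d(E,E)$, $b\in\mathrm{Symb}^m_d(E,E)$; it is a unital associative $\Bbbk[h]$-algebra structure with unit $\mathrm{id}_E$. *)

theory Defs
  imports "HOL-Algebra.UnivPoly" "HOL-Algebra.QuotRing" "HOL-Algebra.Generated_Rings"
begin

section \<open>Algebras, left modules and exterior algebras\<close>

text \<open>The library locales \<^locale>\<open>algebra\<close> and \<^locale>\<open>module\<close> are restricted to commutative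
  algebras and to modules over commutative rings. As in the library, a module is a
  \<^typ>\<open>('a, 'b) module\<close> record; the fields \<^const>\<open>mult\<close> and \<^const>\<open>one\<close> of such a record are
  meaningful only if it is regarded as an algebra, and are ignored (or \<^const>\<open>undefined\<close>) otherwise.\<close>

locale assoc_algebra = module K R + ring R for K and R (structure) +
  assumes smult_mult_left:
      "\<lbrakk>c \<in> carrier K; x \<in> carrier R; y \<in> carrier R\<rbrakk> \<Longrightarrow> (c \<odot> x) \<otimes> y = c \<odot> (x \<otimes> y)"
    and smult_mult_right:
      "\<lbrakk>c \<in> carrier K; x \<in> carrier R; y \<in> carrier R\<rbrakk> \<Longrightarrow> x \<otimes> (c \<odot> y) = c \<odot> (x \<otimes> y)"

locale left_module = R?: ring A + M?: abelian_group M
  for A :: "('a, 'c) ring_scheme" and M :: "('a, 'b, 'd) module_scheme" (structure) +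
  assumes act_closed:
      "\<lbrakk>a \<in> carrier A; x \<in> carrier M\<rbrakk> \<Longrightarrow> a \<odot> x \<in> carrier M"
    and act_l_distr:
      "\<lbrakk>a \<in> carrier A; b \<in> carrier A; x \<in> carrier M\<rbrakk> \<Longrightarrow> (a \<oplus>\<^bsub>A\<^esub> b) \<odot> x = a \<odot> x \<oplus> b \<odot> x"
    and act_r_distr:
      "\<lbrakk>a \<in> carrier A; x \<in> carrier M; y \<in> carrier M\<rbrakk> \<Longrightarrow> a \<odot> (x \<oplus> y) = a \<odot> x \<oplus> a \<odot> y"
    and act_assoc:
      "\<lbrakk>a \<in> carrier A; b \<in> carrier A; x \<in> carrier M\<rbrakk> \<Longrightarrow> (a \<otimes>\<^bsub>A\<^esub> b) \<odot> x = a \<odot> (b \<odot> x)"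
    and act_one:
      "x \<in> carrier M \<Longrightarrow> \<one>\<^bsub>A\<^esub> \<odot> x = x"

text \<open>A differential graded algebra \<open>\<Omega>\<close> is an algebra record extended by its homogeneous components
  \<open>grd \<Omega> k\<close> and its differential. The product of \<open>\<Omega>\<close> is the wedge product. The algebra \<open>A\<close> is
  the degree-zero part of \<open>\<Omega>\<close>.\<close>

record ('k, 'w) dga = "('k, 'w) module" +
  grd :: "nat \<Rightarrow> 'w set"
  dif :: "'w \<Rightarrow> 'w"

definition deg0 :: "('k, 'w) dga \<Rightarrow> ('k, 'w) dga" where
  "deg0 \<Omega> = \<Omega>\<lparr>carrier := grd \<Omega> 0\<rparr>"

locale exterior_algebra = assoc_algebra K \<Omega> for K and \<Omega> :: "('k, 'w) dga" (structure) +
  assumes grd_submodule: "submodule (grd \<Omega> n) K \<Omega>"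
    and direct_sum: "w \<in> carrier \<Omega> \<Longrightarrow>
      \<exists>!f. (\<forall>n. f n \<in> grd \<Omega> n) \<and> finite {n. f n \<noteq> \<zero>} \<and> w = (\<Oplus>n\<in>{n. f n \<noteq> \<zero>}. f n)"
    and one_grd: "\<one> \<in> grd \<Omega> 0"
    and mult_grd: "\<lbrakk>x \<in> grd \<Omega> m; y \<in> grd \<Omega> n\<rbrakk> \<Longrightarrow> x \<otimes> y \<in> grd \<Omega> (m + n)"
    and dif_grd: "x \<in> grd \<Omega> n \<Longrightarrow> dif \<Omega> x \<in> grd \<Omega> (Suc n)"
    and dif_closed: "x \<in> carrier \<Omega> \<Longrightarrow> dif \<Omega> x \<in> carrier \<Omega>"
    and dif_add: "\<lbrakk>x \<in> carrier \<Omega>; y \<in> carrier \<Omega>\<rbrakk> \<Longrightarrow> dif \<Omega> (x \<oplus> y) = dif \<Omega> x \<oplus> dif \<Omega> y"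
    and dif_smult: "\<lbrakk>c \<in> carrier K; x \<in> carrier \<Omega>\<rbrakk> \<Longrightarrow> dif \<Omega> (c \<odot> x) = c \<odot> dif \<Omega> x"
    and dif_dif: "x \<in> carrier \<Omega> \<Longrightarrow> dif \<Omega> (dif \<Omega> x) = \<zero>"
    and leibniz: "\<lbrakk>x \<in> grd \<Omega> n; y \<in> carrier \<Omega>\<rbrakk> \<Longrightarrow>
      dif \<Omega> (x \<otimes> y) = dif \<Omega> x \<otimes> y \<oplus> (\<ominus> \<one>) [^] n \<otimes> (x \<otimes> dif \<Omega> y)"
    and generated: "generate_ring \<Omega> (grd \<Omega> 0 \<union> dif \<Omega> ` grd \<Omega> 0) = carrier \<Omega>"

section \<open>Tensor products\<close>

text \<open>A list of pairs \<open>(x, y)\<close> stands for the formal sum of the \<open>x \<otimes> y\<close>.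
  \<open>tensor_eq S U r V l\<close> is the congruence whose quotient is the tensor product over the ring with
  underlying set \<open>S\<close> of the right module \<open>U\<close> (action \<open>r\<close>) and the left module \<open>V\<close> (action \<open>l\<close>).
  No negative coefficients are needed, since \<open>- (x \<otimes> y) = (- x) \<otimes> y\<close>.\<close>

inductive tensor_eq ::
  "'r set \<Rightarrow> ('x, 'b) ring_scheme \<Rightarrow> ('x \<Rightarrow> 'r \<Rightarrow> 'x) \<Rightarrow> ('m, 'c) ring_scheme \<Rightarrow> ('r \<Rightarrow> 'm \<Rightarrow> 'm) \<Rightarrow>
   ('x \<times> 'm) list \<Rightarrow> ('x \<times> 'm) list \<Rightarrow> bool"
  for S U r V l where
    refl: "set xs \<subseteq> carrier U \<times> carrier V \<Longrightarrow> tensor_eq S U r V l xs xs"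
  | sym: "tensor_eq S U r V l xs ys \<Longrightarrow> tensor_eq S U r V l ys xs"
  | trans: "\<lbrakk>tensor_eq S U r V l xs ys; tensor_eq S U r V l ys zs\<rbrakk> \<Longrightarrow> tensor_eq S U r V l xs zs"
  | append: "\<lbrakk>tensor_eq S U r V l xs xs'; tensor_eq S U r V l ys ys'\<rbrakk> \<Longrightarrow>
      tensor_eq S U r V l (xs @ ys) (xs' @ ys')"
  | commute: "\<lbrakk>set xs \<subseteq> carrier U \<times> carrier V; set ys \<subseteq> carrier U \<times> carrier V\<rbrakk> \<Longrightarrow>
      tensor_eq S U r V l (xs @ ys) (ys @ xs)"
  | zero_left: "y \<in> carrier V \<Longrightarrow> tensor_eq S U r V l [(\<zero>\<^bsub>U\<^esub>, y)] []"
  | zero_right: "x \<in> carrier U \<Longrightarrow> tensor_eq S U r V l [(x, \<zero>\<^bsub>V\<^esub>)] []"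
  | add_left: "\<lbrakk>x \<in> carrier U; x' \<in> carrier U; y \<in> carrier V\<rbrakk> \<Longrightarrow>
      tensor_eq S U r V l [(x \<oplus>\<^bsub>U\<^esub> x', y)] [(x, y), (x', y)]"
  | add_right: "\<lbrakk>x \<in> carrier U; y \<in> carrier V; y' \<in> carrier V\<rbrakk> \<Longrightarrow>
      tensor_eq S U r V l [(x, y \<oplus>\<^bsub>V\<^esub> y')] [(x, y), (x, y')]"
  | balanced: "\<lbrakk>s \<in> S; x \<in> carrier U; y \<in> carrier V\<rbrakk> \<Longrightarrow>
      tensor_eq S U r V l [(r x s, y)] [(x, l s y)]"

text \<open>Restriction of scalars of a left \<open>A\<close>-module along \<open>\<k> \<rightarrow> A\<close>.\<close>

definition kact :: "('k, 'w) dga \<Rightarrow> ('w, 'm) module \<Rightarrow> 'k \<Rightarrow> 'm \<Rightarrow> 'm" where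
  "kact \<Omega> M c x = (c \<odot>\<^bsub>\<Omega>\<^esub> \<one>\<^bsub>\<Omega>\<^esub>) \<odot>\<^bsub>M\<^esub> x"

text \<open>Equality in \<open>A \<otimes>\<^bsub>\<k>\<^esub> M\<close> and in \<open>\<Omega>\<^sup>k \<otimes>\<^bsub>A\<^esub> M\<close>.\<close>

definition ktensor_eq ::
  "'k ring \<Rightarrow> ('k, 'w) dga \<Rightarrow> ('w, 'm) module \<Rightarrow> ('w \<times> 'm) list \<Rightarrow> ('w \<times> 'm) list \<Rightarrow> bool" where
  "ktensor_eq K \<Omega> M = tensor_eq (carrier K) (deg0 \<Omega>) (\<lambda>a c. c \<odot>\<^bsub>\<Omega>\<^esub> a) M (kact \<Omega> M)"

definition form_eq ::
  "('k, 'w) dga \<Rightarrow> nat \<Rightarrow> ('w, 'm) module \<Rightarrow> ('w \<times> 'm) list \<Rightarrow> ('w \<times> 'm) list \<Rightarrow> bool" where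
  "form_eq \<Omega> k M =
     tensor_eq (carrier (deg0 \<Omega>)) (\<Omega>\<lparr>carrier := grd \<Omega> k\<rparr>) (\<lambda>w a. w \<otimes>\<^bsub>\<Omega>\<^esub> a) M (smult M)"

section \<open>Jets\<close>

text \<open>All the modules \<open>J\<^sup>n E\<close> live in the following type, independent of \<open>n\<close>.
  An element of \<open>E\<close> is a \<open>Base e\<close>; an element of a quotient \<open>J\<^sup>1 M\<close> of \<open>A \<otimes>\<^bsub>\<k>\<^esub> M\<close> is
  \<open>Jet xs\<close> for a formal sum \<open>xs\<close> of \<open>a \<otimes> m\<close>, where \<open>xs\<close> is a fixed representative
  of its class.\<close>

datatype ('w, 'e) jet = Base (unbase: 'e) | Jet (formal: "('w \<times> ('w, 'e) jet) list")

definition base_module :: "('w, 'e) module \<Rightarrow> ('w, ('w, 'e) jet) module" where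
  "base_module E =
     \<lparr>carrier = Base ` carrier E, mult = undefined, one = undefined,
      zero = Base \<zero>\<^bsub>E\<^esub>, add = (\<lambda>x y. Base (unbase x \<oplus>\<^bsub>E\<^esub> unbase y)),
      smult = (\<lambda>a x. Base (a \<odot>\<^bsub>E\<^esub> unbase x))\<rparr>"

text \<open>The sums of \<open>a\<^sub>i \<otimes> e\<^sub>i\<close> with \<open>\<Sum>\<^sub>i a\<^sub>i e\<^sub>i = 0\<close> and \<open>\<Sum>\<^sub>i d a\<^sub>i \<otimes>\<^bsub>A\<^esub> e\<^sub>i = 0\<close>, by which
  \<open>A \<otimes>\<^bsub>\<k>\<^esub> M\<close> is divided.\<close>

definition jet_relations :: "('k, 'w) dga \<Rightarrow> ('w, 'm) module \<Rightarrow> ('w \<times> 'm) list set" where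
  "jet_relations \<Omega> M =
     {xs. set xs \<subseteq> carrier (deg0 \<Omega>) \<times> carrier M \<and>
          foldr (\<lambda>(a, e) s. a \<odot>\<^bsub>M\<^esub> e \<oplus>\<^bsub>M\<^esub> s) xs \<zero>\<^bsub>M\<^esub> = \<zero>\<^bsub>M\<^esub> \<and>
          form_eq \<Omega> 1 M (map (\<lambda>(a, e). (dif \<Omega> a, e)) xs) []}"

definition jet_eq ::
  "'k ring \<Rightarrow> ('k, 'w) dga \<Rightarrow> ('w, 'm) module \<Rightarrow> ('w \<times> 'm) list \<Rightarrow> ('w \<times> 'm) list \<Rightarrow> bool" where
  "jet_eq K \<Omega> M xs ys \<longleftrightarrow> (\<exists>zs \<in> jet_relations \<Omega> M. ktensor_eq K \<Omega> M xs (ys @ zs))"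

definition jet_class ::
  "'k ring \<Rightarrow> ('k, 'w) dga \<Rightarrow> ('w, ('w, 'e) jet) module \<Rightarrow> ('w \<times> ('w, 'e) jet) list \<Rightarrow> ('w, 'e) jet" where
  "jet_class K \<Omega> M xs = Jet (SOME ys. jet_eq K \<Omega> M xs ys)"

definition J1 ::
  "'k ring \<Rightarrow> ('k, 'w) dga \<Rightarrow> ('w, ('w, 'e) jet) module \<Rightarrow> ('w, ('w, 'e) jet) module" where
  "J1 K \<Omega> M =
     \<lparr>carrier = jet_class K \<Omega> M ` {xs. set xs \<subseteq> carrier (deg0 \<Omega>) \<times> carrier M},
      mult = undefined, one = undefined,
      zero = jet_class K \<Omega> M [],
      add = (\<lambda>x y. jet_class K \<Omega> M (formal x @ formal y)),
      smult = (\<lambda>a x. jet_class K \<Omega> M (map (\<lambda>(b, e). (a \<otimes>\<^bsub>\<Omega>\<^esub> b, e)) (formal x)))\<rparr>"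

definition j1 ::
  "'k ring \<Rightarrow> ('k, 'w) dga \<Rightarrow> ('w, ('w, 'e) jet) module \<Rightarrow> ('w, 'e) jet \<Rightarrow> ('w, 'e) jet" where
  "j1 K \<Omega> M e = jet_class K \<Omega> M [(\<one>\<^bsub>\<Omega>\<^esub>, e)]"

text \<open>The map \<open>J\<^sup>1 f : J\<^sup>1 M \<rightarrow> J\<^sup>1 N\<close> induced by \<open>f : M \<rightarrow> N\<close>; only the target \<open>N\<close> enters.\<close>

definition J1_map ::
  "'k ring \<Rightarrow> ('k, 'w) dga \<Rightarrow> ('w, ('w, 'e) jet) module \<Rightarrow> (('w, 'e) jet \<Rightarrow> ('w, 'e) jet) \<Rightarrow>
   ('w, 'e) jet \<Rightarrow> ('w, 'e) jet" where
  "J1_map K \<Omega> N f x = jet_class K \<Omega> N (map (\<lambda>(a, m). (a, f m)) (formal x))"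

text \<open>Formal sums representing the images of \<open>x \<in> J\<^sup>1 (J\<^sup>1 M)\<close> under
  \<open>[a \<otimes> [c \<otimes> e]] \<mapsto> a dc \<otimes> e\<close> and \<open>[a \<otimes> [c \<otimes> e]] \<mapsto> da \<and> dc \<otimes> e\<close>. Their classes
  in \<open>\<Omega>\<^sup>1 \<otimes>\<^bsub>A\<^esub> M\<close> and \<open>\<Omega>\<^sup>2 \<otimes>\<^bsub>A\<^esub> M\<close> do not depend on the chosen representatives.\<close>

definition form1 :: "('k, 'w) dga \<Rightarrow> ('w, 'e) jet \<Rightarrow> ('w \<times> ('w, 'e) jet) list" where
  "form1 \<Omega> x = concat (map (\<lambda>(a, z). map (\<lambda>(c, e). (a \<otimes>\<^bsub>\<Omega>\<^esub> dif \<Omega> c, e)) (formal z)) (formal x))"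

definition form2 :: "('k, 'w) dga \<Rightarrow> ('w, 'e) jet \<Rightarrow> ('w \<times> ('w, 'e) jet) list" where
  "form2 \<Omega> x = concat (map (\<lambda>(a, z). map (\<lambda>(c, e). (dif \<Omega> a \<otimes>\<^bsub>\<Omega>\<^esub> dif \<Omega> c, e)) (formal z)) (formal x))"

text \<open>For \<open>n \<ge> 1\<close> the carrier of \<open>J\<^sup>n M\<close> is a subset of that of \<open>J\<^sup>1 (J\<^sup>n\<^sup>-\<^sup>1 M)\<close> and \<open>l\<^sup>n\<close> is the
  inclusion, i.e. the function \<open>\<lambda>m. m\<close>. Note that \<open>J\<^sup>1 l\<^sup>n\<close> is in general not the identity
  function, because it changes the module in which classes are formed.\<close>

fun Jn ::
  "'k ring \<Rightarrow> ('k, 'w) dga \<Rightarrow> nat \<Rightarrow> ('w, ('w, 'e) jet) module \<Rightarrow> ('w, ('w, 'e) jet) module" where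
  "Jn K \<Omega> 0 M = M"
| "Jn K \<Omega> (Suc 0) M = J1 K \<Omega> M"
| "Jn K \<Omega> (Suc (Suc n)) M = (J1 K \<Omega> (Jn K \<Omega> (Suc n) M))
     \<lparr>carrier := {x \<in> carrier (J1 K \<Omega> (Jn K \<Omega> (Suc n) M)).
        let y = J1_map K \<Omega> (J1 K \<Omega> (Jn K \<Omega> n M)) (\<lambda>m. m) x
        in form_eq \<Omega> 1 (Jn K \<Omega> n M) (form1 \<Omega> y) [] \<and>
           form_eq \<Omega> 2 (Jn K \<Omega> n M) (form2 \<Omega> y) []}\<rparr>"

fun jn ::
  "'k ring \<Rightarrow> ('k, 'w) dga \<Rightarrow> nat \<Rightarrow> ('w, ('w, 'e) jet) module \<Rightarrow> ('w, 'e) jet \<Rightarrow> ('w, 'e) jet" where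
  "jn K \<Omega> 0 M e = e"
| "jn K \<Omega> (Suc n) M e = j1 K \<Omega> (Jn K \<Omega> n M) (jn K \<Omega> n M e)"

section \<open>Differential operators and symbols\<close>

text \<open>Maps between carriers are extensional functions, so that equal maps are equal functions.\<close>

definition lin_hom :: "('k, 'w) dga \<Rightarrow> ('w, 'm) module \<Rightarrow> ('w, 'n) module \<Rightarrow> ('m \<Rightarrow> 'n) set" where
  "lin_hom \<Omega> M N = {f \<in> carrier M \<rightarrow>\<^sub>E carrier N.
     (\<forall>x \<in> carrier M. \<forall>y \<in> carrier M. f (x \<oplus>\<^bsub>M\<^esub> y) = f x \<oplus>\<^bsub>N\<^esub> f y) \<and>
     (\<forall>a \<in> carrier (deg0 \<Omega>). \<forall>x \<in> carrier M. f (a \<odot>\<^bsub>M\<^esub> x) = a \<odot>\<^bsub>N\<^esub> f x)}"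

definition klin_hom ::
  "'k ring \<Rightarrow> ('k, 'w) dga \<Rightarrow> ('w, 'm) module \<Rightarrow> ('w, 'n) module \<Rightarrow> ('m \<Rightarrow> 'n) set" where
  "klin_hom K \<Omega> M N = {f \<in> carrier M \<rightarrow>\<^sub>E carrier N.
     (\<forall>x \<in> carrier M. \<forall>y \<in> carrier M. f (x \<oplus>\<^bsub>M\<^esub> y) = f x \<oplus>\<^bsub>N\<^esub> f y) \<and>
     (\<forall>c \<in> carrier K. \<forall>x \<in> carrier M. f (kact \<Omega> M c x) = kact \<Omega> N c (f x))}"

definition Diff ::
  "'k ring \<Rightarrow> ('k, 'w) dga \<Rightarrow> nat \<Rightarrow> ('w, 'e) module \<Rightarrow> ('w, 'f) module \<Rightarrow> ('e \<Rightarrow> 'f) set" where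
  "Diff K \<Omega> n E F = {\<Delta> \<in> klin_hom K \<Omega> E F.
     \<exists>T \<in> lin_hom \<Omega> (Jn K \<Omega> n (base_module E)) F.
       \<forall>e \<in> carrier E. T (jn K \<Omega> n (base_module E) (Base e)) = \<Delta> e}"

text \<open>\<open>Diff_below \<dots> n\<close> is \<open>Diff\<^sup>n\<^sup>-\<^sup>1\<close>, including the case \<open>Diff\<^sup>-\<^sup>1 = 0\<close>.\<close>

definition Diff_below ::
  "'k ring \<Rightarrow> ('k, 'w) dga \<Rightarrow> nat \<Rightarrow> ('w, 'e) module \<Rightarrow> ('w, 'f) module \<Rightarrow> ('e \<Rightarrow> 'f) set" where
  "Diff_below K \<Omega> n E F =
     (case n of 0 \<Rightarrow> {\<lambda>e \<in> carrier E. \<zero>\<^bsub>F\<^esub>} | Suc m \<Rightarrow> Diff K \<Omega> m E F)"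

definition EndK :: "'k ring \<Rightarrow> ('k, 'w) dga \<Rightarrow> ('w, 'e) module \<Rightarrow> ('k, 'e \<Rightarrow> 'e) module" where
  "EndK K \<Omega> E =
     \<lparr>carrier = klin_hom K \<Omega> E E, mult = compose (carrier E), one = (\<lambda>e \<in> carrier E. e),
      zero = (\<lambda>e \<in> carrier E. \<zero>\<^bsub>E\<^esub>), add = (\<lambda>f g. \<lambda>e \<in> carrier E. f e \<oplus>\<^bsub>E\<^esub> g e),
      smult = (\<lambda>c f. \<lambda>e \<in> carrier E. kact \<Omega> E c (f e))\<rparr>"

definition symbol ::
  "'k ring \<Rightarrow> ('k, 'w) dga \<Rightarrow> ('w, 'e) module \<Rightarrow> nat \<Rightarrow> ('e \<Rightarrow> 'e) \<Rightarrow> ('e \<Rightarrow> 'e) set" where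
  "symbol K \<Omega> E n \<Delta> = Diff_below K \<Omega> n E E +>\<^bsub>EndK K \<Omega> E\<^esub> \<Delta>"

definition Symb ::
  "'k ring \<Rightarrow> ('k, 'w) dga \<Rightarrow> ('w, 'e) module \<Rightarrow> nat \<Rightarrow> ('e \<Rightarrow> 'e) set set" where
  "Symb K \<Omega> E n = symbol K \<Omega> E n ` Diff K \<Omega> n E E"

text \<open>Operations on cosets are formed from all representatives, as in \<^const>\<open>rcoset_mult\<close>.\<close>

definition symbol_smult ::
  "'k ring \<Rightarrow> ('k, 'w) dga \<Rightarrow> ('w, 'e) module \<Rightarrow> nat \<Rightarrow> 'k \<Rightarrow> ('e \<Rightarrow> 'e) set \<Rightarrow> ('e \<Rightarrow> 'e) set" where
  "symbol_smult K \<Omega> E n c U = (\<Union>\<Delta>\<in>U. symbol K \<Omega> E n (c \<odot>\<^bsub>EndK K \<Omega> E\<^esub> \<Delta>))"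

definition symbol_mult ::
  "'k ring \<Rightarrow> ('k, 'w) dga \<Rightarrow> ('w, 'e) module \<Rightarrow> nat \<Rightarrow> nat \<Rightarrow>
   ('e \<Rightarrow> 'e) set \<Rightarrow> ('e \<Rightarrow> 'e) set \<Rightarrow> ('e \<Rightarrow> 'e) set" where
  "symbol_mult K \<Omega> E n m U V =
     (\<Union>\<Delta>\<^sub>1\<in>U. \<Union>\<Delta>\<^sub>2\<in>V. symbol K \<Omega> E (n + m) (\<Delta>\<^sub>1 \<otimes>\<^bsub>EndK K \<Omega> E\<^esub> \<Delta>\<^sub>2))"

definition symbol_postcomp ::
  "'k ring \<Rightarrow> ('k, 'w) dga \<Rightarrow> ('w, 'e) module \<Rightarrow> nat \<Rightarrow>
   ('e \<Rightarrow> 'e) \<Rightarrow> ('e \<Rightarrow> 'e) set \<Rightarrow> ('e \<Rightarrow> 'e) set" where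
  "symbol_postcomp K \<Omega> E n f U = (\<Union>\<Delta>\<in>U. symbol K \<Omega> E n (f \<otimes>\<^bsub>EndK K \<Omega> E\<^esub> \<Delta>))"

text \<open>The direct sum of all \<open>Symb\<^sup>n\<close>: finitely supported families. The zero of \<open>Symb\<^sup>n\<close> is the
  coset \<open>Diff\<^sup>n\<^sup>-\<^sup>1\<close>.\<close>

definition symb_module ::
  "'k ring \<Rightarrow> ('k, 'w) dga \<Rightarrow> ('w, 'e) module \<Rightarrow> ('k, nat \<Rightarrow> ('e \<Rightarrow> 'e) set) module" where
  "symb_module K \<Omega> E =
     \<lparr>carrier = {s. (\<forall>n. s n \<in> Symb K \<Omega> E n) \<and> finite {n. s n \<noteq> Diff_below K \<Omega> n E E}},
      mult = undefined, one = undefined,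
      zero = (\<lambda>n. Diff_below K \<Omega> n E E),
      add = (\<lambda>s t n. s n <+>\<^bsub>EndK K \<Omega> E\<^esub> t n),
      smult = (\<lambda>c s n. symbol_smult K \<Omega> E n c (s n))\<rparr>"

definition symb_in ::
  "'k ring \<Rightarrow> ('k, 'w) dga \<Rightarrow> ('w, 'e) module \<Rightarrow> nat \<Rightarrow> ('e \<Rightarrow> 'e) set \<Rightarrow> nat \<Rightarrow> ('e \<Rightarrow> 'e) set" where
  "symb_in K \<Omega> E n U = (\<lambda>m. if m = n then U else Diff_below K \<Omega> m E E)"

text \<open>Extension to finitely supported families \<open>s\<close>, \<open>t\<close> (with zero components \<open>z n\<close>) of a product
  \<open>\<beta> n m\<close> of components of degrees \<open>n\<close> and \<open>m\<close> with values in \<open>G\<close>.\<close>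

definition bilinear_ext ::
  "('g, 'b) ring_scheme \<Rightarrow> (nat \<Rightarrow> 'x) \<Rightarrow> (nat \<Rightarrow> nat \<Rightarrow> 'x \<Rightarrow> 'x \<Rightarrow> 'g) \<Rightarrow>
   (nat \<Rightarrow> 'x) \<Rightarrow> (nat \<Rightarrow> 'x) \<Rightarrow> 'g" where
  "bilinear_ext G z \<beta> s t =
     (\<Oplus>\<^bsub>G\<^esub>n\<in>{n. s n \<noteq> z n}. \<Oplus>\<^bsub>G\<^esub>m\<in>{m. t m \<noteq> z m}. \<beta> n m (s n) (t m))"

definition symb_algebra ::
  "'k ring \<Rightarrow> ('k, 'w) dga \<Rightarrow> ('w, 'e) module \<Rightarrow> ('k, nat \<Rightarrow> ('e \<Rightarrow> 'e) set) module" where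
  "symb_algebra K \<Omega> E = (symb_module K \<Omega> E)
     \<lparr>mult := bilinear_ext (symb_module K \<Omega> E) (\<lambda>n. Diff_below K \<Omega> n E E)
        (\<lambda>n m U V. symb_in K \<Omega> E (n + m) (symbol_mult K \<Omega> E n m U V)),
      one := symb_in K \<Omega> E 0 (symbol K \<Omega> E 0 \<one>\<^bsub>EndK K \<Omega> E\<^esub>)\<rparr>"

text \<open>The direct sum of the \<open>Symb\<^sup>k\<close> with \<open>k < n\<close>.\<close>

definition symb_below ::
  "'k ring \<Rightarrow> ('k, 'w) dga \<Rightarrow> ('w, 'e) module \<Rightarrow> nat \<Rightarrow> (nat \<Rightarrow> ('e \<Rightarrow> 'e) set) set" where
  "symb_below K \<Omega> E n =
     {s \<in> carrier (symb_algebra K \<Omega> E). \<forall>k\<ge>n. s k = Diff_below K \<Omega> k E E}"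

section \<open>Quantizations and star products\<close>

definition quantization ::
  "'k ring \<Rightarrow> ('k, 'w) dga \<Rightarrow> ('w, 'e) module \<Rightarrow> nat \<Rightarrow> (('e \<Rightarrow> 'e) set \<Rightarrow> 'e \<Rightarrow> 'e) \<Rightarrow> bool" where
  "quantization K \<Omega> E n p \<longleftrightarrow>
     p \<in> Symb K \<Omega> E n \<rightarrow> Diff K \<Omega> n E E \<and>
     (\<forall>U \<in> Symb K \<Omega> E n. \<forall>V \<in> Symb K \<Omega> E n.
        p (U <+>\<^bsub>EndK K \<Omega> E\<^esub> V) = p U \<oplus>\<^bsub>EndK K \<Omega> E\<^esub> p V) \<and>
     (\<forall>f \<in> lin_hom \<Omega> E E. \<forall>U \<in> Symb K \<Omega> E n.
        p (symbol_postcomp K \<Omega> E n f U) = f \<otimes>\<^bsub>EndK K \<Omega> E\<^esub> p U) \<and>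
     (\<forall>U \<in> Symb K \<Omega> E n. symbol K \<Omega> E n (p U) = U)"

definition full_quantization ::
  "'k ring \<Rightarrow> ('k, 'w) dga \<Rightarrow> ('w, 'e) module \<Rightarrow> (nat \<Rightarrow> ('e \<Rightarrow> 'e) set \<Rightarrow> 'e \<Rightarrow> 'e) \<Rightarrow> bool" where
  "full_quantization K \<Omega> E q \<longleftrightarrow> (\<forall>n. quantization K \<Omega> E n (q n))"

text \<open>\<open>truncate K \<Omega> E q n \<Delta> k\<close> is \<open>\<Delta>\<^bsub>\<le>k\<^esub>\<close> for an operator \<open>\<Delta>\<close> of order at most \<open>n\<close>.\<close>

function truncate ::
  "'k ring \<Rightarrow> ('k, 'w) dga \<Rightarrow> ('w, 'e) module \<Rightarrow> (nat \<Rightarrow> ('e \<Rightarrow> 'e) set \<Rightarrow> 'e \<Rightarrow> 'e) \<Rightarrow>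
   nat \<Rightarrow> ('e \<Rightarrow> 'e) \<Rightarrow> nat \<Rightarrow> 'e \<Rightarrow> 'e" where
  "truncate K \<Omega> E q n \<Delta> k =
     (if n \<le> k then \<Delta>
      else truncate K \<Omega> E q n \<Delta> (k + 1) \<ominus>\<^bsub>EndK K \<Omega> E\<^esub>
           q (k + 1) (symbol K \<Omega> E (k + 1) (truncate K \<Omega> E q n \<Delta> (k + 1))))"
  by auto
termination
  by (relation "measure (\<lambda>(K, \<Omega>, E, q, n, \<Delta>, k). n - k)") auto

declare truncate.simps [simp del]

text \<open>\<open>star_term K \<Omega> E q n m U V k\<close> is \<open>[q\<^sup>n(U) \<circ> q\<^sup>m(V)]\<^sup>n\<^sup>+\<^sup>m\<^sup>-\<^sup>k\<close>, as an element of the direct sum.\<close>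

definition star_term ::
  "'k ring \<Rightarrow> ('k, 'w) dga \<Rightarrow> ('w, 'e) module \<Rightarrow> (nat \<Rightarrow> ('e \<Rightarrow> 'e) set \<Rightarrow> 'e \<Rightarrow> 'e) \<Rightarrow>
   nat \<Rightarrow> nat \<Rightarrow> ('e \<Rightarrow> 'e) set \<Rightarrow> ('e \<Rightarrow> 'e) set \<Rightarrow> nat \<Rightarrow> nat \<Rightarrow> ('e \<Rightarrow> 'e) set" where
  "star_term K \<Omega> E q n m U V k =
     symb_in K \<Omega> E (n + m - k) (symbol K \<Omega> E (n + m - k)
       (truncate K \<Omega> E q (n + m) (q n U \<otimes>\<^bsub>EndK K \<Omega> E\<^esub> q m V) (n + m - k)))"

definition star_algebra ::
  "'k ring \<Rightarrow> ('k, 'w) dga \<Rightarrow> ('w, 'e) module \<Rightarrow> (nat \<Rightarrow> ('e \<Rightarrow> 'e) set \<Rightarrow> 'e \<Rightarrow> 'e) \<Rightarrow> 'k \<Rightarrow>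
   ('k, nat \<Rightarrow> ('e \<Rightarrow> 'e) set) module" where
  "star_algebra K \<Omega> E q hbar = (symb_algebra K \<Omega> E)
     \<lparr>mult := bilinear_ext (symb_algebra K \<Omega> E) (\<lambda>n. Diff_below K \<Omega> n E E)
        (\<lambda>n m U V. \<Oplus>\<^bsub>symb_algebra K \<Omega> E\<^esub>k\<in>{..n + m}.
           (hbar [^]\<^bsub>K\<^esub> k) \<odot>\<^bsub>symb_algebra K \<Omega> E\<^esub> star_term K \<Omega> E q n m U V k)\<rparr>"

text \<open>\<open>M[h] = M \<otimes> \<k>[h]\<close> is realised by finitely supported coefficient sequences,
  \<open>up M\<close>.\<close>

definition poly_module :: "('k, 'm) module \<Rightarrow> ('k, nat \<Rightarrow> 'm) module" where
  "poly_module M =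
     \<lparr>carrier = up M, mult = undefined, one = undefined, zero = (\<lambda>i. \<zero>\<^bsub>M\<^esub>),
      add = (\<lambda>x y i. x i \<oplus>\<^bsub>M\<^esub> y i), smult = (\<lambda>c x i. c \<odot>\<^bsub>M\<^esub> x i)\<rparr>"

definition hmonom :: "('k, 'm) module \<Rightarrow> nat \<Rightarrow> 'm \<Rightarrow> nat \<Rightarrow> 'm" where
  "hmonom M l s = (\<lambda>i. if i = l then s else \<zero>\<^bsub>M\<^esub>)"

definition hshift :: "('k, 'm) module \<Rightarrow> nat \<Rightarrow> (nat \<Rightarrow> 'm) \<Rightarrow> nat \<Rightarrow> 'm" where
  "hshift M l x = (\<lambda>i. if i < l then \<zero>\<^bsub>M\<^esub> else x (i - l))"

text \<open>\<open>(h\<^sup>i a, h\<^sup>j b) \<mapsto> h\<^sup>i\<^sup>+\<^sup>j (\<Sum>\<^sub>k h\<^sup>k [q\<^sup>n(a) \<circ> q\<^sup>m(b)]\<^sup>n\<^sup>+\<^sup>m\<^sup>-\<^sup>k)\<close>, extended bilinearly first over the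
  degrees \<open>n\<close>, \<open>m\<close> and then over the powers \<open>i\<close>, \<open>j\<close> of \<open>h\<close>.\<close>

definition formal_star_algebra ::
  "'k ring \<Rightarrow> ('k, 'w) dga \<Rightarrow> ('w, 'e) module \<Rightarrow> (nat \<Rightarrow> ('e \<Rightarrow> 'e) set \<Rightarrow> 'e \<Rightarrow> 'e) \<Rightarrow>
   ('k, nat \<Rightarrow> nat \<Rightarrow> ('e \<Rightarrow> 'e) set) module" where
  "formal_star_algebra K \<Omega> E q =
     (let S = symb_algebra K \<Omega> E; H = poly_module S in H
        \<lparr>mult := bilinear_ext H (\<lambda>i. \<zero>\<^bsub>S\<^esub>)
           (\<lambda>i j a b. hshift S (i + j)
              (bilinear_ext H (\<lambda>n. Diff_below K \<Omega> n E E)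
                 (\<lambda>n m U V. \<Oplus>\<^bsub>H\<^esub>k\<in>{..n + m}. hmonom S k (star_term K \<Omega> E q n m U V k))
                 a b)),
         one := hmonom S 0 \<one>\<^bsub>S\<^esub>\<rparr>)"

text \<open>The element \<open>h - hbar\<close> of \<open>\<k>[h]\<close>, acting on the unit of the formal star algebra.\<close>

definition h_minus ::
  "'k ring \<Rightarrow> ('k, 'w) dga \<Rightarrow> ('w, 'e) module \<Rightarrow> (nat \<Rightarrow> ('e \<Rightarrow> 'e) set \<Rightarrow> 'e \<Rightarrow> 'e) \<Rightarrow> 'k \<Rightarrow>
   nat \<Rightarrow> nat \<Rightarrow> ('e \<Rightarrow> 'e) set" where
  "h_minus K \<Omega> E q hbar =
     (let S = symb_algebra K \<Omega> E; H = formal_star_algebra K \<Omega> E q in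
        hmonom S 1 \<one>\<^bsub>S\<^esub> \<ominus>\<^bsub>H\<^esub> hbar \<odot>\<^bsub>H\<^esub> \<one>\<^bsub>H\<^esub>)"

section \<open>Filtered algebras, quotient algebras and isomorphisms\<close>

locale filtered_algebra = assoc_algebra K R for K and R (structure) +
  fixes F :: "nat \<Rightarrow> _ set"
  assumes filtration_submodule: "submodule (F n) K R"
    and filtration_mono: "F n \<subseteq> F (Suc n)"
    and filtration_exhaustive: "(\<Union>n. F n) = carrier R"
    and filtration_one: "\<one> \<in> F 0"
    and filtration_mult: "\<lbrakk>x \<in> F m; y \<in> F n\<rbrakk> \<Longrightarrow> x \<otimes> y \<in> F (m + n)"

definition quotient_algebra :: "('k, 'r) module \<Rightarrow> 'r set \<Rightarrow> ('k, 'r set) module" where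
  "quotient_algebra R I = ring.extend (R Quot I)
     (module.fields (\<lambda>c U. \<Union>x\<in>U. I +>\<^bsub>R\<^esub> (c \<odot>\<^bsub>R\<^esub> x)))"

definition algebra_iso :: "'k ring \<Rightarrow> ('k, 'r) module \<Rightarrow> ('k, 's) module \<Rightarrow> ('r \<Rightarrow> 's) set" where
  "algebra_iso K R S = {f \<in> ring_iso R S.
     \<forall>c \<in> carrier K. \<forall>x \<in> carrier R. f (c \<odot>\<^bsub>R\<^esub> x) = c \<odot>\<^bsub>S\<^esub> f x}"

end

theory Submission
  imports Defs
begin

text \<open>A first jet is determined by the pair consisting of its value and its differential, and with this
  description the holonomy conditions that cut \<open>J\<^sup>n\<close> out of \<open>J\<^sup>1 J\<^sup>n\<^sup>-\<^sup>1\<close> are natural. An \<open>A\<close>-linear map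
  \<open>J\<^sup>m E \<rightarrow> E\<close> therefore prolongs to \<open>J\<^sup>n\<^sup>+\<^sup>m E \<rightarrow> J\<^sup>n E\<close>, so orders of differential operators add under composition.

  A quantization identifies an operator \<open>\<Delta>\<close> of order \<open>n\<close> with \<open>\<Sum>\<^sub>k q\<^sup>k([\<Delta>]\<^sup>k)\<close>. Consequently the linear map
  \<open>\<Phi>\<close> from \<open>Symb[h]\<close> to the polynomials in \<open>t\<close> over all operators that sends \<open>h\<^sup>i a\<close>, with \<open>a\<close> of degree \<open>n\<close>,
  to \<open>q\<^sup>n(a) t\<^sup>i\<^sup>+\<^sup>n\<close> is injective and multiplicative for the formal star product, from which associativity is inherited.
  Modulo the central element \<open>h - hbar\<close> every element of \<open>Symb[h]\<close> is congruent to its value at \<open>hbar\<close>;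
  evaluation is thus a surjective homomorphism onto the star product at \<open>hbar\<close>, with kernel generated by \<open>h - hbar\<close>.\<close>

section \<open>Sums over lists\<close>

text \<open>For a fixed scalar hbar there is an obvious candidate for a direct proof: sending a
  symbol \<open>a\<close> of degree n to \<open>hbar^n q^n(a)\<close> is multiplicative, since the
  k-th term of the star product carries \<open>hbar^k\<close> and has degree n + m - k. But this map
  is injective only in special cases; for hbar = 0 it kills all positive degrees. So associativity
  cannot be pulled back along it, and the formal parameter is introduced first. With
  \<open>h\<close> in place of hbar no information is lost: among the terms with exponent N of
  \<open>t\<close>, the degree n determines the power N - n of \<open>h\<close>.

  On the side of jets the difficulty is the encoding. Jets store representatives chosen by
  \<open>SOME\<close>, and \<open>J^1\<close> of an injective map need not be injective, so
  \<open>l^n\<close> cannot be ignored even though it is the identity on carriers. Tensor products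
  are therefore handled through their universal property, and inclusions through the naturality of
  \<open>J1_map\<close>.\<close>

definition lsum :: "('g, 'b) ring_scheme \<Rightarrow> ('x \<Rightarrow> 'g) \<Rightarrow> 'x list \<Rightarrow> 'g" where
  "lsum G f xs = foldr (\<lambda>x s. f x \<oplus>\<^bsub>G\<^esub> s) xs \<zero>\<^bsub>G\<^esub>"

lemma lsum_Nil [simp]: "lsum G f [] = \<zero>\<^bsub>G\<^esub>"
  and lsum_Cons [simp]: "lsum G f (x # xs) = f x \<oplus>\<^bsub>G\<^esub> lsum G f xs"
  by (simp_all add: lsum_def)

lemma lsum_map: "lsum G f (map g xs) = lsum G (\<lambda>x. f (g x)) xs"
  by (induction xs) auto

lemma (in abelian_monoid) lsum_closed [simp]:
  "(\<And>x. x \<in> set xs \<Longrightarrow> f x \<in> carrier G) \<Longrightarrow> lsum G f xs \<in> carrier G"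
  by (induction xs) auto

lemma (in abelian_monoid) lsum_append:
  "(\<And>x. x \<in> set xs \<union> set ys \<Longrightarrow> f x \<in> carrier G) \<Longrightarrow>
    lsum G f (xs @ ys) = lsum G f xs \<oplus> lsum G f ys"
  by (induction xs) (auto simp: a_assoc)

lemma additive_zero:
  assumes "abelian_group G" "abelian_group H" "h \<in> carrier G \<rightarrow> carrier H"
    and "\<And>x y. x \<in> carrier G \<Longrightarrow> y \<in> carrier G \<Longrightarrow> h (x \<oplus>\<^bsub>G\<^esub> y) = h x \<oplus>\<^bsub>H\<^esub> h y"
  shows "h \<zero>\<^bsub>G\<^esub> = \<zero>\<^bsub>H\<^esub>"
proof -
  interpret G: abelian_group G by fact
  interpret H: abelian_group H by fact
  have c: "h \<zero>\<^bsub>G\<^esub> \<in> carrier H" using assms(3) by auto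
  have "h \<zero>\<^bsub>G\<^esub> \<oplus>\<^bsub>H\<^esub> h \<zero>\<^bsub>G\<^esub> = h \<zero>\<^bsub>G\<^esub>" using assms(4)[of "\<zero>\<^bsub>G\<^esub>" "\<zero>\<^bsub>G\<^esub>"] by simp
  then show ?thesis using c by simp
qed

lemma additive_a_inv:
  assumes "abelian_group G" "abelian_group H" "h \<in> carrier G \<rightarrow> carrier H"
    and "\<And>x y. x \<in> carrier G \<Longrightarrow> y \<in> carrier G \<Longrightarrow> h (x \<oplus>\<^bsub>G\<^esub> y) = h x \<oplus>\<^bsub>H\<^esub> h y"
    and x: "x \<in> carrier G"
  shows "h (\<ominus>\<^bsub>G\<^esub> x) = \<ominus>\<^bsub>H\<^esub> h x"
proof -
  interpret G: abelian_group G by fact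
  interpret H: abelian_group H by fact
  have c: "h x \<in> carrier H" "h (\<ominus>\<^bsub>G\<^esub> x) \<in> carrier H" using assms(3) x by auto
  have "h (\<ominus>\<^bsub>G\<^esub> x) \<oplus>\<^bsub>H\<^esub> h x = \<zero>\<^bsub>H\<^esub>"
    using assms(4)[of "\<ominus>\<^bsub>G\<^esub> x" x] x additive_zero[OF assms(1-4)] by (simp add: G.l_neg)
  then show ?thesis using c H.minus_equality by metis
qed

section \<open>The tensor product as a group\<close>

text \<open>Serves for both tensor products: with \<open>S\<close> the scalars for
  \<open>A \<otimes> M\<close> over the base ring, and with \<open>S = A\<close> for forms with
  values in a module. The closure conditions keep the congruence inside formal sums over the
  carriers.\<close>

locale tensor = U?: abelian_group U + V?: abelian_group V
  for S :: "'r set" and U :: "('x, 'b) ring_scheme" and r :: "'x \<Rightarrow> 'r \<Rightarrow> 'x"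
    and V :: "('m, 'c) ring_scheme" and l :: "'r \<Rightarrow> 'm \<Rightarrow> 'm" +
  assumes r_closed: "x \<in> carrier U \<Longrightarrow> s \<in> S \<Longrightarrow> r x s \<in> carrier U"
    and l_closed: "y \<in> carrier V \<Longrightarrow> s \<in> S \<Longrightarrow> l s y \<in> carrier V"
begin

abbreviation eq (infix "\<approx>" 50) where "xs \<approx> ys \<equiv> tensor_eq S U r V l xs ys"

definition wf_sum :: "('x \<times> 'm) list \<Rightarrow> bool" where
  "wf_sum xs \<longleftrightarrow> set xs \<subseteq> carrier U \<times> carrier V"

lemma wf_sum_simps [simp]:
  "wf_sum []" "wf_sum (p # xs) \<longleftrightarrow> fst p \<in> carrier U \<and> snd p \<in> carrier V \<and> wf_sum xs"
  "wf_sum (xs @ ys) \<longleftrightarrow> wf_sum xs \<and> wf_sum ys"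
  by (auto simp: wf_sum_def mem_Times_iff)

lemma eq_wf: "xs \<approx> ys \<Longrightarrow> wf_sum xs \<and> wf_sum ys"
  by (induction rule: tensor_eq.induct) (auto simp: wf_sum_def r_closed l_closed)

lemma eq_refl: "wf_sum xs \<Longrightarrow> xs \<approx> xs"
  by (simp add: wf_sum_def tensor_eq.refl)

definition cls :: "('x \<times> 'm) list \<Rightarrow> ('x \<times> 'm) list set" where
  "cls xs = {ys. xs \<approx> ys}"

lemma cls_eq_iff: assumes w: "wf_sum xs" shows "cls xs = cls ys \<longleftrightarrow> xs \<approx> ys"
proof
  show "cls xs = cls ys \<Longrightarrow> xs \<approx> ys"
    using eq_refl[OF w] eq_wf tensor_eq.sym unfolding cls_def by blast
  show "xs \<approx> ys \<Longrightarrow> cls xs = cls ys"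
    unfolding cls_def using tensor_eq.sym tensor_eq.trans by blast
qed

text \<open>Addition concatenates representatives picked by \<open>SOME\<close>. The rule
  \<open>append\<close> of the congruence makes the choice immaterial, and \<open>commute\<close>
  makes the group abelian.\<close>

definition grp :: "('x \<times> 'm) list set ring" where
  "grp = \<lparr>carrier = cls ` {xs. wf_sum xs}, mult = undefined, one = undefined, zero = cls [],
     add = (\<lambda>X Y. cls ((SOME xs. xs \<in> X) @ (SOME ys. ys \<in> Y)))\<rparr>"

lemma some_cls: "wf_sum xs \<Longrightarrow> xs \<approx> (SOME ys. ys \<in> cls xs)"
  using someI[of "\<lambda>ys. ys \<in> cls xs" xs] eq_refl[of xs] by (simp add: cls_def)

lemma cls_closed [simp]: "wf_sum xs \<Longrightarrow> cls xs \<in> carrier grp"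
  by (simp add: grp_def)

lemma grp_cases: "t \<in> carrier grp \<Longrightarrow> (\<And>xs. wf_sum xs \<Longrightarrow> t = cls xs \<Longrightarrow> P) \<Longrightarrow> P"
  by (auto simp: grp_def)

lemma cls_Nil: "cls [] = \<zero>\<^bsub>grp\<^esub>"
  by (simp add: grp_def)

lemma cls_append: "wf_sum xs \<Longrightarrow> wf_sum ys \<Longrightarrow> cls (xs @ ys) = cls xs \<oplus>\<^bsub>grp\<^esub> cls ys"
  by (simp add: grp_def cls_eq_iff some_cls tensor_eq.append)

text \<open>Supplies inverses although formal sums have no negative coefficients: negate the left
  factors. Each head cancels against its negative once it has been moved past the negated
  tail.\<close>

lemma cls_neg:
  assumes "wf_sum xs"
  shows "cls (map (\<lambda>(x, y). (\<ominus>\<^bsub>U\<^esub> x, y)) xs) \<oplus>\<^bsub>grp\<^esub> cls xs = \<zero>\<^bsub>grp\<^esub>"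
    (is "cls (?n xs) \<oplus>\<^bsub>grp\<^esub> _ = _")
proof -
  have "?n xs @ xs \<approx> []" using assms
  proof (induction xs)
    case Nil
    then show ?case by (simp add: eq_refl)
  next
    case (Cons p xs)
    obtain x y where p: "p = (x, y)" by (cases p)
    then have xy: "x \<in> carrier U" "y \<in> carrier V" and w: "wf_sum xs" using Cons.prems by auto
    have wn: "wf_sum (?n xs)" using w by (auto simp: wf_sum_def)
    have 1: "[(\<ominus>\<^bsub>U\<^esub> x, y)] @ [(x, y)] \<approx> []"
      using tensor_eq.add_left[of "\<ominus>\<^bsub>U\<^esub> x" U x y V] xy tensor_eq.zero_left[of y V]
      by (metis (no_types) U.a_inv_closed U.l_neg append_Cons append_Nil tensor_eq.sym tensor_eq.trans)
    have 2: "(?n xs @ [(x, y)]) @ xs \<approx> ([(x, y)] @ ?n xs) @ xs"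
      by (rule tensor_eq.append[OF tensor_eq.commute eq_refl]) (use wn w xy in \<open>auto simp: wf_sum_def\<close>)
    have 3: "([(\<ominus>\<^bsub>U\<^esub> x, y)] @ [(x, y)]) @ (?n xs @ xs) \<approx> [] @ []"
      by (rule tensor_eq.append[OF 1 Cons.IH[OF w]])
    have "[(\<ominus>\<^bsub>U\<^esub> x, y)] @ ((?n xs @ [(x, y)]) @ xs) \<approx> [(\<ominus>\<^bsub>U\<^esub> x, y)] @ (([(x, y)] @ ?n xs) @ xs)"
      by (rule tensor_eq.append[OF eq_refl 2]) (use xy in auto)
    from tensor_eq.trans[OF this] 3 show ?case by (simp add: p)
  qed
  moreover have "wf_sum (?n xs)" using assms by (auto simp: wf_sum_def)
  ultimately show ?thesis using assms
    by (simp add: cls_append[symmetric] cls_Nil[symmetric] cls_eq_iff)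
qed

sublocale grp: abelian_group grp
proof (rule abelian_groupI)
  show "\<zero>\<^bsub>grp\<^esub> \<in> carrier grp" by (simp add: cls_Nil[symmetric])
next
  fix x y assume "x \<in> carrier grp" "y \<in> carrier grp"
  then obtain xs ys where x: "wf_sum xs" "x = cls xs" and y: "wf_sum ys" "y = cls ys"
    by (metis grp_cases)
  show "x \<oplus>\<^bsub>grp\<^esub> y \<in> carrier grp" using x y by (simp add: cls_append[symmetric])
  show "x \<oplus>\<^bsub>grp\<^esub> y = y \<oplus>\<^bsub>grp\<^esub> x"
    using x y by (simp add: cls_append[symmetric] cls_eq_iff tensor_eq.commute wf_sum_def)
  fix z assume "z \<in> carrier grp"
  then obtain zs where z: "wf_sum zs" "z = cls zs" by (metis grp_cases)
  show "x \<oplus>\<^bsub>grp\<^esub> y \<oplus>\<^bsub>grp\<^esub> z = x \<oplus>\<^bsub>grp\<^esub> (y \<oplus>\<^bsub>grp\<^esub> z)"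
    using x y z by (simp add: cls_append[symmetric])
next
  fix x assume "x \<in> carrier grp"
  then obtain xs where x: "wf_sum xs" "x = cls xs" by (metis grp_cases)
  show "\<zero>\<^bsub>grp\<^esub> \<oplus>\<^bsub>grp\<^esub> x = x"
    using x by (simp add: cls_append[symmetric] cls_Nil[symmetric])
  have "wf_sum (map (\<lambda>(x, y). (\<ominus>\<^bsub>U\<^esub> x, y)) xs)" using x(1) by (auto simp: wf_sum_def)
  then show "\<exists>y\<in>carrier grp. y \<oplus>\<^bsub>grp\<^esub> x = \<zero>\<^bsub>grp\<^esub>"
    using cls_neg[OF x(1)] cls_closed unfolding x(2) by blast
qed

definition ten :: "'x \<Rightarrow> 'm \<Rightarrow> ('x \<times> 'm) list set" where
  "ten x y = cls [(x, y)]"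

lemma ten_closed [simp]: "x \<in> carrier U \<Longrightarrow> y \<in> carrier V \<Longrightarrow> ten x y \<in> carrier grp"
  by (simp add: ten_def)

lemma ten_add_left: "x \<in> carrier U \<Longrightarrow> x' \<in> carrier U \<Longrightarrow> y \<in> carrier V \<Longrightarrow>
    ten (x \<oplus>\<^bsub>U\<^esub> x') y = ten x y \<oplus>\<^bsub>grp\<^esub> ten x' y"
  by (simp add: ten_def cls_append[symmetric] cls_eq_iff tensor_eq.add_left)

lemma ten_add_right: "x \<in> carrier U \<Longrightarrow> y \<in> carrier V \<Longrightarrow> y' \<in> carrier V \<Longrightarrow>
    ten x (y \<oplus>\<^bsub>V\<^esub> y') = ten x y \<oplus>\<^bsub>grp\<^esub> ten x y'"
  by (simp add: ten_def cls_append[symmetric] cls_eq_iff tensor_eq.add_right)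

lemma ten_balanced: "s \<in> S \<Longrightarrow> x \<in> carrier U \<Longrightarrow> y \<in> carrier V \<Longrightarrow> ten (r x s) y = ten x (l s y)"
  by (simp add: ten_def cls_eq_iff tensor_eq.balanced r_closed)

lemma ten_minus_left: "x \<in> carrier U \<Longrightarrow> y \<in> carrier V \<Longrightarrow> ten (\<ominus>\<^bsub>U\<^esub> x) y = \<ominus>\<^bsub>grp\<^esub> ten x y"
  by (rule additive_a_inv[OF U.abelian_group_axioms grp.abelian_group_axioms, where h = "\<lambda>x. ten x y"])
    (auto simp: ten_add_left)

lemma cls_lsum: "wf_sum xs \<Longrightarrow> cls xs = lsum grp (\<lambda>(x, y). ten x y) xs"
proof (induction xs)
  case (Cons p xs)
  then show ?case using cls_append[of "[p]" xs] by (cases p) (auto simp: ten_def)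
qed (simp add: cls_Nil)

definition balanced_map :: "('g, 'd) ring_scheme \<Rightarrow> ('x \<Rightarrow> 'm \<Rightarrow> 'g) \<Rightarrow> bool" where
  "balanced_map G f \<longleftrightarrow> abelian_group G \<and>
    (\<forall>x\<in>carrier U. \<forall>y\<in>carrier V. f x y \<in> carrier G) \<and>
    (\<forall>x\<in>carrier U. \<forall>x'\<in>carrier U. \<forall>y\<in>carrier V. f (x \<oplus>\<^bsub>U\<^esub> x') y = f x y \<oplus>\<^bsub>G\<^esub> f x' y) \<and>
    (\<forall>x\<in>carrier U. \<forall>y\<in>carrier V. \<forall>y'\<in>carrier V. f x (y \<oplus>\<^bsub>V\<^esub> y') = f x y \<oplus>\<^bsub>G\<^esub> f x y') \<and>
    (\<forall>s\<in>S. \<forall>x\<in>carrier U. \<forall>y\<in>carrier V. f (r x s) y = f x (l s y))"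

text \<open>Existence half of the universal property. The generating rules of the congruence are
  identities that a balanced map respects, so induction over the derivation applies.\<close>

lemma balanced_lsum:
  assumes "balanced_map G f" "xs \<approx> ys"
  shows "lsum G (\<lambda>(x, y). f x y) xs = lsum G (\<lambda>(x, y). f x y) ys"
proof -
  interpret G: abelian_group G using assms(1) by (simp add: balanced_map_def)
  note f = assms(1)[unfolded balanced_map_def]
  have cl: "wf_sum xs \<Longrightarrow> p \<in> set xs \<Longrightarrow> (case p of (x, y) \<Rightarrow> f x y) \<in> carrier G" for p xs
    using f by (auto simp: wf_sum_def)
  have ap: "lsum G (\<lambda>(x, y). f x y) (xs @ ys) =
      lsum G (\<lambda>(x, y). f x y) xs \<oplus>\<^bsub>G\<^esub> lsum G (\<lambda>(x, y). f x y) ys"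
    if "wf_sum xs" "wf_sum ys" for xs ys
    by (rule G.lsum_append) (use cl that in blast)
  show ?thesis using assms(2)
  proof (induction rule: tensor_eq.induct)
    case (append xs xs' ys ys')
    then have w: "wf_sum xs" "wf_sum ys" "wf_sum xs'" "wf_sum ys'" using eq_wf by auto
    show ?case by (simp only: ap[OF w(1,2)] ap[OF w(3,4)] append.IH)
  next
    case (commute xs ys)
    then have w: "wf_sum xs" "wf_sum ys" by (auto simp: wf_sum_def)
    show ?case unfolding ap[OF w] ap[OF w(2,1)]
      by (intro G.a_comm G.lsum_closed cl[OF w(1)] cl[OF w(2)])
  next
    case (zero_left y)
    have "f \<zero>\<^bsub>U\<^esub> y = \<zero>\<^bsub>G\<^esub>"
      by (rule additive_zero[OF U.abelian_group_axioms G.abelian_group_axioms, where h = "\<lambda>x. f x y"])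
        (use f zero_left in auto)
    then show ?case by simp
  next
    case (zero_right x)
    have "f x \<zero>\<^bsub>V\<^esub> = \<zero>\<^bsub>G\<^esub>"
      by (rule additive_zero[OF V.abelian_group_axioms G.abelian_group_axioms, where h = "f x"])
        (use f zero_right in auto)
    then show ?case by simp
  qed (use f r_closed l_closed in \<open>auto simp: G.a_assoc\<close>)
qed

definition lift :: "('g, 'd) ring_scheme \<Rightarrow> ('x \<Rightarrow> 'm \<Rightarrow> 'g) \<Rightarrow> ('x \<times> 'm) list set \<Rightarrow> 'g" where
  "lift G f t = lsum G (\<lambda>(x, y). f x y) (SOME xs. xs \<in> t)"

lemma lift_cls: "balanced_map G f \<Longrightarrow> wf_sum xs \<Longrightarrow> lift G f (cls xs) = lsum G (\<lambda>(x, y). f x y) xs"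
  unfolding lift_def by (rule balanced_lsum[symmetric]) (simp_all add: some_cls)

lemma lift_closed [simp]:
  assumes "balanced_map G f" "t \<in> carrier grp" shows "lift G f t \<in> carrier G"
proof -
  interpret G: abelian_group G using assms(1) by (simp add: balanced_map_def)
  from assms(2) obtain xs where "wf_sum xs" "t = cls xs" by (rule grp_cases)
  then show ?thesis using assms(1) by (auto simp: lift_cls wf_sum_def balanced_map_def intro!: G.lsum_closed)
qed

lemma lift_add:
  assumes "balanced_map G f" "t \<in> carrier grp" "t' \<in> carrier grp"
  shows "lift G f (t \<oplus>\<^bsub>grp\<^esub> t') = lift G f t \<oplus>\<^bsub>G\<^esub> lift G f t'"
proof -
  interpret G: abelian_group G using assms(1) by (simp add: balanced_map_def)
  from assms(2) obtain xs where 1: "wf_sum xs" "t = cls xs" by (rule grp_cases)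
  from assms(3) obtain ys where 2: "wf_sum ys" "t' = cls ys" by (rule grp_cases)
  have "lsum G (\<lambda>(x, y). f x y) (xs @ ys) =
      lsum G (\<lambda>(x, y). f x y) xs \<oplus>\<^bsub>G\<^esub> lsum G (\<lambda>(x, y). f x y) ys"
    by (rule G.lsum_append) (use 1 2 assms(1) in \<open>auto simp: wf_sum_def balanced_map_def\<close>)
  then show ?thesis using 1 2 assms(1) cls_append[of xs ys] lift_cls[of G f "xs @ ys"]
    by (simp add: lift_cls)
qed

lemma lift_ten:
  assumes "balanced_map G f" "x \<in> carrier U" "y \<in> carrier V"
  shows "lift G f (ten x y) = f x y"
proof -
  interpret G: abelian_group G using assms(1) by (simp add: balanced_map_def)
  show ?thesis using assms by (simp add: ten_def lift_cls balanced_map_def)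
qed

text \<open>Uniqueness half of the universal property: elementary tensors generate. Identities
  between maps out of a tensor product are reduced to generators by this.\<close>

lemma additive_ext:
  assumes "abelian_group G" "h \<in> carrier grp \<rightarrow> carrier G" "h' \<in> carrier grp \<rightarrow> carrier G"
    and "\<And>t t'. t \<in> carrier grp \<Longrightarrow> t' \<in> carrier grp \<Longrightarrow> h (t \<oplus>\<^bsub>grp\<^esub> t') = h t \<oplus>\<^bsub>G\<^esub> h t'"
    and "\<And>t t'. t \<in> carrier grp \<Longrightarrow> t' \<in> carrier grp \<Longrightarrow> h' (t \<oplus>\<^bsub>grp\<^esub> t') = h' t \<oplus>\<^bsub>G\<^esub> h' t'"
    and "\<And>x y. x \<in> carrier U \<Longrightarrow> y \<in> carrier V \<Longrightarrow> h (ten x y) = h' (ten x y)"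
    and "t \<in> carrier grp"
  shows "h t = h' t"
proof -
  from assms(7) obtain xs where xs: "wf_sum xs" "t = cls xs" by (rule grp_cases)
  have z: "h \<zero>\<^bsub>grp\<^esub> = h' \<zero>\<^bsub>grp\<^esub>"
    using additive_zero[where h = h and G = grp and H = G, OF grp.abelian_group_axioms assms(1) assms(2) assms(4)]
      additive_zero[where h = h' and G = grp and H = G, OF grp.abelian_group_axioms assms(1) assms(3) assms(5)] by (simp only:)
  have "h (cls xs) = h' (cls xs)" using xs(1)
  proof (induction xs)
    case Nil
    then show ?case using z by (simp only: cls_Nil)
  next
    case (Cons p xs)
    have "cls (p # xs) = ten (fst p) (snd p) \<oplus>\<^bsub>grp\<^esub> cls xs"
      using Cons.prems cls_append[of "[p]" xs] by (simp add: ten_def)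
    moreover have c: "wf_sum xs" "fst p \<in> carrier U" "snd p \<in> carrier V" using Cons.prems by simp_all
    ultimately show ?case
      by (simp only: assms(4)[OF ten_closed[OF c(2,3)] cls_closed[OF c(1)]]
        assms(5)[OF ten_closed[OF c(2,3)] cls_closed[OF c(1)]] assms(6)[OF c(2,3)] Cons.IH[OF c(1)])
  qed
  then show ?thesis by (simp only: xs(2))
qed

end

section \<open>Forms with values in a module\<close>

context exterior_algebra
begin

lemma deg0_simps [simp]:
  "carrier (deg0 \<Omega>) = grd \<Omega> 0" "mult (deg0 \<Omega>) = mult \<Omega>" "one (deg0 \<Omega>) = one \<Omega>"
  "zero (deg0 \<Omega>) = zero \<Omega>" "add (deg0 \<Omega>) = add \<Omega>"
  by (simp_all add: deg0_def)

lemma grd_subset: "x \<in> grd \<Omega> n \<Longrightarrow> x \<in> carrier \<Omega>"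
  using submoduleE(1)[OF grd_submodule] by auto

lemma grd_zero [simp]: "\<zero> \<in> grd \<Omega> n"
  and grd_add [simp]: "x \<in> grd \<Omega> n \<Longrightarrow> y \<in> grd \<Omega> n \<Longrightarrow> x \<oplus> y \<in> grd \<Omega> n"
  and grd_minus [simp]: "x \<in> grd \<Omega> n \<Longrightarrow> \<ominus> x \<in> grd \<Omega> n"
  and grd_smult [simp]: "c \<in> carrier K \<Longrightarrow> x \<in> grd \<Omega> n \<Longrightarrow> c \<odot> x \<in> grd \<Omega> n"
proof -
  interpret g: submodule "grd \<Omega> n" K \<Omega> by (rule grd_submodule)
  show "\<zero> \<in> grd \<Omega> n" using g.one_closed by simp
  show "x \<in> grd \<Omega> n \<Longrightarrow> y \<in> grd \<Omega> n \<Longrightarrow> x \<oplus> y \<in> grd \<Omega> n" using g.m_closed by simp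
  show "x \<in> grd \<Omega> n \<Longrightarrow> \<ominus> x \<in> grd \<Omega> n" using g.m_inv_closed by (simp add: a_inv_def)
  show "c \<in> carrier K \<Longrightarrow> x \<in> grd \<Omega> n \<Longrightarrow> c \<odot> x \<in> grd \<Omega> n" by simp
qed

lemma mult_grd': "x \<in> grd \<Omega> (n - m) \<Longrightarrow> y \<in> grd \<Omega> (m - k) \<Longrightarrow> m \<le> n \<Longrightarrow> k \<le> m \<Longrightarrow> x \<otimes> y \<in> grd \<Omega> (n - k)"
  using mult_grd[of x "n - m" y "m - k"] by simp

lemma mult_grd0 [simp]:
  "x \<in> grd \<Omega> 0 \<Longrightarrow> y \<in> grd \<Omega> n \<Longrightarrow> x \<otimes> y \<in> grd \<Omega> n"
  "x \<in> grd \<Omega> n \<Longrightarrow> y \<in> grd \<Omega> 0 \<Longrightarrow> x \<otimes> y \<in> grd \<Omega> n"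
  using mult_grd[of x 0 y n] mult_grd[of x n y 0] by auto

lemma dif_grd1 [simp]: "x \<in> grd \<Omega> 0 \<Longrightarrow> dif \<Omega> x \<in> grd \<Omega> 1"
  using dif_grd[of x 0] by simp

lemma dif_grd2 [simp]: "x \<in> grd \<Omega> 1 \<Longrightarrow> dif \<Omega> x \<in> grd \<Omega> 2"
  using dif_grd[of x 1] by (simp add: numeral_2_eq_2)

lemma grd_group: "abelian_group (\<Omega>\<lparr>carrier := grd \<Omega> n\<rparr>)"
proof (rule abelian_groupI)
  fix x assume "x \<in> carrier (\<Omega>\<lparr>carrier := grd \<Omega> n\<rparr>)"
  then show "\<exists>y\<in>carrier (\<Omega>\<lparr>carrier := grd \<Omega> n\<rparr>). y \<oplus>\<^bsub>\<Omega>\<lparr>carrier := grd \<Omega> n\<rparr>\<^esub> x = \<zero>\<^bsub>\<Omega>\<lparr>carrier := grd \<Omega> n\<rparr>\<^esub>"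
    using l_neg[OF grd_subset] by (auto intro!: bexI[of _ "\<ominus> x"])
qed (auto simp: a_ac grd_subset)

lemma deg0_ring: "ring (deg0 \<Omega>)"
proof (rule ringI)
  show "abelian_group (deg0 \<Omega>)" using grd_group[of 0] by (simp add: deg0_def)
  show "Group.monoid (deg0 \<Omega>)" by (rule monoidI) (auto simp: m_assoc one_grd grd_subset)
qed (auto simp: l_distr r_distr grd_subset)

text \<open>\<open>a_inv\<close> is chosen inside the carrier of its record, so the negative in the
  record restricted to one degree has to be compared with the negative in
  \<open>\<Omega>\<close>.\<close>

lemma grd_a_inv: "x \<in> grd \<Omega> n \<Longrightarrow> \<ominus>\<^bsub>\<Omega>\<lparr>carrier := grd \<Omega> n\<rparr>\<^esub> x = \<ominus> x"
  by (rule abelian_group.minus_equality[OF grd_group]) (auto simp: l_neg grd_subset)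

lemma scalar_grd: "c \<in> carrier K \<Longrightarrow> c \<odot> \<one> \<in> grd \<Omega> 0"
  by (simp add: one_grd)

lemma scalar_mult: "c \<in> carrier K \<Longrightarrow> x \<in> carrier \<Omega> \<Longrightarrow> (c \<odot> \<one>) \<otimes> x = c \<odot> x"
  "c \<in> carrier K \<Longrightarrow> x \<in> carrier \<Omega> \<Longrightarrow> x \<otimes> (c \<odot> \<one>) = c \<odot> x"
  by (auto simp: smult_mult_left smult_mult_right)

definition wf_forms :: "nat \<Rightarrow> ('w, 'm) module \<Rightarrow> ('w \<times> 'm) list \<Rightarrow> bool" where
  "wf_forms k M xs \<longleftrightarrow> set xs \<subseteq> grd \<Omega> k \<times> carrier M"

lemma wf_forms_simps [simp]:
  "wf_forms k M []" "wf_forms k M (p # xs) \<longleftrightarrow> fst p \<in> grd \<Omega> k \<and> snd p \<in> carrier M \<and> wf_forms k M xs"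
  "wf_forms k M (xs @ ys) \<longleftrightarrow> wf_forms k M xs \<and> wf_forms k M ys"
  by (auto simp: wf_forms_def mem_Times_iff)

text \<open>The group \<open>\<Omega>^k \<otimes>_A M\<close>. Naming it, its elementary tensors and
  its lifts hides the five parameters of the tensor locale.\<close>

definition T :: "nat \<Rightarrow> ('w, 'm) module \<Rightarrow> ('w \<times> 'm) list set ring" where
  "T k M = tensor.grp (carrier (deg0 \<Omega>)) (\<Omega>\<lparr>carrier := grd \<Omega> k\<rparr>) (\<lambda>w a. w \<otimes> a) M (smult M)"

definition ten :: "nat \<Rightarrow> ('w, 'm) module \<Rightarrow> 'w \<Rightarrow> 'm \<Rightarrow> ('w \<times> 'm) list set" where
  "ten k M = tensor.ten (carrier (deg0 \<Omega>)) (\<Omega>\<lparr>carrier := grd \<Omega> k\<rparr>) (\<lambda>w a. w \<otimes> a) M (smult M)"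

definition tlift :: "nat \<Rightarrow> ('w, 'm) module \<Rightarrow> ('g, 'd) ring_scheme \<Rightarrow> ('w \<Rightarrow> 'm \<Rightarrow> 'g) \<Rightarrow>
    ('w \<times> 'm) list set \<Rightarrow> 'g" where
  "tlift k M = tensor.lift"

definition balanced :: "nat \<Rightarrow> ('w, 'm) module \<Rightarrow> ('g, 'd) ring_scheme \<Rightarrow> ('w \<Rightarrow> 'm \<Rightarrow> 'g) \<Rightarrow> bool" where
  "balanced k M G f \<longleftrightarrow> abelian_group G \<and>
    (\<forall>x\<in>grd \<Omega> k. \<forall>y\<in>carrier M. f x y \<in> carrier G) \<and>
    (\<forall>x\<in>grd \<Omega> k. \<forall>x'\<in>grd \<Omega> k. \<forall>y\<in>carrier M. f (x \<oplus> x') y = f x y \<oplus>\<^bsub>G\<^esub> f x' y) \<and>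
    (\<forall>x\<in>grd \<Omega> k. \<forall>y\<in>carrier M. \<forall>y'\<in>carrier M. f x (y \<oplus>\<^bsub>M\<^esub> y') = f x y \<oplus>\<^bsub>G\<^esub> f x y') \<and>
    (\<forall>s\<in>grd \<Omega> 0. \<forall>x\<in>grd \<Omega> k. \<forall>y\<in>carrier M. f (x \<otimes> s) y = f x (s \<odot>\<^bsub>M\<^esub> y))"

context
  fixes M :: "('w, 'm) module"
  assumes M: "left_module (deg0 \<Omega>) M"
begin

interpretation M: left_module "deg0 \<Omega>" M by (rule M)

lemma tensor_forms:
  "tensor (carrier (deg0 \<Omega>)) (\<Omega>\<lparr>carrier := grd \<Omega> k\<rparr>) (\<lambda>w a. w \<otimes> a) M (smult M)"
  using M.act_closed by (intro tensor.intro tensor_axioms.intro grd_group M.abelian_group_axioms) auto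

interpretation t: tensor "carrier (deg0 \<Omega>)" "\<Omega>\<lparr>carrier := grd \<Omega> k\<rparr>" "\<lambda>w a. w \<otimes> a" M "smult M" for k
  by (rule tensor_forms)

lemma balanced_iff: "t.balanced_map k G f \<longleftrightarrow> balanced k M G f"
  unfolding t.balanced_map_def balanced_def by simp

lemma T_group: "abelian_group (T k M)"
  unfolding T_def by (rule t.grp.abelian_group_axioms)

lemma ten_closed [simp]: "x \<in> grd \<Omega> k \<Longrightarrow> y \<in> carrier M \<Longrightarrow> ten k M x y \<in> carrier (T k M)"
  using t.ten_closed[of x k y] by (simp add: T_def ten_def)

lemma ten_add_left: "x \<in> grd \<Omega> k \<Longrightarrow> x' \<in> grd \<Omega> k \<Longrightarrow> y \<in> carrier M \<Longrightarrow>
    ten k M (x \<oplus> x') y = ten k M x y \<oplus>\<^bsub>T k M\<^esub> ten k M x' y"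
  using t.ten_add_left[of x k x' y] by (simp add: T_def ten_def)

lemma ten_add_right: "x \<in> grd \<Omega> k \<Longrightarrow> y \<in> carrier M \<Longrightarrow> y' \<in> carrier M \<Longrightarrow>
    ten k M x (y \<oplus>\<^bsub>M\<^esub> y') = ten k M x y \<oplus>\<^bsub>T k M\<^esub> ten k M x y'"
  using t.ten_add_right[of x k y y'] by (simp add: T_def ten_def)

lemma ten_balanced: "s \<in> grd \<Omega> 0 \<Longrightarrow> x \<in> grd \<Omega> k \<Longrightarrow> y \<in> carrier M \<Longrightarrow>
    ten k M (x \<otimes> s) y = ten k M x (s \<odot>\<^bsub>M\<^esub> y)"
  using t.ten_balanced[of s x k y] by (simp add: ten_def)

lemma ten_minus_left: "x \<in> grd \<Omega> k \<Longrightarrow> y \<in> carrier M \<Longrightarrow> ten k M (\<ominus> x) y = \<ominus>\<^bsub>T k M\<^esub> ten k M x y"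
  using t.ten_minus_left[of x k y] by (simp add: ten_def T_def grd_a_inv)

text \<open>Turns the congruence that occurs in the definition of jets into an equation in
  \<open>T k M\<close>, where group laws and additive maps are available.\<close>

lemma form_eq_iff:
  assumes "wf_forms k M xs" "wf_forms k M ys"
  shows "form_eq \<Omega> k M xs ys \<longleftrightarrow>
    lsum (T k M) (\<lambda>(x, y). ten k M x y) xs = lsum (T k M) (\<lambda>(x, y). ten k M x y) ys"
proof -
  have "t.wf_sum k xs" "t.wf_sum k ys" using assms by (simp_all add: t.wf_sum_def wf_forms_def)
  then show ?thesis using t.cls_eq_iff[of k xs ys] t.cls_lsum[of k xs] t.cls_lsum[of k ys]
    unfolding T_def ten_def form_eq_def by simp
qed

lemma tlift_closed: "balanced k M G f \<Longrightarrow> t \<in> carrier (T k M) \<Longrightarrow> tlift k M G f t \<in> carrier G"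
  using t.lift_closed unfolding T_def tlift_def balanced_iff .

lemma tlift_add: "balanced k M G f \<Longrightarrow> t \<in> carrier (T k M) \<Longrightarrow> t' \<in> carrier (T k M) \<Longrightarrow>
    tlift k M G f (t \<oplus>\<^bsub>T k M\<^esub> t') = tlift k M G f t \<oplus>\<^bsub>G\<^esub> tlift k M G f t'"
  using t.lift_add unfolding T_def tlift_def balanced_iff .

lemma tlift_ten: "balanced k M G f \<Longrightarrow> x \<in> grd \<Omega> k \<Longrightarrow> y \<in> carrier M \<Longrightarrow>
    tlift k M G f (ten k M x y) = f x y"
  using t.lift_ten[of k G f x y] unfolding ten_def tlift_def balanced_iff by simp

lemma T_ext:
  assumes "abelian_group G" "h \<in> carrier (T k M) \<rightarrow> carrier G" "h' \<in> carrier (T k M) \<rightarrow> carrier G"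
    and "\<And>t t'. t \<in> carrier (T k M) \<Longrightarrow> t' \<in> carrier (T k M) \<Longrightarrow> h (t \<oplus>\<^bsub>T k M\<^esub> t') = h t \<oplus>\<^bsub>G\<^esub> h t'"
    and "\<And>t t'. t \<in> carrier (T k M) \<Longrightarrow> t' \<in> carrier (T k M) \<Longrightarrow> h' (t \<oplus>\<^bsub>T k M\<^esub> t') = h' t \<oplus>\<^bsub>G\<^esub> h' t'"
    and "\<And>x y. x \<in> grd \<Omega> k \<Longrightarrow> y \<in> carrier M \<Longrightarrow> h (ten k M x y) = h' (ten k M x y)"
    and "t \<in> carrier (T k M)"
  shows "h t = h' t"
  by (rule t.additive_ext[where k = k and G = G and h = h and h' = h' and t = t])
    (use assms in \<open>simp_all add: T_def ten_def\<close>)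

end

end

section \<open>Additive maps, multiplication by forms, and functoriality of module-valued
  forms\<close>

definition additive_map :: "('g, 'b) ring_scheme \<Rightarrow> ('h, 'c) ring_scheme \<Rightarrow> ('g \<Rightarrow> 'h) \<Rightarrow> bool" where
  "additive_map G H h \<longleftrightarrow> h \<in> carrier G \<rightarrow> carrier H \<and>
     (\<forall>x\<in>carrier G. \<forall>y\<in>carrier G. h (x \<oplus>\<^bsub>G\<^esub> y) = h x \<oplus>\<^bsub>H\<^esub> h y)"

lemma additive_map_closed: "additive_map G H h \<Longrightarrow> x \<in> carrier G \<Longrightarrow> h x \<in> carrier H"
  and additive_map_add: "additive_map G H h \<Longrightarrow> x \<in> carrier G \<Longrightarrow> y \<in> carrier G \<Longrightarrow>
    h (x \<oplus>\<^bsub>G\<^esub> y) = h x \<oplus>\<^bsub>H\<^esub> h y"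
  by (auto simp: additive_map_def)

lemma additive_map_comp: "additive_map G H h \<Longrightarrow> additive_map H L g \<Longrightarrow> additive_map G L (\<lambda>x. g (h x))"
  by (auto simp: additive_map_def Pi_iff)

lemma additive_map_plus:
  assumes "abelian_group H" "additive_map G H h" "additive_map G H g"
  shows "additive_map G H (\<lambda>x. h x \<oplus>\<^bsub>H\<^esub> g x)"
proof -
  interpret H: abelian_group H by fact
  show ?thesis using assms(2,3) unfolding additive_map_def by (auto simp: Pi_iff H.a_ac)
qed

lemma additive_map_zero:
  "abelian_group G \<Longrightarrow> abelian_group H \<Longrightarrow> additive_map G H h \<Longrightarrow> h \<zero>\<^bsub>G\<^esub> = \<zero>\<^bsub>H\<^esub>"
  by (rule additive_zero) (auto simp: additive_map_def)

lemma additive_map_a_inv: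
  "abelian_group G \<Longrightarrow> abelian_group H \<Longrightarrow> additive_map G H h \<Longrightarrow> x \<in> carrier G \<Longrightarrow>
    h (\<ominus>\<^bsub>G\<^esub> x) = \<ominus>\<^bsub>H\<^esub> h x"
  by (rule additive_a_inv) (auto simp: additive_map_def)

context exterior_algebra
begin

lemma dif_mult0: "a \<in> grd \<Omega> 0 \<Longrightarrow> x \<in> carrier \<Omega> \<Longrightarrow> dif \<Omega> (a \<otimes> x) = dif \<Omega> a \<otimes> x \<oplus> a \<otimes> dif \<Omega> x"
  using leibniz[of a 0 x] by (simp add: dif_closed grd_subset)

text \<open>The Leibniz rule for the product of 1 with itself gives d1 = d1 + d1.\<close>

lemma dif_one: "dif \<Omega> \<one> = \<zero>"
  using dif_mult0[of \<one> \<one>] by (simp add: one_grd dif_closed)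

lemma dif_mult1: "w \<in> grd \<Omega> 1 \<Longrightarrow> x \<in> carrier \<Omega> \<Longrightarrow> dif \<Omega> (w \<otimes> x) = dif \<Omega> w \<otimes> x \<oplus> \<ominus> (w \<otimes> dif \<Omega> x)"
  using leibniz[of w 1 x] by (simp add: dif_closed grd_subset l_minus)

definition lin :: "('w, 'm) module \<Rightarrow> ('w, 'n) module \<Rightarrow> ('m \<Rightarrow> 'n) \<Rightarrow> bool" where
  "lin M N f \<longleftrightarrow> additive_map M N f \<and> (\<forall>a\<in>grd \<Omega> 0. \<forall>x\<in>carrier M. f (a \<odot>\<^bsub>M\<^esub> x) = a \<odot>\<^bsub>N\<^esub> f x)"

lemma lin_additive: "lin M N f \<Longrightarrow> additive_map M N f"
  and lin_closed: "lin M N f \<Longrightarrow> x \<in> carrier M \<Longrightarrow> f x \<in> carrier N"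
  and lin_add: "lin M N f \<Longrightarrow> x \<in> carrier M \<Longrightarrow> y \<in> carrier M \<Longrightarrow> f (x \<oplus>\<^bsub>M\<^esub> y) = f x \<oplus>\<^bsub>N\<^esub> f y"
  and lin_act: "lin M N f \<Longrightarrow> a \<in> grd \<Omega> 0 \<Longrightarrow> x \<in> carrier M \<Longrightarrow> f (a \<odot>\<^bsub>M\<^esub> x) = a \<odot>\<^bsub>N\<^esub> f x"
  by (auto simp: lin_def additive_map_def)

lemma lin_comp: "lin M N f \<Longrightarrow> lin N L g \<Longrightarrow> lin M L (\<lambda>x. g (f x))"
  unfolding lin_def by (auto intro: additive_map_comp simp: additive_map_closed)

text \<open>\<open>lmul n k M v\<close> is left multiplication \<open>\<Omega>\<^sup>k \<otimes> M \<rightarrow> \<Omega>\<^sup>n \<otimes> M\<close> by a form \<open>v\<close> of degree \<open>n - k\<close>.\<close>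

definition lmul :: "nat \<Rightarrow> nat \<Rightarrow> ('w, 'm) module \<Rightarrow> 'w \<Rightarrow> ('w \<times> 'm) list set \<Rightarrow> ('w \<times> 'm) list set" where
  "lmul n k M v = tlift k M (T n M) (\<lambda>w e. ten n M (v \<otimes> w) e)"

text \<open>The map \<open>id \<otimes> f\<close> on forms with values in a module.\<close>

definition tmap :: "nat \<Rightarrow> ('w, 'm) module \<Rightarrow> ('w, 'n) module \<Rightarrow> ('m \<Rightarrow> 'n) \<Rightarrow>
    ('w \<times> 'm) list set \<Rightarrow> ('w \<times> 'n) list set" where
  "tmap k M N f = tlift k M (T k N) (\<lambda>w e. ten k N w (f e))"

context
  fixes M :: "('w, 'm) module"
  assumes M: "left_module (deg0 \<Omega>) M"
begin

interpretation M: left_module "deg0 \<Omega>" M by (rule M)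
interpretation T: abelian_group "T k M" for k by (rule T_group[OF M])

lemma act_simps [simp]:
  "a \<in> grd \<Omega> 0 \<Longrightarrow> x \<in> carrier M \<Longrightarrow> a \<odot>\<^bsub>M\<^esub> x \<in> carrier M"
  "x \<in> carrier M \<Longrightarrow> \<one> \<odot>\<^bsub>M\<^esub> x = x"
  "a \<in> grd \<Omega> 0 \<Longrightarrow> a \<odot>\<^bsub>M\<^esub> \<zero>\<^bsub>M\<^esub> = \<zero>\<^bsub>M\<^esub>"
  using M.act_closed M.act_one
    additive_zero[OF M.abelian_group_axioms M.abelian_group_axioms, where h = "\<lambda>x. a \<odot>\<^bsub>M\<^esub> x"]
    M.act_r_distr by auto

lemma act_minus: "a \<in> grd \<Omega> 0 \<Longrightarrow> x \<in> carrier M \<Longrightarrow> (\<ominus> a) \<odot>\<^bsub>M\<^esub> x = \<ominus>\<^bsub>M\<^esub> (a \<odot>\<^bsub>M\<^esub> x)"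
  using additive_a_inv[OF grd_group[of 0] M.abelian_group_axioms, where h = "\<lambda>a. a \<odot>\<^bsub>M\<^esub> x" and x = a]
    M.act_l_distr by (auto simp: grd_a_inv)

lemma act_rules:
  "a \<in> grd \<Omega> 0 \<Longrightarrow> b \<in> grd \<Omega> 0 \<Longrightarrow> x \<in> carrier M \<Longrightarrow> (a \<oplus> b) \<odot>\<^bsub>M\<^esub> x = a \<odot>\<^bsub>M\<^esub> x \<oplus>\<^bsub>M\<^esub> b \<odot>\<^bsub>M\<^esub> x"
  "a \<in> grd \<Omega> 0 \<Longrightarrow> x \<in> carrier M \<Longrightarrow> y \<in> carrier M \<Longrightarrow>
     a \<odot>\<^bsub>M\<^esub> (x \<oplus>\<^bsub>M\<^esub> y) = a \<odot>\<^bsub>M\<^esub> x \<oplus>\<^bsub>M\<^esub> a \<odot>\<^bsub>M\<^esub> y"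
  "a \<in> grd \<Omega> 0 \<Longrightarrow> b \<in> grd \<Omega> 0 \<Longrightarrow> x \<in> carrier M \<Longrightarrow> (a \<otimes> b) \<odot>\<^bsub>M\<^esub> x = a \<odot>\<^bsub>M\<^esub> (b \<odot>\<^bsub>M\<^esub> x)"
  using M.act_l_distr M.act_r_distr M.act_assoc by auto

lemma kact_simps: "c \<in> carrier K \<Longrightarrow> x \<in> carrier M \<Longrightarrow> kact \<Omega> M c x = (c \<odot> \<one>) \<odot>\<^bsub>M\<^esub> x"
  by (simp add: kact_def)

lemma lmul_balanced:
  assumes "k \<le> n" "v \<in> grd \<Omega> (n - k)"
  shows "balanced k M (T n M) (\<lambda>w e. ten n M (v \<otimes> w) e)"
proof -
  have c: "w \<in> grd \<Omega> k \<Longrightarrow> v \<otimes> w \<in> grd \<Omega> n" for w using mult_grd[of v "n - k" w k] assms by simp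
  show ?thesis unfolding balanced_def
    using c assms
    by (auto simp: T.abelian_group_axioms ten_closed[OF M] r_distr grd_subset m_assoc[symmetric]
        ten_add_left[OF M] ten_add_right[OF M] ten_balanced[OF M])
qed

lemma lmul_additive: "k \<le> n \<Longrightarrow> v \<in> grd \<Omega> (n - k) \<Longrightarrow> additive_map (T k M) (T n M) (lmul n k M v)"
  unfolding lmul_def additive_map_def
  using tlift_closed[OF M lmul_balanced] tlift_add[OF M lmul_balanced] by blast

lemma lmul_ten: "k \<le> n \<Longrightarrow> v \<in> grd \<Omega> (n - k) \<Longrightarrow> w \<in> grd \<Omega> k \<Longrightarrow> e \<in> carrier M \<Longrightarrow>
    lmul n k M v (ten k M w e) = ten n M (v \<otimes> w) e"
  unfolding lmul_def by (rule tlift_ten[OF M lmul_balanced])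

lemma T_eqI:
  assumes "abelian_group G" "additive_map (T k M) G h" "additive_map (T k M) G h'"
    and "\<And>x y. x \<in> grd \<Omega> k \<Longrightarrow> y \<in> carrier M \<Longrightarrow> h (ten k M x y) = h' (ten k M x y)"
    and "t \<in> carrier (T k M)"
  shows "h t = h' t"
  by (rule T_ext[where h = h and h' = h' and k = k and t = t, OF M assms(1)])
    (use assms in \<open>auto simp: additive_map_def\<close>)

lemma lmul_add_left:
  assumes "k \<le> n" "v \<in> grd \<Omega> (n - k)" "v' \<in> grd \<Omega> (n - k)" "t \<in> carrier (T k M)"
  shows "lmul n k M (v \<oplus> v') t = lmul n k M v t \<oplus>\<^bsub>T n M\<^esub> lmul n k M v' t"
proof (rule T_eqI[OF T.abelian_group_axioms _ _ _ assms(4)])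
  show "additive_map (T k M) (T n M) (lmul n k M (v \<oplus> v'))"
    using assms by (intro lmul_additive) auto
  show "additive_map (T k M) (T n M) (\<lambda>t. lmul n k M v t \<oplus>\<^bsub>T n M\<^esub> lmul n k M v' t)"
    using assms by (intro additive_map_plus T.abelian_group_axioms lmul_additive) auto
  fix x y assume x: "x \<in> grd \<Omega> k" "y \<in> carrier M"
  have "v \<otimes> x \<in> grd \<Omega> n" "v' \<otimes> x \<in> grd \<Omega> n"
    using mult_grd[of _ "n - k" x k] assms x by fastforce+
  then show "lmul n k M (v \<oplus> v') (ten k M x y) =
      lmul n k M v (ten k M x y) \<oplus>\<^bsub>T n M\<^esub> lmul n k M v' (ten k M x y)"
    using assms x by (simp add: lmul_ten l_distr grd_subset ten_add_left[OF M])
qed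

lemma lmul_lmul:
  assumes "k \<le> m" "m \<le> n" "v \<in> grd \<Omega> (n - m)" "v' \<in> grd \<Omega> (m - k)" "t \<in> carrier (T k M)"
  shows "lmul n m M v (lmul m k M v' t) = lmul n k M (v \<otimes> v') t"
proof (rule T_eqI[OF T.abelian_group_axioms _ _ _ assms(5)])
  show "additive_map (T k M) (T n M) (\<lambda>t. lmul n m M v (lmul m k M v' t))"
    using assms by (intro additive_map_comp[OF lmul_additive lmul_additive]) auto
  have vv: "v \<otimes> v' \<in> grd \<Omega> (n - k)" using assms mult_grd' by blast
  then show "additive_map (T k M) (T n M) (lmul n k M (v \<otimes> v'))"
    using assms by (intro lmul_additive) auto
  fix x y assume x: "x \<in> grd \<Omega> k" "y \<in> carrier M"
  have "v' \<otimes> x \<in> grd \<Omega> m" using mult_grd[of v' "m - k" x k] assms x by simp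
  then show "lmul n m M v (lmul m k M v' (ten k M x y)) = lmul n k M (v \<otimes> v') (ten k M x y)"
    using assms x vv by (simp add: lmul_ten m_assoc grd_subset[of v "n-m"] grd_subset[of v' "m-k"] grd_subset[of x k])
qed

lemma lmul_one: "t \<in> carrier (T k M) \<Longrightarrow> lmul k k M \<one> t = t"
proof (rule T_eqI[OF T.abelian_group_axioms, where h' = "\<lambda>t. t"])
  show "additive_map (T k M) (T k M) (lmul k k M \<one>)" by (intro lmul_additive) (auto simp: one_grd)
  show "additive_map (T k M) (T k M) (\<lambda>t. t)" by (simp add: additive_map_def)
  show "x \<in> grd \<Omega> k \<Longrightarrow> y \<in> carrier M \<Longrightarrow> lmul k k M \<one> (ten k M x y) = ten k M x y" for x y
    by (simp add: lmul_ten one_grd grd_subset)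
qed

context
  fixes N :: "('w, 'n) module" and f
  assumes N: "left_module (deg0 \<Omega>) N" and f: "lin M N f"
begin

interpretation N: left_module "deg0 \<Omega>" N by (rule N)
interpretation TN: abelian_group "T k N" for k by (rule T_group[OF N])

lemma tmap_balanced: "balanced k M (T k N) (\<lambda>w e. ten k N w (f e))"
  unfolding balanced_def
  by (auto simp: TN.abelian_group_axioms ten_closed[OF N] lin_closed[OF f] lin_add[OF f] lin_act[OF f]
      ten_add_left[OF N] ten_add_right[OF N] ten_balanced[OF N])

lemma tmap_additive: "additive_map (T k M) (T k N) (tmap k M N f)"
  unfolding tmap_def additive_map_def
  using tlift_closed[OF M tmap_balanced] tlift_add[OF M tmap_balanced] by blast

lemma tmap_ten: "w \<in> grd \<Omega> k \<Longrightarrow> e \<in> carrier M \<Longrightarrow> tmap k M N f (ten k M w e) = ten k N w (f e)"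
  unfolding tmap_def by (rule tlift_ten[OF M tmap_balanced])

end

end

lemma tmap_lmul:
  fixes M :: "('w, 'm) module" and N :: "('w, 'n) module"
  assumes M: "left_module (deg0 \<Omega>) M" and N: "left_module (deg0 \<Omega>) N" and f: "lin M N f"
    and "k \<le> n" "v \<in> grd \<Omega> (n - k)" "t \<in> carrier (T k M)"
  shows "tmap n M N f (lmul n k M v t) = lmul n k N v (tmap k M N f t)"
proof (rule T_eqI[OF M T_group[OF N, of n] _ _ _ assms(6)])
  show "additive_map (T k M) (T n N) (\<lambda>t. tmap n M N f (lmul n k M v t))"
    by (rule additive_map_comp[OF lmul_additive[OF M assms(4,5)] tmap_additive[OF M N f]])
  show "additive_map (T k M) (T n N) (\<lambda>t. lmul n k N v (tmap k M N f t))"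
    by (rule additive_map_comp[OF tmap_additive[OF M N f] lmul_additive[OF N assms(4,5)]])
  fix x y assume x: "x \<in> grd \<Omega> k" "y \<in> carrier M"
  have "v \<otimes> x \<in> grd \<Omega> n" using mult_grd[of v "n - k" x k] assms x by simp
  then show "tmap n M N f (lmul n k M v (ten k M x y)) = lmul n k N v (tmap k M N f (ten k M x y))"
    using x assms(4,5) by (simp add: lmul_ten[OF M] lmul_ten[OF N] tmap_ten[OF M N f] lin_closed[OF f])
qed

end

lemma (in abelian_group) a_inv_zero [simp]: "\<ominus> \<zero> = \<zero>"
  by (rule minus_equality) auto

section \<open>First jets\<close>

text \<open>A first jet \<open>[\<Sum> a\<^sub>i \<otimes> e\<^sub>i]\<close> is determined by the pair of \<open>\<Sum> a\<^sub>i e\<^sub>i\<close> (\<open>jp\<close>) and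
  \<open>\<Sum> da\<^sub>i \<otimes> e\<^sub>i\<close> (\<open>jd\<close>); under this embedding \<open>a\<close> acts by \<open>(m, t) \<mapsto> (a m, da \<otimes> m + a t)\<close>.\<close>

locale jet_algebra = exterior_algebra K \<Omega> for K :: "'k ring" and \<Omega> :: "('k, 'w) dga" (structure)
begin

definition jval :: "('w, 'm) module \<Rightarrow> ('w \<times> 'm) list \<Rightarrow> 'm" where
  "jval M xs = lsum M (\<lambda>(a, e). a \<odot>\<^bsub>M\<^esub> e) xs"

definition jdif :: "('w, 'm) module \<Rightarrow> ('w \<times> 'm) list \<Rightarrow> ('w \<times> 'm) list set" where
  "jdif M xs = lsum (T 1 M) (\<lambda>(a, e). ten 1 M (dif \<Omega> a) e) xs"

text \<open>\<open>jp\<close> and \<open>jd\<close> read the stored representative of a jet; by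
  \<open>formal_jet_class\<close> any other representative would give the same results.\<close>

definition jp :: "('w, ('w, 'e) jet) module \<Rightarrow> ('w, 'e) jet \<Rightarrow> ('w, 'e) jet" where
  "jp M x = jval M (formal x)"

definition jd :: "('w, ('w, 'e) jet) module \<Rightarrow> ('w, 'e) jet \<Rightarrow> ('w \<times> ('w, 'e) jet) list set" where
  "jd M x = jdif M (formal x)"

definition neg_sum :: "('w \<times> 'm) list \<Rightarrow> ('w \<times> 'm) list" where
  "neg_sum xs = map (\<lambda>(a, e). (\<ominus> a, e)) xs"

definition mul_sum :: "'w \<Rightarrow> ('w \<times> 'm) list \<Rightarrow> ('w \<times> 'm) list" where
  "mul_sum a xs = map (\<lambda>(b, e). (a \<otimes> b, e)) xs"

lemma jval_simps [simp]: "jval M [] = \<zero>\<^bsub>M\<^esub>" "jval M ((a, e) # xs) = a \<odot>\<^bsub>M\<^esub> e \<oplus>\<^bsub>M\<^esub> jval M xs"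
  by (simp_all add: jval_def)

lemma jdif_simps [simp]: "jdif M [] = \<zero>\<^bsub>T 1 M\<^esub>"
  "jdif M ((a, e) # xs) = ten 1 M (dif \<Omega> a) e \<oplus>\<^bsub>T 1 M\<^esub> jdif M xs"
  by (simp_all add: jdif_def)

lemma wf_forms_induct [consumes 1, case_names Nil Cons]:
  assumes "wf_forms k M xs" "P []"
    and "\<And>a e xs. a \<in> grd \<Omega> k \<Longrightarrow> e \<in> carrier M \<Longrightarrow> wf_forms k M xs \<Longrightarrow> P xs \<Longrightarrow> P ((a, e) # xs)"
  shows "P xs"
  using assms(1) by (induction xs) (auto intro: assms(2,3))

section \<open>Value and differential of formal sums\<close>

context
  fixes M :: "('w, 'm) module"
  assumes M: "left_module (deg0 \<Omega>) M"
begin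

interpretation M: left_module "deg0 \<Omega>" M by (rule M)
interpretation T: abelian_group "T k M" for k by (rule T_group[OF M])

lemma jval_closed [simp]: "wf_forms 0 M xs \<Longrightarrow> jval M xs \<in> carrier M"
  by (induction rule: wf_forms_induct) (auto simp: act_simps[OF M])

lemma jdif_closed [simp]: "wf_forms 0 M xs \<Longrightarrow> jdif M xs \<in> carrier (T 1 M)"
  by (induction rule: wf_forms_induct) (auto simp: ten_closed[OF M] simp del: One_nat_def)

lemma jval_append: "wf_forms 0 M xs \<Longrightarrow> wf_forms 0 M ys \<Longrightarrow> jval M (xs @ ys) = jval M xs \<oplus>\<^bsub>M\<^esub> jval M ys"
  by (induction rule: wf_forms_induct) (auto simp: act_simps[OF M] M.a_assoc)

lemma jdif_append: "wf_forms 0 M xs \<Longrightarrow> wf_forms 0 M ys \<Longrightarrow>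
    jdif M (xs @ ys) = jdif M xs \<oplus>\<^bsub>T 1 M\<^esub> jdif M ys"
  by (induction rule: wf_forms_induct) (auto simp: ten_closed[OF M] T.a_assoc simp del: One_nat_def)

lemma neg_sum_wf [simp]: "wf_forms k M xs \<Longrightarrow> wf_forms k M (neg_sum xs)"
  by (auto simp: neg_sum_def wf_forms_def)

lemma jval_neg: "wf_forms 0 M xs \<Longrightarrow> jval M (neg_sum xs) = \<ominus>\<^bsub>M\<^esub> jval M xs"
  by (induction rule: wf_forms_induct)
    (auto simp: neg_sum_def act_minus[OF M] act_simps[OF M] M.minus_add)

lemma dif_minus: "x \<in> carrier \<Omega> \<Longrightarrow> dif \<Omega> (\<ominus> x) = \<ominus> dif \<Omega> x"
  using additive_a_inv[OF is_abelian_group is_abelian_group, where h = "dif \<Omega>" and x = x]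
  by (auto simp: dif_add dif_closed)

lemma jdif_neg: "wf_forms 0 M xs \<Longrightarrow> jdif M (neg_sum xs) = \<ominus>\<^bsub>T 1 M\<^esub> jdif M xs"
  by (induction rule: wf_forms_induct)
    (auto simp: neg_sum_def dif_minus grd_subset ten_minus_left[OF M] ten_closed[OF M] T.minus_add simp del: One_nat_def)

lemma tensor_scalars:
  "tensor (carrier K) (deg0 \<Omega>) (\<lambda>a c. c \<odot> a) M (kact \<Omega> M)"
proof (intro tensor.intro tensor_axioms.intro M.abelian_group_axioms)
  show "abelian_group (deg0 \<Omega>)" using deg0_ring by (rule ring.is_abelian_group)
qed (auto simp: kact_simps[OF M] act_simps[OF M] scalar_grd)

interpretation k: tensor "carrier K" "deg0 \<Omega>" "\<lambda>a c. c \<odot> a" M "kact \<Omega> M"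
  by (rule tensor_scalars)

lemma k_wf_iff: "k.wf_sum xs \<longleftrightarrow> wf_forms 0 M xs"
  by (simp add: k.wf_sum_def wf_forms_def)

lemma ktensor_wf: "ktensor_eq K \<Omega> M xs ys \<Longrightarrow> wf_forms 0 M xs \<and> wf_forms 0 M ys"
  using k.eq_wf[of xs ys] by (simp only: ktensor_eq_def k_wf_iff)

lemma ktensor_jval: "ktensor_eq K \<Omega> M xs ys \<Longrightarrow> jval M xs = jval M ys"
  unfolding jval_def ktensor_eq_def
proof (rule k.balanced_lsum)
  show "k.balanced_map M (smult M)"
    unfolding k.balanced_map_def
    by (auto simp: act_simps[OF M] act_rules[OF M] M.abelian_group_axioms kact_simps[OF M]
        act_rules(3)[OF M, symmetric] scalar_mult scalar_grd grd_subset)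
qed

lemma ktensor_jdif: "ktensor_eq K \<Omega> M xs ys \<Longrightarrow> jdif M xs = jdif M ys"
  unfolding jdif_def ktensor_eq_def
proof (rule k.balanced_lsum)
  \<comment> \<open>Scalars are central and d is linear over them, so
    \<open>d (c a) = c da = da (c 1)\<close>, and \<open>c 1\<close> lies in \<open>A\<close> and
    can cross the tensor sign.\<close>
  have "ten 1 M (dif \<Omega> (c \<odot> a)) y = ten 1 M (dif \<Omega> a) (kact \<Omega> M c y)"
    if "c \<in> carrier K" "a \<in> grd \<Omega> 0" "y \<in> carrier M" for c a y
    using ten_balanced[OF M, of "c \<odot> \<one>" "dif \<Omega> a" 1 y] that
    by (simp add: dif_smult grd_subset scalar_mult dif_closed scalar_grd kact_simps[OF M] del: One_nat_def)
  then show "k.balanced_map (T 1 M) (\<lambda>a. ten 1 M (dif \<Omega> a))"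
    unfolding k.balanced_map_def
    by (auto simp: T.abelian_group_axioms ten_closed[OF M] dif_add grd_subset
        ten_add_left[OF M] ten_add_right[OF M] simp del: One_nat_def)
qed

lemma jet_relations_iff:
  "zs \<in> jet_relations \<Omega> M \<longleftrightarrow> wf_forms 0 M zs \<and> jval M zs = \<zero>\<^bsub>M\<^esub> \<and> jdif M zs = \<zero>\<^bsub>T 1 M\<^esub>"
proof -
  have e: "foldr (\<lambda>(a, e). (\<oplus>\<^bsub>M\<^esub>) (a \<odot>\<^bsub>M\<^esub> e)) zs \<zero>\<^bsub>M\<^esub> = jval M zs"
    unfolding jval_def lsum_def by (rule foldr_cong) auto
  have "form_eq \<Omega> 1 M (map (\<lambda>(a, e). (dif \<Omega> a, e)) zs) [] \<longleftrightarrow> jdif M zs = \<zero>\<^bsub>T 1 M\<^esub>"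
    if "wf_forms 0 M zs"
  proof -
    have "wf_forms 1 M (map (\<lambda>(a, e). (dif \<Omega> a, e)) zs)"
      using that by (auto simp: wf_forms_def simp del: One_nat_def)
    then show ?thesis unfolding jdif_def
      by (subst form_eq_iff[OF M]) (auto simp: lsum_map split_def)
  qed
  then show ?thesis using e by (auto simp: jet_relations_def wf_forms_def simp del: One_nat_def)
qed

text \<open>Both invariants are additive and vanish on relations, which gives one direction.
  Conversely, if they agree on two sums, the difference of the sums is itself one of the
  relations.\<close>

lemma jet_eq_iff:
  "jet_eq K \<Omega> M xs ys \<longleftrightarrow>
    wf_forms 0 M xs \<and> wf_forms 0 M ys \<and> jval M xs = jval M ys \<and> jdif M xs = jdif M ys"
proof
  assume "jet_eq K \<Omega> M xs ys"
  then obtain zs where z: "zs \<in> jet_relations \<Omega> M" "ktensor_eq K \<Omega> M xs (ys @ zs)"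
    by (auto simp: jet_eq_def)
  have w: "wf_forms 0 M xs" "wf_forms 0 M ys" "wf_forms 0 M zs" using ktensor_wf[OF z(2)] by auto
  then show "wf_forms 0 M xs \<and> wf_forms 0 M ys \<and> jval M xs = jval M ys \<and> jdif M xs = jdif M ys"
    using ktensor_jval[OF z(2)] ktensor_jdif[OF z(2)] z(1)
    by (auto simp: jval_append jdif_append jet_relations_iff simp del: One_nat_def)
next
  assume a: "wf_forms 0 M xs \<and> wf_forms 0 M ys \<and> jval M xs = jval M ys \<and> jdif M xs = jdif M ys"
  then have w: "k.wf_sum xs" "k.wf_sum ys" "k.wf_sum (neg_sum ys)" by (auto simp: k_wf_iff)
  \<comment> \<open>The witness for \<open>zs\<close> is the difference \<open>xs - ys\<close>, so
    that \<open>ys + zs\<close> equals \<open>xs\<close> in the tensor product over the base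
    ring.\<close>
  have "neg_sum ys @ xs \<in> jet_relations \<Omega> M"
    using a by (auto simp: jet_relations_iff jval_append jdif_append jval_neg jdif_neg M.l_neg T.l_neg simp del: One_nat_def)
  moreover have "neg_sum ys = map (\<lambda>(a, e). (\<ominus>\<^bsub>deg0 \<Omega>\<^esub> a, e)) ys"
    using a by (auto simp: neg_sum_def wf_forms_def grd_a_inv deg0_def)
  then have "k.cls (neg_sum ys) \<oplus>\<^bsub>k.grp\<^esub> k.cls ys = \<zero>\<^bsub>k.grp\<^esub>" using k.cls_neg[OF w(2)] by simp
  then have "k.cls (ys @ neg_sum ys @ xs) = k.cls xs"
    using w k.grp.a_comm[of "k.cls ys" "k.cls (neg_sum ys)"]
    by (simp add: k.cls_append k.grp.a_assoc[symmetric])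
  then have "ktensor_eq K \<Omega> M xs (ys @ neg_sum ys @ xs)"
    using w k.cls_eq_iff[of xs "ys @ neg_sum ys @ xs"] unfolding ktensor_eq_def by auto
  ultimately show "jet_eq K \<Omega> M xs ys" unfolding jet_eq_def by blast
qed

end

section \<open>The module structure of J^1 M\<close>

context
  fixes M :: "('w, ('w, 'e) jet) module"
  assumes M: "left_module (deg0 \<Omega>) M"
begin

interpretation M: left_module "deg0 \<Omega>" M by (rule M)
interpretation T: abelian_group "T k M" for k by (rule T_group[OF M])

text \<open>The representative stored by \<open>jet_class\<close> need not be \<open>xs\<close>, but
  value and differential do not see the difference.\<close>

lemma formal_jet_class:
  assumes "wf_forms 0 M xs"
  shows "wf_forms 0 M (formal (jet_class K \<Omega> M xs))" "jp M (jet_class K \<Omega> M xs) = jval M xs"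
    "jd M (jet_class K \<Omega> M xs) = jdif M xs"
proof -
  have "jet_eq K \<Omega> M xs xs" using assms by (simp add: jet_eq_iff[OF M])
  from someI[of "jet_eq K \<Omega> M xs", OF this]
  have "jet_eq K \<Omega> M xs (formal (jet_class K \<Omega> M xs))" by (simp add: jet_class_def)
  then show "wf_forms 0 M (formal (jet_class K \<Omega> M xs))" "jp M (jet_class K \<Omega> M xs) = jval M xs"
    "jd M (jet_class K \<Omega> M xs) = jdif M xs"
    by (auto simp: jet_eq_iff[OF M] jp_def jd_def)
qed

text \<open>Equivalent sums satisfy the same predicate \<open>jet_eq K \<Omega> M xs\<close>, and
  \<open>SOME\<close> makes equal choices for equal predicates. Equality of jets is thus equality of
  the stored data.\<close>

lemma jet_class_eqI: "wf_forms 0 M xs \<Longrightarrow> wf_forms 0 M ys \<Longrightarrow> jval M xs = jval M ys \<Longrightarrow>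
    jdif M xs = jdif M ys \<Longrightarrow> jet_class K \<Omega> M xs = jet_class K \<Omega> M ys"
  unfolding jet_class_def by (rule arg_cong[where f = "\<lambda>P. Jet (Eps P)"]) (simp add: jet_eq_iff[OF M] fun_eq_iff)

lemma J1_cases:
  assumes "x \<in> carrier (J1 K \<Omega> M)"
  obtains xs where "wf_forms 0 M xs" "x = jet_class K \<Omega> M xs"
  using assms by (auto simp: J1_def wf_forms_def)

lemma jet_class_closed [simp]: "wf_forms 0 M xs \<Longrightarrow> jet_class K \<Omega> M xs \<in> carrier (J1 K \<Omega> M)"
  by (auto simp: J1_def wf_forms_def)

lemma formal_wf: "x \<in> carrier (J1 K \<Omega> M) \<Longrightarrow> wf_forms 0 M (formal x)"
  using formal_jet_class(1) by (metis J1_cases)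

lemma jp_closed [simp]: "x \<in> carrier (J1 K \<Omega> M) \<Longrightarrow> jp M x \<in> carrier M"
  and jd_closed [simp]: "x \<in> carrier (J1 K \<Omega> M) \<Longrightarrow> jd M x \<in> carrier (T 1 M)"
  unfolding jp_def jd_def by (simp_all add: formal_wf jval_closed[OF M] jdif_closed[OF M] del: One_nat_def)

text \<open>Injectivity of the embedding by value and differential. The module axioms of
  \<open>J1\<close> and the linearity of \<open>J1_map\<close> are checked on these two
  components.\<close>

lemma J1_eqI:
  assumes "x \<in> carrier (J1 K \<Omega> M)" "y \<in> carrier (J1 K \<Omega> M)" "jp M x = jp M y" "jd M x = jd M y"
  shows "x = y"
  using assms by (metis J1_cases formal_jet_class(2,3) jet_class_eqI)

lemma J1_zero: "\<zero>\<^bsub>J1 K \<Omega> M\<^esub> = jet_class K \<Omega> M []"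
  by (simp add: J1_def)

lemma J1_zero_simps: "jp M \<zero>\<^bsub>J1 K \<Omega> M\<^esub> = \<zero>\<^bsub>M\<^esub>" "jd M \<zero>\<^bsub>J1 K \<Omega> M\<^esub> = \<zero>\<^bsub>T 1 M\<^esub>"
  unfolding J1_zero by (simp_all add: formal_jet_class del: One_nat_def)

lemma J1_add:
  assumes "x \<in> carrier (J1 K \<Omega> M)" "y \<in> carrier (J1 K \<Omega> M)"
  shows "x \<oplus>\<^bsub>J1 K \<Omega> M\<^esub> y = jet_class K \<Omega> M (formal x @ formal y)"
    "x \<oplus>\<^bsub>J1 K \<Omega> M\<^esub> y \<in> carrier (J1 K \<Omega> M)"
    "jp M (x \<oplus>\<^bsub>J1 K \<Omega> M\<^esub> y) = jp M x \<oplus>\<^bsub>M\<^esub> jp M y"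
    "jd M (x \<oplus>\<^bsub>J1 K \<Omega> M\<^esub> y) = jd M x \<oplus>\<^bsub>T 1 M\<^esub> jd M y"
proof -
  note w = formal_wf[OF assms(1)] formal_wf[OF assms(2)]
  show e: "x \<oplus>\<^bsub>J1 K \<Omega> M\<^esub> y = jet_class K \<Omega> M (formal x @ formal y)" by (simp add: J1_def)
  show "x \<oplus>\<^bsub>J1 K \<Omega> M\<^esub> y \<in> carrier (J1 K \<Omega> M)"
    "jp M (x \<oplus>\<^bsub>J1 K \<Omega> M\<^esub> y) = jp M x \<oplus>\<^bsub>M\<^esub> jp M y"
    "jd M (x \<oplus>\<^bsub>J1 K \<Omega> M\<^esub> y) = jd M x \<oplus>\<^bsub>T 1 M\<^esub> jd M y"
    unfolding e using w formal_jet_class[of "formal x @ formal y"]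
    by (simp_all add: jval_append[OF M] jdif_append[OF M] jp_def jd_def del: One_nat_def)
qed

lemma mul_sum_wf: "a \<in> grd \<Omega> 0 \<Longrightarrow> wf_forms 0 M xs \<Longrightarrow> wf_forms 0 M (mul_sum a xs)"
  by (auto simp: mul_sum_def wf_forms_def)

lemma jval_mul: "wf_forms 0 M xs \<Longrightarrow> a \<in> grd \<Omega> 0 \<Longrightarrow> jval M (mul_sum a xs) = a \<odot>\<^bsub>M\<^esub> jval M xs"
  by (induction rule: wf_forms_induct)
    (auto simp: mul_sum_def act_rules[OF M] act_simps[OF M] jval_closed[OF M])

text \<open>The Leibniz rule
  \<open>d(a b) \<otimes> e = da \<otimes> b e + a db \<otimes> e\<close>, summed over a formal sum.
  The differential is linear over \<open>A\<close> only up to the term with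
  \<open>da\<close>.\<close>

lemma jdif_mul:
  assumes "wf_forms 0 M xs" "a \<in> grd \<Omega> 0"
  shows "jdif M (mul_sum a xs) = ten 1 M (dif \<Omega> a) (jval M xs) \<oplus>\<^bsub>T 1 M\<^esub> lmul 1 1 M a (jdif M xs)"
proof -
  have l: "additive_map (T 1 M) (T 1 M) (lmul 1 1 M a)"
    using assms by (intro lmul_additive[OF M]) auto
  show ?thesis using assms(1)
  proof (induction rule: wf_forms_induct)
    case Nil
    have "ten 1 M (dif \<Omega> a) \<zero>\<^bsub>M\<^esub> = \<zero>\<^bsub>T 1 M\<^esub>"
      by (rule additive_zero[OF M.abelian_group_axioms T.abelian_group_axioms[of 1]])
        (use assms in \<open>auto simp: ten_closed[OF M] ten_add_right[OF M] simp del: One_nat_def\<close>)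
    then show ?case
      using additive_map_zero[OF T.abelian_group_axioms T.abelian_group_axioms l]
      by (simp add: mul_sum_def del: One_nat_def)
  next
    case (Cons b e xs)
    have 1: "ten 1 M (dif \<Omega> (a \<otimes> b)) e =
        ten 1 M (dif \<Omega> a) (b \<odot>\<^bsub>M\<^esub> e) \<oplus>\<^bsub>T 1 M\<^esub> ten 1 M (a \<otimes> dif \<Omega> b) e"
      using Cons(1,2) assms
      by (simp add: dif_mult0 grd_subset ten_add_left[OF M] ten_balanced[OF M] del: One_nat_def)
    have 2: "ten 1 M (dif \<Omega> a) (b \<odot>\<^bsub>M\<^esub> e \<oplus>\<^bsub>M\<^esub> jval M xs) =
        ten 1 M (dif \<Omega> a) (b \<odot>\<^bsub>M\<^esub> e) \<oplus>\<^bsub>T 1 M\<^esub> ten 1 M (dif \<Omega> a) (jval M xs)"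
      using Cons(1-3) assms
      by (simp add: ten_add_right[OF M] act_simps[OF M] jval_closed[OF M] del: One_nat_def)
    have 3: "lmul 1 1 M a (ten 1 M (dif \<Omega> b) e \<oplus>\<^bsub>T 1 M\<^esub> jdif M xs) =
        ten 1 M (a \<otimes> dif \<Omega> b) e \<oplus>\<^bsub>T 1 M\<^esub> lmul 1 1 M a (jdif M xs)"
      using Cons(1-3) assms
      by (simp add: additive_map_add[OF l] lmul_ten[OF M] ten_closed[OF M] jdif_closed[OF M] del: One_nat_def)
    have c: "ten 1 M (dif \<Omega> a) (b \<odot>\<^bsub>M\<^esub> e) \<in> carrier (T 1 M)" "ten 1 M (a \<otimes> dif \<Omega> b) e \<in> carrier (T 1 M)"
      "ten 1 M (dif \<Omega> a) (jval M xs) \<in> carrier (T 1 M)" "lmul 1 1 M a (jdif M xs) \<in> carrier (T 1 M)"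
      using Cons(1-3) assms additive_map_closed[OF l]
      by (auto simp: ten_closed[OF M] act_simps[OF M] jval_closed[OF M] jdif_closed[OF M] simp del: One_nat_def)
    have "jdif M (mul_sum a ((b, e) # xs)) = ten 1 M (dif \<Omega> (a \<otimes> b)) e \<oplus>\<^bsub>T 1 M\<^esub> jdif M (mul_sum a xs)"
      by (simp add: mul_sum_def del: One_nat_def)
    then show ?case
      unfolding Cons.IH 1 using c by (simp add: 2 3 T.a_ac del: One_nat_def)
  qed
qed

lemma J1_smult:
  assumes "a \<in> grd \<Omega> 0" "x \<in> carrier (J1 K \<Omega> M)"
  shows "a \<odot>\<^bsub>J1 K \<Omega> M\<^esub> x = jet_class K \<Omega> M (mul_sum a (formal x))"
    "a \<odot>\<^bsub>J1 K \<Omega> M\<^esub> x \<in> carrier (J1 K \<Omega> M)"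
    "jp M (a \<odot>\<^bsub>J1 K \<Omega> M\<^esub> x) = a \<odot>\<^bsub>M\<^esub> jp M x"
    "jd M (a \<odot>\<^bsub>J1 K \<Omega> M\<^esub> x) = ten 1 M (dif \<Omega> a) (jp M x) \<oplus>\<^bsub>T 1 M\<^esub> lmul 1 1 M a (jd M x)"
proof -
  note w = formal_wf[OF assms(2)]
  show e: "a \<odot>\<^bsub>J1 K \<Omega> M\<^esub> x = jet_class K \<Omega> M (mul_sum a (formal x))" by (simp add: J1_def mul_sum_def)
  show "a \<odot>\<^bsub>J1 K \<Omega> M\<^esub> x \<in> carrier (J1 K \<Omega> M)"
    "jp M (a \<odot>\<^bsub>J1 K \<Omega> M\<^esub> x) = a \<odot>\<^bsub>M\<^esub> jp M x"
    "jd M (a \<odot>\<^bsub>J1 K \<Omega> M\<^esub> x) = ten 1 M (dif \<Omega> a) (jp M x) \<oplus>\<^bsub>T 1 M\<^esub> lmul 1 1 M a (jd M x)"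
    unfolding e using w formal_jet_class[of "mul_sum a (formal x)"] assms
    by (simp_all add: mul_sum_wf jval_mul jdif_mul jp_def jd_def del: One_nat_def)
qed

lemma J1_group: "abelian_group (J1 K \<Omega> M)"
proof (rule abelian_groupI)
  show "\<zero>\<^bsub>J1 K \<Omega> M\<^esub> \<in> carrier (J1 K \<Omega> M)" by (simp add: J1_zero)
next
  fix x y assume xy: "x \<in> carrier (J1 K \<Omega> M)" "y \<in> carrier (J1 K \<Omega> M)"
  show "x \<oplus>\<^bsub>J1 K \<Omega> M\<^esub> y \<in> carrier (J1 K \<Omega> M)" by (rule J1_add(2)[OF xy])
  show "x \<oplus>\<^bsub>J1 K \<Omega> M\<^esub> y = y \<oplus>\<^bsub>J1 K \<Omega> M\<^esub> x"
    by (rule J1_eqI) (use xy in \<open>simp_all add: J1_add(2-4) M.a_comm T.a_comm del: One_nat_def\<close>)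
  fix z assume z: "z \<in> carrier (J1 K \<Omega> M)"
  show "x \<oplus>\<^bsub>J1 K \<Omega> M\<^esub> y \<oplus>\<^bsub>J1 K \<Omega> M\<^esub> z = x \<oplus>\<^bsub>J1 K \<Omega> M\<^esub> (y \<oplus>\<^bsub>J1 K \<Omega> M\<^esub> z)"
    by (rule J1_eqI) (use xy z in \<open>simp_all add: J1_add(2-4) M.a_assoc T.a_assoc del: One_nat_def\<close>)
next
  fix x assume x: "x \<in> carrier (J1 K \<Omega> M)"
  have z: "\<zero>\<^bsub>J1 K \<Omega> M\<^esub> \<in> carrier (J1 K \<Omega> M)" by (simp add: J1_zero)
  show "\<zero>\<^bsub>J1 K \<Omega> M\<^esub> \<oplus>\<^bsub>J1 K \<Omega> M\<^esub> x = x"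
    by (rule J1_eqI) (use x z in \<open>simp_all add: J1_add(2-4) J1_zero_simps del: One_nat_def\<close>)
  let ?y = "jet_class K \<Omega> M (neg_sum (formal x))"
  have w: "wf_forms 0 M (neg_sum (formal x))" using formal_wf[OF x] neg_sum_wf[OF M] by blast
  then have y: "?y \<in> carrier (J1 K \<Omega> M)" by simp
  have "?y \<oplus>\<^bsub>J1 K \<Omega> M\<^esub> x = \<zero>\<^bsub>J1 K \<Omega> M\<^esub>"
    by (rule J1_eqI)
      (use x y z in \<open>simp_all add: J1_add(2-4) J1_zero_simps formal_jet_class[OF w] jval_neg[OF M formal_wf]
        jdif_neg[OF M formal_wf] jp_def[symmetric] jd_def[symmetric] M.l_neg T.l_neg del: One_nat_def\<close>)
  then show "\<exists>y\<in>carrier (J1 K \<Omega> M). y \<oplus>\<^bsub>J1 K \<Omega> M\<^esub> x = \<zero>\<^bsub>J1 K \<Omega> M\<^esub>" using y by blast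
qed

lemma J1_module: "left_module (deg0 \<Omega>) (J1 K \<Omega> M)"
proof (intro left_module.intro left_module_axioms.intro deg0_ring J1_group)
  have lm: "additive_map (T 1 M) (T 1 M) (lmul 1 1 M a)" if "a \<in> grd \<Omega> 0" for a
    using that by (intro lmul_additive[OF M]) auto
  note lc = additive_map_closed[OF lm] and la = additive_map_add[OF lm]
  note r = J1_add(2-4) J1_smult(2-4) lc la ten_closed[OF M] act_simps[OF M] act_rules[OF M]
  fix a x assume ax: "a \<in> carrier (deg0 \<Omega>)" "x \<in> carrier (J1 K \<Omega> M)"
  then have a: "a \<in> grd \<Omega> 0" and x: "x \<in> carrier (J1 K \<Omega> M)" by auto
  show "a \<odot>\<^bsub>J1 K \<Omega> M\<^esub> x \<in> carrier (J1 K \<Omega> M)" by (rule J1_smult(2)[OF a x])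
  { fix y assume y: "y \<in> carrier (J1 K \<Omega> M)"
    show "a \<odot>\<^bsub>J1 K \<Omega> M\<^esub> (x \<oplus>\<^bsub>J1 K \<Omega> M\<^esub> y) = a \<odot>\<^bsub>J1 K \<Omega> M\<^esub> x \<oplus>\<^bsub>J1 K \<Omega> M\<^esub> a \<odot>\<^bsub>J1 K \<Omega> M\<^esub> y"
      by (rule J1_eqI) (use a x y in \<open>simp_all add: r ten_add_right[OF M] T.a_ac del: One_nat_def\<close>) }
  fix b assume b': "b \<in> carrier (deg0 \<Omega>)"
  then have b: "b \<in> grd \<Omega> 0" by simp
  show "(a \<oplus>\<^bsub>deg0 \<Omega>\<^esub> b) \<odot>\<^bsub>J1 K \<Omega> M\<^esub> x = a \<odot>\<^bsub>J1 K \<Omega> M\<^esub> x \<oplus>\<^bsub>J1 K \<Omega> M\<^esub> b \<odot>\<^bsub>J1 K \<Omega> M\<^esub> x"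
    by (rule J1_eqI)
      (use a b x in \<open>simp_all add: r ten_add_left[OF M] lmul_add_left[OF M] dif_add grd_subset T.a_ac del: One_nat_def\<close>)
  have 1: "lmul 1 1 M a (ten 1 M (dif \<Omega> b) (jp M x)) = ten 1 M (a \<otimes> dif \<Omega> b) (jp M x)"
    using a b x by (simp add: lmul_ten[OF M] del: One_nat_def)
  have 2: "lmul 1 1 M a (lmul 1 1 M b (jd M x)) = lmul 1 1 M (a \<otimes> b) (jd M x)"
    using a b x by (simp add: lmul_lmul[OF M] del: One_nat_def)
  have 3: "ten 1 M (dif \<Omega> (a \<otimes> b)) (jp M x) =
      ten 1 M (dif \<Omega> a) (b \<odot>\<^bsub>M\<^esub> jp M x) \<oplus>\<^bsub>T 1 M\<^esub> ten 1 M (a \<otimes> dif \<Omega> b) (jp M x)"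
    using a b x by (simp add: dif_mult0 grd_subset ten_add_left[OF M] ten_balanced[OF M] del: One_nat_def)
  show "(a \<otimes>\<^bsub>deg0 \<Omega>\<^esub> b) \<odot>\<^bsub>J1 K \<Omega> M\<^esub> x = a \<odot>\<^bsub>J1 K \<Omega> M\<^esub> (b \<odot>\<^bsub>J1 K \<Omega> M\<^esub> x)"
    by (rule J1_eqI)
      (use a b x in \<open>simp_all add: r 1 2 3 T.a_assoc del: One_nat_def\<close>)
next
  fix x assume x: "x \<in> carrier (J1 K \<Omega> M)"
  \<comment> \<open>Needed because \<open>d1 = 0\<close>. The zero is written as that of the group
    of one-forms, in which the additivity argument takes place; it is the zero of
    \<open>\<Omega>\<close>.\<close>
  have z: "ten 1 M \<zero>\<^bsub>\<Omega>\<lparr>carrier := grd \<Omega> 1\<rparr>\<^esub> (jp M x) = \<zero>\<^bsub>T 1 M\<^esub>"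
    by (rule additive_zero[OF grd_group[of 1] T.abelian_group_axioms[of 1], where h = "\<lambda>w. ten 1 M w (jp M x)"])
      (use x in \<open>simp_all add: Pi_iff ten_closed[OF M] ten_add_left[OF M] del: One_nat_def\<close>)
  show "\<one>\<^bsub>deg0 \<Omega>\<^esub> \<odot>\<^bsub>J1 K \<Omega> M\<^esub> x = x"
    by (rule J1_eqI)
      (use x z in \<open>simp_all add: J1_smult(2-4) one_grd dif_one lmul_one[OF M] act_simps[OF M] del: One_nat_def\<close>)
qed

lemma jp_lin: "lin (J1 K \<Omega> M) M (jp M)"
  unfolding lin_def additive_map_def by (simp add: J1_add(2-4) J1_smult(2-4) Pi_iff)

lemma j1_simps:
  assumes "e \<in> carrier M"
  shows "j1 K \<Omega> M e \<in> carrier (J1 K \<Omega> M)" "jp M (j1 K \<Omega> M e) = e"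
    "j1 K \<Omega> M e = jet_class K \<Omega> M [(\<one>, e)]"
  using assms formal_jet_class[of "[(\<one>, e)]"] by (simp_all add: j1_def one_grd act_simps[OF M])

end

section \<open>Functoriality of first jets\<close>

context
  fixes M N :: "('w, ('w, 'e) jet) module" and f
  assumes M: "left_module (deg0 \<Omega>) M" and N: "left_module (deg0 \<Omega>) N" and f: "lin M N f"
begin

interpretation M: left_module "deg0 \<Omega>" M by (rule M)
interpretation N: left_module "deg0 \<Omega>" N by (rule N)
interpretation TM: abelian_group "T k M" for k by (rule T_group[OF M])
interpretation TN: abelian_group "T k N" for k by (rule T_group[OF N])

lemma map_wf: "wf_forms k M xs \<Longrightarrow> wf_forms k N (map (\<lambda>(a, m). (a, f m)) xs)"
  using lin_closed[OF f] by (auto simp: wf_forms_def)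

lemma jval_map: "wf_forms 0 M xs \<Longrightarrow> jval N (map (\<lambda>(a, m). (a, f m)) xs) = f (jval M xs)"
  by (induction rule: wf_forms_induct)
    (auto simp: additive_map_zero[OF M.abelian_group_axioms N.abelian_group_axioms lin_additive[OF f]]
      lin_add[OF f] lin_act[OF f] act_simps[OF M] jval_closed[OF M])

lemma jdif_map: "wf_forms 0 M xs \<Longrightarrow> jdif N (map (\<lambda>(a, m). (a, f m)) xs) = tmap 1 M N f (jdif M xs)"
  by (induction rule: wf_forms_induct)
    (simp_all add: additive_map_zero[OF TM.abelian_group_axioms TN.abelian_group_axioms tmap_additive[OF M N f]]
      additive_map_add[OF tmap_additive[OF M N f]] tmap_ten[OF M N f] ten_closed[OF M]
      jdif_closed[OF M] del: One_nat_def)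

lemma J1_map_simps:
  assumes "x \<in> carrier (J1 K \<Omega> M)"
  shows "J1_map K \<Omega> N f x \<in> carrier (J1 K \<Omega> N)" "jp N (J1_map K \<Omega> N f x) = f (jp M x)"
    "jd N (J1_map K \<Omega> N f x) = tmap 1 M N f (jd M x)"
  using map_wf formal_wf[OF M assms]
    formal_jet_class[OF N map_wf[OF formal_wf[OF M assms]]]
  by (auto simp: J1_map_def jp_def jd_def jval_map jdif_map jet_class_closed[OF N] simp del: One_nat_def)

text \<open>\<open>J1_map\<close> is defined on the stored representative; naturality of value and
  differential permits any other one, which functoriality requires.\<close>

lemma J1_map_class:
  assumes "wf_forms 0 M xs"
  shows "J1_map K \<Omega> N f (jet_class K \<Omega> M xs) = jet_class K \<Omega> N (map (\<lambda>(a, m). (a, f m)) xs)"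
  unfolding J1_map_def
proof (rule jet_class_eqI[OF N])
  note w = formal_jet_class[OF M assms]
  show "wf_forms 0 N (map (\<lambda>(a, m). (a, f m)) xs)"
    "wf_forms 0 N (map (\<lambda>(a, m). (a, f m)) (formal (jet_class K \<Omega> M xs)))"
    using assms w(1) map_wf by auto
  show "jval N (map (\<lambda>(a, m). (a, f m)) (formal (jet_class K \<Omega> M xs))) = jval N (map (\<lambda>(a, m). (a, f m)) xs)"
    using w assms by (simp add: jval_map jp_def)
  show "jdif N (map (\<lambda>(a, m). (a, f m)) (formal (jet_class K \<Omega> M xs))) = jdif N (map (\<lambda>(a, m). (a, f m)) xs)"
    using w assms by (simp add: jdif_map jd_def)
qed

lemma J1_map_lin: "lin (J1 K \<Omega> M) (J1 K \<Omega> N) (J1_map K \<Omega> N f)"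
  unfolding lin_def additive_map_def
proof (intro conjI ballI)
  note t = tmap_additive[OF M N f, of 1]
  show "J1_map K \<Omega> N f \<in> carrier (J1 K \<Omega> M) \<rightarrow> carrier (J1 K \<Omega> N)" by (simp add: J1_map_simps)
  fix x assume x: "x \<in> carrier (J1 K \<Omega> M)"
  { fix y assume y: "y \<in> carrier (J1 K \<Omega> M)"
    show "J1_map K \<Omega> N f (x \<oplus>\<^bsub>J1 K \<Omega> M\<^esub> y) = J1_map K \<Omega> N f x \<oplus>\<^bsub>J1 K \<Omega> N\<^esub> J1_map K \<Omega> N f y"
      by (rule J1_eqI[OF N])
        (use x y in \<open>simp_all add: J1_map_simps J1_add(2-4)[OF M] J1_add(2-4)[OF N] lin_add[OF f]
          jp_closed[OF M] jd_closed[OF M] additive_map_add[OF t] del: One_nat_def\<close>) }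
  fix a assume a: "a \<in> grd \<Omega> 0"
  have t': "tmap 1 M N f (ten 1 M (dif \<Omega> a) (jp M x) \<oplus>\<^bsub>T 1 M\<^esub> lmul 1 1 M a (jd M x)) =
      ten 1 N (dif \<Omega> a) (f (jp M x)) \<oplus>\<^bsub>T 1 N\<^esub> lmul 1 1 N a (tmap 1 M N f (jd M x))"
    using a x additive_map_closed[OF lmul_additive[OF M]]
    by (simp add: additive_map_add[OF t] ten_closed[OF M] jp_closed[OF M] jd_closed[OF M]
        tmap_ten[OF M N f] tmap_lmul[OF M N f] del: One_nat_def)
  show "J1_map K \<Omega> N f (a \<odot>\<^bsub>J1 K \<Omega> M\<^esub> x) = a \<odot>\<^bsub>J1 K \<Omega> N\<^esub> J1_map K \<Omega> N f x"
    by (rule J1_eqI[OF N])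
      (use a x t' in \<open>simp_all add: J1_map_simps J1_smult(2-4)[OF M] J1_smult(2-4)[OF N] lin_act[OF f]
        jp_closed[OF M] del: One_nat_def\<close>)
qed

lemma J1_map_j1: "e \<in> carrier M \<Longrightarrow> J1_map K \<Omega> N f (j1 K \<Omega> M e) = j1 K \<Omega> N (f e)"
  using J1_map_class[of "[(\<one>, e)]"] by (simp add: j1_def one_grd)

end

text \<open>Functoriality, needed to move prolonged maps past the inclusions
  \<open>l^n\<close>.\<close>

lemma J1_map_map:
  assumes "left_module (deg0 \<Omega>) M" "left_module (deg0 \<Omega>) N" "left_module (deg0 \<Omega>) L"
    and "lin M N f" "lin N L g" "x \<in> carrier (J1 K \<Omega> M)"
  shows "J1_map K \<Omega> L g (J1_map K \<Omega> N f x) = J1_map K \<Omega> L (\<lambda>m. g (f m)) x"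
  using J1_map_class[OF assms(2,3,5) map_wf[OF assms(1,2,4) formal_wf[OF assms(1,6)]]]
  by (simp add: J1_map_def[of K \<Omega> N] J1_map_def[of K \<Omega> L "\<lambda>m. g (f m)"] comp_def split_def)

end

section \<open>Holonomic jets\<close>

context jet_algebra
begin

text \<open>\<open>hol1\<close> and \<open>hol2\<close> are the two maps in the definition of
  \<open>J^n\<close>, with values in \<open>\<Omega>^1 \<otimes> M\<close> and
  \<open>\<Omega>^2 \<otimes> M\<close>; the inner sum over \<open>c \<otimes> e\<close> is
  collected in \<open>jd M z\<close>.\<close>

definition hol1 :: "('w, ('w, 'e) jet) module \<Rightarrow> ('w \<times> ('w, 'e) jet) list \<Rightarrow> ('w \<times> ('w, 'e) jet) list set" where
  "hol1 M ys = lsum (T 1 M) (\<lambda>(a, z). lmul 1 1 M a (jd M z)) ys"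

definition hol2 :: "('w, ('w, 'e) jet) module \<Rightarrow> ('w \<times> ('w, 'e) jet) list \<Rightarrow> ('w \<times> ('w, 'e) jet) list set" where
  "hol2 M ys = lsum (T 2 M) (\<lambda>(a, z). lmul 2 1 M (dif \<Omega> a) (jd M z)) ys"

definition holonomic :: "('w, ('w, 'e) jet) module \<Rightarrow> ('w, 'e) jet \<Rightarrow> bool" where
  "holonomic M x \<longleftrightarrow> form_eq \<Omega> 1 M (form1 \<Omega> x) [] \<and> form_eq \<Omega> 2 M (form2 \<Omega> x) []"

lemma hol_simps [simp]:
  "hol1 M [] = \<zero>\<^bsub>T 1 M\<^esub>" "hol1 M ((a, z) # ys) = lmul 1 1 M a (jd M z) \<oplus>\<^bsub>T 1 M\<^esub> hol1 M ys"
  "hol2 M [] = \<zero>\<^bsub>T 2 M\<^esub>" "hol2 M ((a, z) # ys) = lmul 2 1 M (dif \<Omega> a) (jd M z) \<oplus>\<^bsub>T 2 M\<^esub> hol2 M ys"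
  by (simp_all add: hol1_def hol2_def)

context
  fixes M :: "('w, ('w, 'e) jet) module"
  assumes M: "left_module (deg0 \<Omega>) M"
begin

interpretation M: left_module "deg0 \<Omega>" M by (rule M)
interpretation T: abelian_group "T k M" for k by (rule T_group[OF M])
interpretation J: left_module "deg0 \<Omega>" "J1 K \<Omega> M" by (rule J1_module[OF M])
interpretation TJ: abelian_group "T k (J1 K \<Omega> M)" for k by (rule T_group[OF J1_module[OF M]])

lemma lmul11: "a \<in> grd \<Omega> 0 \<Longrightarrow> additive_map (T 1 M) (T 1 M) (lmul 1 1 M a)"
  and lmul21: "w \<in> grd \<Omega> 1 \<Longrightarrow> additive_map (T 1 M) (T 2 M) (lmul 2 1 M w)"
  and lmul22: "a \<in> grd \<Omega> 0 \<Longrightarrow> additive_map (T 2 M) (T 2 M) (lmul 2 2 M a)"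
  by (rule lmul_additive[OF M]; simp)+

lemma lmul_closed:
  "a \<in> grd \<Omega> 0 \<Longrightarrow> t \<in> carrier (T 1 M) \<Longrightarrow> lmul 1 1 M a t \<in> carrier (T 1 M)"
  "w \<in> grd \<Omega> 1 \<Longrightarrow> t \<in> carrier (T 1 M) \<Longrightarrow> lmul 2 1 M w t \<in> carrier (T 2 M)"
  "a \<in> grd \<Omega> 0 \<Longrightarrow> u \<in> carrier (T 2 M) \<Longrightarrow> lmul 2 2 M a u \<in> carrier (T 2 M)"
  using additive_map_closed[OF lmul11] additive_map_closed[OF lmul21] additive_map_closed[OF lmul22] by auto

lemma lmul_plus:
  "a \<in> grd \<Omega> 0 \<Longrightarrow> t \<in> carrier (T 1 M) \<Longrightarrow> t' \<in> carrier (T 1 M) \<Longrightarrow>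
    lmul 1 1 M a (t \<oplus>\<^bsub>T 1 M\<^esub> t') = lmul 1 1 M a t \<oplus>\<^bsub>T 1 M\<^esub> lmul 1 1 M a t'"
  "w \<in> grd \<Omega> 1 \<Longrightarrow> t \<in> carrier (T 1 M) \<Longrightarrow> t' \<in> carrier (T 1 M) \<Longrightarrow>
    lmul 2 1 M w (t \<oplus>\<^bsub>T 1 M\<^esub> t') = lmul 2 1 M w t \<oplus>\<^bsub>T 2 M\<^esub> lmul 2 1 M w t'"
  "a \<in> grd \<Omega> 0 \<Longrightarrow> u \<in> carrier (T 2 M) \<Longrightarrow> u' \<in> carrier (T 2 M) \<Longrightarrow>
    lmul 2 2 M a (u \<oplus>\<^bsub>T 2 M\<^esub> u') = lmul 2 2 M a u \<oplus>\<^bsub>T 2 M\<^esub> lmul 2 2 M a u'"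
  using additive_map_add[OF lmul11] additive_map_add[OF lmul21] additive_map_add[OF lmul22] by auto

lemma lmul_zero:
  "a \<in> grd \<Omega> 0 \<Longrightarrow> lmul 1 1 M a \<zero>\<^bsub>T 1 M\<^esub> = \<zero>\<^bsub>T 1 M\<^esub>"
  "w \<in> grd \<Omega> 1 \<Longrightarrow> lmul 2 1 M w \<zero>\<^bsub>T 1 M\<^esub> = \<zero>\<^bsub>T 2 M\<^esub>"
  "a \<in> grd \<Omega> 0 \<Longrightarrow> lmul 2 2 M a \<zero>\<^bsub>T 2 M\<^esub> = \<zero>\<^bsub>T 2 M\<^esub>"
  using additive_map_zero[OF T.abelian_group_axioms T.abelian_group_axioms] lmul11 lmul21 lmul22 by blast+

lemma lmul_1_2:
  "w \<in> grd \<Omega> 1 \<Longrightarrow> v \<in> grd \<Omega> 1 \<Longrightarrow> e \<in> carrier M \<Longrightarrow> lmul 2 1 M w (ten 1 M v e) = ten 2 M (w \<otimes> v) e"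
  "w \<in> grd \<Omega> 1 \<Longrightarrow> a \<in> grd \<Omega> 0 \<Longrightarrow> t \<in> carrier (T 1 M) \<Longrightarrow>
    lmul 2 1 M w (lmul 1 1 M a t) = lmul 2 1 M (w \<otimes> a) t"
  "w \<in> grd \<Omega> 1 \<Longrightarrow> a \<in> grd \<Omega> 0 \<Longrightarrow> t \<in> carrier (T 1 M) \<Longrightarrow>
    lmul 2 2 M a (lmul 2 1 M w t) = lmul 2 1 M (a \<otimes> w) t"
  "w \<in> grd \<Omega> 1 \<Longrightarrow> v \<in> grd \<Omega> 1 \<Longrightarrow> t \<in> carrier (T 1 M) \<Longrightarrow>
    lmul 2 1 M (w \<oplus> v) t = lmul 2 1 M w t \<oplus>\<^bsub>T 2 M\<^esub> lmul 2 1 M v t"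
  by (rule lmul_ten[OF M] lmul_lmul[OF M] lmul_add_left[OF M]; simp)+

lemma hol_closed [simp]: "wf_forms 0 (J1 K \<Omega> M) ys \<Longrightarrow> hol1 M ys \<in> carrier (T 1 M)"
  "wf_forms 0 (J1 K \<Omega> M) ys \<Longrightarrow> hol2 M ys \<in> carrier (T 2 M)"
  by (induction rule: wf_forms_induct) (auto simp: lmul_closed jd_closed[OF M] simp del: One_nat_def)

lemma hol_append:
  assumes "wf_forms 0 (J1 K \<Omega> M) xs" "wf_forms 0 (J1 K \<Omega> M) ys"
  shows "hol1 M (xs @ ys) = hol1 M xs \<oplus>\<^bsub>T 1 M\<^esub> hol1 M ys"
    "hol2 M (xs @ ys) = hol2 M xs \<oplus>\<^bsub>T 2 M\<^esub> hol2 M ys"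
  using assms
  by (induction rule: wf_forms_induct)
    (simp_all add: lmul_closed jd_closed[OF M] T.a_assoc del: One_nat_def)

text \<open>Connects the doubly indexed formal sums \<open>form1\<close> and \<open>form2\<close>
  with \<open>hol1\<close> and \<open>hol2\<close>: left multiplication by a form distributes over
  the inner sum that represents \<open>jd\<close>.\<close>

lemma form_sums:
  assumes x: "wf_forms 0 (J1 K \<Omega> M) xs"
  shows "wf_forms 1 M (form1 \<Omega> (Jet xs))"
    "lsum (T 1 M) (\<lambda>(w, e). ten 1 M w e) (form1 \<Omega> (Jet xs)) = hol1 M xs"
    "wf_forms 2 M (form2 \<Omega> (Jet xs))"
    "lsum (T 2 M) (\<lambda>(w, e). ten 2 M w e) (form2 \<Omega> (Jet xs)) = hol2 M xs"
proof -
  have m2: "w \<otimes> v \<in> grd \<Omega> 2" if "w \<in> grd \<Omega> 1" "v \<in> grd \<Omega> 1" for w v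
    using mult_grd[OF that] by (simp add: numeral_2_eq_2)
  have 1: "wf_forms 1 M (map (\<lambda>(c, e). (a \<otimes> dif \<Omega> c, e)) zs) \<and>
      lsum (T 1 M) (\<lambda>(w, e). ten 1 M w e) (map (\<lambda>(c, e). (a \<otimes> dif \<Omega> c, e)) zs) = lmul 1 1 M a (jdif M zs)"
    if "a \<in> grd \<Omega> 0" "wf_forms 0 M zs" for a zs
    using that(2) by (induction rule: wf_forms_induct)
      (use that(1) in \<open>simp_all add: lmul_zero lmul_plus lmul_ten[OF M] ten_closed[OF M] jdif_closed[OF M] del: One_nat_def\<close>)
  have 2: "wf_forms 2 M (map (\<lambda>(c, e). (w \<otimes> dif \<Omega> c, e)) zs) \<and>
      lsum (T 2 M) (\<lambda>(w, e). ten 2 M w e) (map (\<lambda>(c, e). (w \<otimes> dif \<Omega> c, e)) zs) = lmul 2 1 M w (jdif M zs)"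
    if "w \<in> grd \<Omega> 1" "wf_forms 0 M zs" for w zs
    using that(2) by (induction rule: wf_forms_induct)
      (use that(1) in \<open>simp_all add: m2 lmul_zero lmul_plus lmul_1_2 ten_closed[OF M] jdif_closed[OF M] del: One_nat_def\<close>)
  have ap: "lsum (T k M) (\<lambda>(w, e). ten k M w e) (us @ vs) =
      lsum (T k M) (\<lambda>(w, e). ten k M w e) us \<oplus>\<^bsub>T k M\<^esub> lsum (T k M) (\<lambda>(w, e). ten k M w e) vs"
    if "wf_forms k M us" "wf_forms k M vs" for k us vs
    by (rule T.lsum_append) (use that in \<open>auto simp: wf_forms_def intro!: ten_closed[OF M]\<close>)
  have "wf_forms 1 M (form1 \<Omega> (Jet xs)) \<and> wf_forms 2 M (form2 \<Omega> (Jet xs)) \<and>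
    lsum (T 1 M) (\<lambda>(w, e). ten 1 M w e) (form1 \<Omega> (Jet xs)) = hol1 M xs \<and>
    lsum (T 2 M) (\<lambda>(w, e). ten 2 M w e) (form2 \<Omega> (Jet xs)) = hol2 M xs"
    using x
  proof (induction rule: wf_forms_induct)
    case Nil
    then show ?case by (simp add: form1_def form2_def)
  next
    case (Cons a z xs)
    have z: "wf_forms 0 M (formal z)" by (rule formal_wf[OF M Cons(2)])
    note p = 1[OF Cons(1) z] 2[OF dif_grd1[OF Cons(1)] z]
    have f: "form1 \<Omega> (Jet ((a, z) # xs)) = map (\<lambda>(c, e). (a \<otimes> dif \<Omega> c, e)) (formal z) @ form1 \<Omega> (Jet xs)"
      "form2 \<Omega> (Jet ((a, z) # xs)) = map (\<lambda>(c, e). (dif \<Omega> a \<otimes> dif \<Omega> c, e)) (formal z) @ form2 \<Omega> (Jet xs)"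
      by (simp_all add: form1_def form2_def)
    show ?case using p Cons.IH unfolding f by (simp add: ap jd_def del: One_nat_def)
  qed
  then show "wf_forms 1 M (form1 \<Omega> (Jet xs))"
    "lsum (T 1 M) (\<lambda>(w, e). ten 1 M w e) (form1 \<Omega> (Jet xs)) = hol1 M xs"
    "wf_forms 2 M (form2 \<Omega> (Jet xs))"
    "lsum (T 2 M) (\<lambda>(w, e). ten 2 M w e) (form2 \<Omega> (Jet xs)) = hol2 M xs"
    by blast+
qed

lemma holonomic_iff:
  assumes "x \<in> carrier (J1 K \<Omega> (J1 K \<Omega> M))"
  shows "holonomic M x \<longleftrightarrow> hol1 M (formal x) = \<zero>\<^bsub>T 1 M\<^esub> \<and> hol2 M (formal x) = \<zero>\<^bsub>T 2 M\<^esub>"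
proof -
  have w: "wf_forms 0 (J1 K \<Omega> M) (formal x)" by (rule formal_wf[OF J1_module[OF M] assms])
  have f: "form1 \<Omega> x = form1 \<Omega> (Jet (formal x))" "form2 \<Omega> x = form2 \<Omega> (Jet (formal x))"
    by (simp_all add: form1_def form2_def)
  note s = form_sums[OF w]
  show ?thesis
    unfolding holonomic_def f form_eq_iff[OF M s(1) wf_forms_simps(1)] form_eq_iff[OF M s(3) wf_forms_simps(1)] s
    by (simp del: One_nat_def)
qed

text \<open>Both holonomy conditions are functions of \<open>jval\<close> and \<open>jdif\<close>, hence well defined on jets:
  \<open>a dc = d(a c) - da c\<close> gives the first, and \<open>da \<and> dc = - d(da c)\<close> the second.\<close>

lemma hol1_jval:
  assumes "wf_forms 0 (J1 K \<Omega> M) ys"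
  shows "hol1 M ys \<oplus>\<^bsub>T 1 M\<^esub> tmap 1 (J1 K \<Omega> M) M (jp M) (jdif (J1 K \<Omega> M) ys) = jd M (jval (J1 K \<Omega> M) ys)"
  using assms
proof (induction rule: wf_forms_induct)
  note t = tmap_additive[OF J1_module[OF M] M jp_lin[OF M], of 1]
  case Nil
  then show ?case
    by (simp add: J1_zero_simps[OF M] additive_map_zero[OF TJ.abelian_group_axioms T.abelian_group_axioms t] del: One_nat_def)
next
  note t = tmap_additive[OF J1_module[OF M] M jp_lin[OF M], of 1]
  case (Cons a z ys)
  note c = jval_closed[OF J1_module[OF M] Cons(3)] jdif_closed[OF J1_module[OF M] Cons(3)]
    ten_closed[OF J1_module[OF M] dif_grd1[OF Cons(1)] Cons(2)]
  have d: "lmul 1 1 M a (jd M z) \<in> carrier (T 1 M)" "hol1 M ys \<in> carrier (T 1 M)"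
    "ten 1 M (dif \<Omega> a) (jp M z) \<in> carrier (T 1 M)"
    "tmap 1 (J1 K \<Omega> M) M (jp M) (jdif (J1 K \<Omega> M) ys) \<in> carrier (T 1 M)"
    using Cons(1-3) additive_map_closed[OF t c(2)]
    by (auto simp: lmul_closed jd_closed[OF M] jp_closed[OF M] ten_closed[OF M] simp del: One_nat_def)
  show ?case
    using Cons(1-3) c d
    by (simp add: J1_add(4)[OF M] J1_smult(2,4)[OF M] additive_map_add[OF t] Cons.IH[symmetric]
        tmap_ten[OF J1_module[OF M] M jp_lin[OF M]] T.a_ac del: One_nat_def)
qed

text \<open>The well-defined version of
  \<open>w \<otimes> [c \<otimes> e] \<mapsto> d(w c) \<otimes> e\<close>, because
  \<open>d(w c) = dw c - w dc\<close> for a one-form \<open>w\<close>.\<close>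

definition delta :: "'w \<Rightarrow> ('w, 'e) jet \<Rightarrow> ('w \<times> ('w, 'e) jet) list set" where
  "delta w z = ten 2 M (dif \<Omega> w) (jp M z) \<oplus>\<^bsub>T 2 M\<^esub> \<ominus>\<^bsub>T 2 M\<^esub> lmul 2 1 M w (jd M z)"

text \<open>Moving \<open>a\<close> across the tensor sign produces the term
  \<open>w da \<otimes> e\<close> on both sides with the same sign: on the left from
  \<open>d(w a)\<close>, on the right from the Leibniz term in the differential of
  \<open>a z\<close>.\<close>

lemma delta_balanced: "balanced 1 (J1 K \<Omega> M) (T 2 M) delta"
proof -
  have m2: "w \<otimes> v \<in> grd \<Omega> 2" if "w \<in> grd \<Omega> 1" "v \<in> grd \<Omega> 1" for w v
    using mult_grd[OF that] by (simp add: numeral_2_eq_2)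
  have bal: "delta (w \<otimes> a) z = delta w (a \<odot>\<^bsub>J1 K \<Omega> M\<^esub> z)"
    if a: "a \<in> grd \<Omega> 0" and w: "w \<in> grd \<Omega> 1" and z: "z \<in> carrier (J1 K \<Omega> M)" for a w z
  proof -
    have 1: "ten 2 M (dif \<Omega> (w \<otimes> a)) (jp M z) =
        ten 2 M (dif \<Omega> w) (a \<odot>\<^bsub>M\<^esub> jp M z) \<oplus>\<^bsub>T 2 M\<^esub> \<ominus>\<^bsub>T 2 M\<^esub> ten 2 M (w \<otimes> dif \<Omega> a) (jp M z)"
      using a w z m2 by (simp add: dif_mult1 grd_subset[OF a] ten_add_left[OF M] ten_balanced[OF M]
        ten_minus_left[OF M] jp_closed[OF M] del: One_nat_def)
    have 2: "lmul 2 1 M w (ten 1 M (dif \<Omega> a) (jp M z) \<oplus>\<^bsub>T 1 M\<^esub> lmul 1 1 M a (jd M z)) =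
        ten 2 M (w \<otimes> dif \<Omega> a) (jp M z) \<oplus>\<^bsub>T 2 M\<^esub> lmul 2 1 M (w \<otimes> a) (jd M z)"
      using a w z by (simp add: lmul_plus lmul_1_2 ten_closed[OF M] lmul_closed
          jp_closed[OF M] jd_closed[OF M] del: One_nat_def)
    have c: "ten 2 M (dif \<Omega> w) (a \<odot>\<^bsub>M\<^esub> jp M z) \<in> carrier (T 2 M)"
      "ten 2 M (w \<otimes> dif \<Omega> a) (jp M z) \<in> carrier (T 2 M)" "lmul 2 1 M (w \<otimes> a) (jd M z) \<in> carrier (T 2 M)"
      using a w z m2 by (auto simp: ten_closed[OF M] jp_closed[OF M] jd_closed[OF M] act_simps[OF M]
          lmul_closed simp del: One_nat_def)
    show ?thesis unfolding delta_def 1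
      using a z c by (simp add: J1_smult(3,4)[OF M] 2 T.minus_add T.a_ac del: One_nat_def)
  qed
  have c: "w \<in> grd \<Omega> 1 \<Longrightarrow> z \<in> carrier (J1 K \<Omega> M) \<Longrightarrow>
      ten 2 M (dif \<Omega> w) (jp M z) \<in> carrier (T 2 M) \<and> lmul 2 1 M w (jd M z) \<in> carrier (T 2 M)" for w z
    by (auto simp: ten_closed[OF M] lmul_closed jp_closed[OF M] jd_closed[OF M] simp del: One_nat_def)
  have al: "delta (w \<oplus> w') z = delta w z \<oplus>\<^bsub>T 2 M\<^esub> delta w' z"
    if w: "w \<in> grd \<Omega> 1" "w' \<in> grd \<Omega> 1" and z: "z \<in> carrier (J1 K \<Omega> M)" for w w' z
    unfolding delta_def using w z c[OF w(1) z] c[OF w(2) z]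
    by (simp add: dif_add grd_subset[of _ 1] ten_add_left[OF M] lmul_1_2 jp_closed[OF M] jd_closed[OF M]
        T.minus_add T.a_ac del: One_nat_def)
  have ar: "delta w (z \<oplus>\<^bsub>J1 K \<Omega> M\<^esub> z') = delta w z \<oplus>\<^bsub>T 2 M\<^esub> delta w z'"
    if w: "w \<in> grd \<Omega> 1" and z: "z \<in> carrier (J1 K \<Omega> M)" "z' \<in> carrier (J1 K \<Omega> M)" for w z z'
    unfolding delta_def using w z c[OF w z(1)] c[OF w z(2)]
    by (simp add: J1_add(3,4)[OF M] ten_add_right[OF M] lmul_plus jp_closed[OF M] jd_closed[OF M]
        T.minus_add T.a_ac del: One_nat_def)
  have cl: "delta w z \<in> carrier (T 2 M)" if "w \<in> grd \<Omega> 1" "z \<in> carrier (J1 K \<Omega> M)" for w z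
    unfolding delta_def using c[OF that] by simp
  show ?thesis unfolding balanced_def by (intro conjI ballI T.abelian_group_axioms bal al ar cl)
qed

text \<open>For \<open>w = da\<close> the first term of \<open>delta\<close> vanishes by
  \<open>d d = 0\<close>, which leaves minus the second holonomy map.\<close>

lemma hol2_jdif:
  assumes "wf_forms 0 (J1 K \<Omega> M) ys"
  shows "hol2 M ys = \<ominus>\<^bsub>T 2 M\<^esub> tlift 1 (J1 K \<Omega> M) (T 2 M) delta (jdif (J1 K \<Omega> M) ys)"
  using assms
proof (induction rule: wf_forms_induct)
  let ?L = "tlift 1 (J1 K \<Omega> M) (T 2 M) delta"
  have L: "additive_map (T 1 (J1 K \<Omega> M)) (T 2 M) ?L"
    using tlift_closed[OF J1_module[OF M] delta_balanced] tlift_add[OF J1_module[OF M] delta_balanced]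
    by (simp add: additive_map_def Pi_iff del: One_nat_def)
  {
    case Nil
    then show ?case
      by (simp add: additive_map_zero[OF TJ.abelian_group_axioms T.abelian_group_axioms L] del: One_nat_def)
  next
    case (Cons a z ys)
    note c = jdif_closed[OF J1_module[OF M] Cons(3)] ten_closed[OF J1_module[OF M] dif_grd1[OF Cons(1)] Cons(2)]
    have "ten 2 M \<zero>\<^bsub>\<Omega>\<lparr>carrier := grd \<Omega> 2\<rparr>\<^esub> (jp M z) = \<zero>\<^bsub>T 2 M\<^esub>"
      by (rule additive_zero[OF grd_group[of 2] T.abelian_group_axioms[of 2], where h = "\<lambda>w. ten 2 M w (jp M z)"])
        (use Cons(2) in \<open>simp_all add: Pi_iff ten_closed[OF M] ten_add_left[OF M] jp_closed[OF M]\<close>)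
    moreover have k: "lmul 2 1 M (dif \<Omega> a) (jd M z) \<in> carrier (T 2 M)"
      using Cons(1,2) by (simp add: lmul_closed jd_closed[OF M] del: One_nat_def)
    ultimately have "delta (dif \<Omega> a) z = \<ominus>\<^bsub>T 2 M\<^esub> lmul 2 1 M (dif \<Omega> a) (jd M z)"
      unfolding delta_def using Cons(1) by (simp add: dif_dif grd_subset del: One_nat_def)
    moreover have "?L (ten 1 (J1 K \<Omega> M) (dif \<Omega> a) z) = delta (dif \<Omega> a) z"
      by (rule tlift_ten[OF J1_module[OF M] delta_balanced dif_grd1[OF Cons(1)] Cons(2)])
    ultimately show ?case
      using c k additive_map_closed[OF L c(1)]
      by (simp add: additive_map_add[OF L] Cons.IH T.minus_add del: One_nat_def)
  }
qed

lemma hol_class: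
  assumes "wf_forms 0 (J1 K \<Omega> M) ys"
  shows "hol1 M (formal (jet_class K \<Omega> (J1 K \<Omega> M) ys)) = hol1 M ys"
    "hol2 M (formal (jet_class K \<Omega> (J1 K \<Omega> M) ys)) = hol2 M ys"
proof -
  let ?zs = "formal (jet_class K \<Omega> (J1 K \<Omega> M) ys)"
  let ?t = "\<lambda>ys. tmap 1 (J1 K \<Omega> M) M (jp M) (jdif (J1 K \<Omega> M) ys)"
  note f = formal_jet_class[OF J1_module[OF M] assms]
  have e: "jval (J1 K \<Omega> M) ?zs = jval (J1 K \<Omega> M) ys" "jdif (J1 K \<Omega> M) ?zs = jdif (J1 K \<Omega> M) ys"
    using f by (simp_all add: jp_def jd_def)
  have t: "?t ys \<in> carrier (T 1 M)"
    by (rule additive_map_closed[OF tmap_additive[OF J1_module[OF M] M jp_lin[OF M]] jdif_closed[OF J1_module[OF M] assms]])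
  \<comment> \<open>Value and differential agree for both sums, so \<open>hol1_jval\<close> gives
    the same right-hand side for both; the common summand cancels.\<close>
  have "hol1 M ?zs \<oplus>\<^bsub>T 1 M\<^esub> ?t ys = hol1 M ys \<oplus>\<^bsub>T 1 M\<^esub> ?t ys"
    using hol1_jval[OF assms] hol1_jval[OF f(1)] by (simp add: e)
  then show "hol1 M ?zs = hol1 M ys"
    using t hol_closed(1)[OF assms] hol_closed(1)[OF f(1)] by (simp del: One_nat_def)
  show "hol2 M ?zs = hol2 M ys"
    using hol2_jdif[OF assms] hol2_jdif[OF f(1)] by (simp add: e)
qed

lemma holonomic_class:
  assumes "wf_forms 0 (J1 K \<Omega> M) ys"
  shows "holonomic M (jet_class K \<Omega> (J1 K \<Omega> M) ys) \<longleftrightarrow> hol1 M ys = \<zero>\<^bsub>T 1 M\<^esub> \<and> hol2 M ys = \<zero>\<^bsub>T 2 M\<^esub>"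
  by (simp only: holonomic_iff[OF jet_class_closed[OF J1_module[OF M] assms]] hol_class[OF assms])

lemma holonomic_zero: "holonomic M \<zero>\<^bsub>J1 K \<Omega> (J1 K \<Omega> M)\<^esub>"
  unfolding J1_zero[OF J1_module[OF M]] by (subst holonomic_class) auto

lemma holonomic_add:
  assumes "x \<in> carrier (J1 K \<Omega> (J1 K \<Omega> M))" "y \<in> carrier (J1 K \<Omega> (J1 K \<Omega> M))" "holonomic M x" "holonomic M y"
  shows "holonomic M (x \<oplus>\<^bsub>J1 K \<Omega> (J1 K \<Omega> M)\<^esub> y)"
proof -
  note w = formal_wf[OF J1_module[OF M] assms(1)] formal_wf[OF J1_module[OF M] assms(2)]
  show ?thesis
    unfolding J1_add(1)[OF J1_module[OF M] assms(1,2)]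
    using assms w by (subst holonomic_class) (simp_all add: holonomic_iff hol_append[OF w] del: One_nat_def)
qed

text \<open>By \<open>d(a b) = da b + a db\<close>, the second holonomy sum of \<open>a x\<close>
  contains \<open>da\<close> times the first holonomy sum of \<open>x\<close>. Stability of the
  second condition therefore uses the first.\<close>

lemma holonomic_smult:
  assumes a: "a \<in> grd \<Omega> 0" and x: "x \<in> carrier (J1 K \<Omega> (J1 K \<Omega> M))" and h: "holonomic M x"
  shows "holonomic M (a \<odot>\<^bsub>J1 K \<Omega> (J1 K \<Omega> M)\<^esub> x)"
proof -
  have p: "hol1 M (mul_sum a ys) = lmul 1 1 M a (hol1 M ys) \<and>
      hol2 M (mul_sum a ys) = lmul 2 1 M (dif \<Omega> a) (hol1 M ys) \<oplus>\<^bsub>T 2 M\<^esub> lmul 2 2 M a (hol2 M ys)"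
    if "wf_forms 0 (J1 K \<Omega> M) ys" for ys
    using that
  proof (induction rule: wf_forms_induct)
    case Nil
    then show ?case using a by (simp add: mul_sum_def lmul_zero del: One_nat_def)
  next
    case (Cons b z ys)
    have j: "jd M z \<in> carrier (T 1 M)" using Cons(2) jd_closed[OF M] by blast
    have "lmul 2 1 M (dif \<Omega> (a \<otimes> b)) (jd M z) =
        lmul 2 1 M (dif \<Omega> a) (lmul 1 1 M b (jd M z)) \<oplus>\<^bsub>T 2 M\<^esub> lmul 2 2 M a (lmul 2 1 M (dif \<Omega> b) (jd M z))"
      using a Cons(1) j
      by (simp add: dif_mult0 grd_subset[of _ 0] lmul_1_2 del: One_nat_def)
    moreover have "lmul 1 1 M (a \<otimes> b) (jd M z) = lmul 1 1 M a (lmul 1 1 M b (jd M z))"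
      using a Cons(1) j by (simp add: lmul_lmul[OF M] del: One_nat_def)
    moreover have "mul_sum a ((b, z) # ys) = (a \<otimes> b, z) # mul_sum a ys" by (simp add: mul_sum_def)
    moreover have "lmul 1 1 M b (jd M z) \<in> carrier (T 1 M)" "lmul 2 1 M (dif \<Omega> b) (jd M z) \<in> carrier (T 2 M)"
      using Cons(1) j by (simp_all add: lmul_closed del: One_nat_def)
    ultimately show ?case
      using Cons.IH a Cons(1,3)
      by (simp add: lmul_plus lmul_closed T.a_ac del: One_nat_def)
  qed
  note w = formal_wf[OF J1_module[OF M] x]
  show ?thesis
    unfolding J1_smult(1)[OF J1_module[OF M] a x]
    using h x a p[OF w]
    by (subst holonomic_class[OF mul_sum_wf[OF J1_module[OF M] a w]])
      (simp add: holonomic_iff lmul_zero del: One_nat_def)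
qed

lemma jd_j1: "e \<in> carrier M \<Longrightarrow> jd M (j1 K \<Omega> M e) = \<zero>\<^bsub>T 1 M\<^esub>"
proof -
  assume e: "e \<in> carrier M"
  have "ten 1 M \<zero>\<^bsub>\<Omega>\<lparr>carrier := grd \<Omega> 1\<rparr>\<^esub> e = \<zero>\<^bsub>T 1 M\<^esub>"
    by (rule additive_zero[OF grd_group[of 1] T.abelian_group_axioms[of 1], where h = "\<lambda>w. ten 1 M w e"])
      (use e in \<open>simp_all add: Pi_iff ten_closed[OF M] ten_add_left[OF M] del: One_nat_def\<close>)
  then show ?thesis
    using e formal_jet_class(3)[OF M, of "[(\<one>, e)]"] by (simp add: j1_def one_grd dif_one del: One_nat_def)
qed

text \<open>Each holonomy sum is a multiple of the differential of \<open>j1 K \<Omega> M e\<close>,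
  which is zero by \<open>d1 = 0\<close>.\<close>

lemma holonomic_j1_j1: "e \<in> carrier M \<Longrightarrow> holonomic M (j1 K \<Omega> (J1 K \<Omega> M) (j1 K \<Omega> M e))"
  unfolding j1_def[of K \<Omega> "J1 K \<Omega> M" "j1 K \<Omega> M e"]
  by (subst holonomic_class)
    (simp_all add: j1_simps(1)[OF M] one_grd jd_j1 lmul_zero del: One_nat_def)

end

text \<open>Both holonomy maps are natural: \<open>id \<otimes> f\<close> carries the sums of
  \<open>x\<close> to those of its image. This keeps prolonged maps inside
  \<open>J^n\<close>.\<close>

lemma holonomic_map:
  assumes M: "left_module (deg0 \<Omega>) M" and N: "left_module (deg0 \<Omega>) N" and f: "lin M N f"
    and x: "x \<in> carrier (J1 K \<Omega> (J1 K \<Omega> M))" and h: "holonomic M x"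
  shows "holonomic N (J1_map K \<Omega> (J1 K \<Omega> N) (J1_map K \<Omega> N f) x)"
proof -
  interpret TM: abelian_group "T k M" for k by (rule T_group[OF M])
  interpret TN: abelian_group "T k N" for k by (rule T_group[OF N])
  let ?m = "map (\<lambda>(a, m). (a, J1_map K \<Omega> N f m))"
  note t = tmap_additive[OF M N f]
  note mw = map_wf[OF J1_module[OF M] J1_module[OF N] J1_map_lin[OF M N f]]
  have z: "tmap k M N f \<zero>\<^bsub>T k M\<^esub> = \<zero>\<^bsub>T k N\<^esub>" for k
    by (rule additive_map_zero[OF TM.abelian_group_axioms TN.abelian_group_axioms t])
  have t21: "tmap 2 M N f (lmul 2 1 M w t) = lmul 2 1 N w (tmap 1 M N f t)"
    if "w \<in> grd \<Omega> 1" "t \<in> carrier (T 1 M)" for w t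
    by (rule tmap_lmul[OF M N f]) (use that in simp_all)
  have p: "hol1 N (?m ys) = tmap 1 M N f (hol1 M ys) \<and> hol2 N (?m ys) = tmap 2 M N f (hol2 M ys)"
    if "wf_forms 0 (J1 K \<Omega> M) ys" for ys
    using that
    by (induction rule: wf_forms_induct)
      (simp_all add: z additive_map_add[OF t] lmul_closed[OF M] jd_closed[OF M] J1_map_simps(3)[OF M N f]
        t21 tmap_lmul[OF M N f] hol_closed[OF M] del: One_nat_def)
  note w = formal_wf[OF J1_module[OF M] x]
  show ?thesis
    using h x p[OF w] unfolding J1_map_def[of K \<Omega> "J1 K \<Omega> N"] holonomic_class[OF N mw[OF w]]
    by (simp add: holonomic_iff[OF M] z del: One_nat_def)
qed

end

section \<open>Iterated jets and differential operators\<close>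

context jet_algebra
begin

lemma restrict_carrier_module:
  assumes P: "left_module (deg0 \<Omega>) P" and C: "C \<subseteq> carrier P" "\<zero>\<^bsub>P\<^esub> \<in> C"
    and add: "\<And>x y. x \<in> C \<Longrightarrow> y \<in> C \<Longrightarrow> x \<oplus>\<^bsub>P\<^esub> y \<in> C"
    and act: "\<And>a x. a \<in> grd \<Omega> 0 \<Longrightarrow> x \<in> C \<Longrightarrow> a \<odot>\<^bsub>P\<^esub> x \<in> C"
  shows "left_module (deg0 \<Omega>) (P\<lparr>carrier := C\<rparr>)" "lin (P\<lparr>carrier := C\<rparr>) P (\<lambda>x. x)"
proof -
  interpret P: left_module "deg0 \<Omega>" P by (rule P)
  have "\<exists>y\<in>C. y \<oplus>\<^bsub>P\<^esub> x = \<zero>\<^bsub>P\<^esub>" if x: "x \<in> C" for x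
  proof
    have xc: "x \<in> carrier P" using x C by blast
    \<comment> \<open>Negatives in \<open>C\<close> come from the action of -1.\<close>
    have "(\<ominus> \<one>) \<odot>\<^bsub>P\<^esub> x = \<ominus>\<^bsub>P\<^esub> x"
      using act_minus[OF P one_grd xc] xc by (simp add: act_simps[OF P])
    then show "(\<ominus> \<one>) \<odot>\<^bsub>P\<^esub> x \<in> C" "(\<ominus> \<one>) \<odot>\<^bsub>P\<^esub> x \<oplus>\<^bsub>P\<^esub> x = \<zero>\<^bsub>P\<^esub>"
      using act[OF _ x, of "\<ominus> \<one>"] xc by (simp_all add: one_grd P.l_neg)
  qed
  then have "abelian_group (P\<lparr>carrier := C\<rparr>)"
    using C by (intro abelian_groupI) (auto simp: add subset_iff intro: P.a_ac)
  then show "left_module (deg0 \<Omega>) (P\<lparr>carrier := C\<rparr>)"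
    using C by (intro left_module.intro left_module_axioms.intro deg0_ring)
      (auto simp: act act_rules[OF P] act_simps[OF P] subset_iff)
  show "lin (P\<lparr>carrier := C\<rparr>) P (\<lambda>x. x)"
    using C by (auto simp: lin_def additive_map_def)
qed

lemma Jn_Suc_Suc:
  "Jn K \<Omega> (Suc (Suc n)) M = (J1 K \<Omega> (Jn K \<Omega> (Suc n) M))
     \<lparr>carrier := {x \<in> carrier (J1 K \<Omega> (Jn K \<Omega> (Suc n) M)).
        holonomic (Jn K \<Omega> n M) (J1_map K \<Omega> (J1 K \<Omega> (Jn K \<Omega> n M)) (\<lambda>m. m) x)}\<rparr>"
  by (simp add: holonomic_def Let_def)

declare Jn.simps(3) [simp del]

section \<open>The modules J^n M and the prolongation of elements\<close>

context
  fixes M :: "('w, ('w, 'e) jet) module"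
  assumes M: "left_module (deg0 \<Omega>) M"
begin

text \<open>Two consecutive levels are carried along because \<open>J^(n+2)\<close> is cut out of
  \<open>J^1 J^(n+1)\<close> by a condition over \<open>J^n\<close>. Its carrier is the preimage of
  the holonomic elements under the linear map \<open>J^1\<close> of the inclusion, hence a
  submodule.\<close>

lemma Jn_module_incl:
  "left_module (deg0 \<Omega>) (Jn K \<Omega> n M) \<and> left_module (deg0 \<Omega>) (Jn K \<Omega> (Suc n) M) \<and>
    lin (Jn K \<Omega> (Suc n) M) (J1 K \<Omega> (Jn K \<Omega> n M)) (\<lambda>x. x)"
proof (induction n)
  case 0
  then show ?case using M J1_module[OF M] by (simp add: lin_def additive_map_def)
next
  case (Suc n)
  let ?J = "Jn K \<Omega> n M" and ?J' = "Jn K \<Omega> (Suc n) M"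
  let ?f = "J1_map K \<Omega> (J1 K \<Omega> ?J) (\<lambda>m. m)"
  let ?C = "{x \<in> carrier (J1 K \<Omega> ?J'). holonomic ?J (?f x)}"
  from Suc have 0: "left_module (deg0 \<Omega>) ?J" and 1: "left_module (deg0 \<Omega>) ?J'"
    and i: "lin ?J' (J1 K \<Omega> ?J) (\<lambda>x. x)" by auto
  note P = J1_module[OF 1]
  interpret P: left_module "deg0 \<Omega>" "J1 K \<Omega> ?J'" by (rule P)
  interpret Q: left_module "deg0 \<Omega>" "J1 K \<Omega> (J1 K \<Omega> ?J)" by (rule J1_module[OF J1_module[OF 0]])
  note f = J1_map_lin[OF 1 J1_module[OF 0] i]
  have "?C \<subseteq> carrier (J1 K \<Omega> ?J')" by auto
  moreover have "\<zero>\<^bsub>J1 K \<Omega> ?J'\<^esub> \<in> ?C"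
    using additive_map_zero[OF P.abelian_group_axioms Q.abelian_group_axioms lin_additive[OF f]]
      holonomic_zero[OF 0] by simp
  moreover have "x \<oplus>\<^bsub>J1 K \<Omega> ?J'\<^esub> y \<in> ?C" if "x \<in> ?C" "y \<in> ?C" for x y
    using that by (simp add: lin_add[OF f] holonomic_add[OF 0] lin_closed[OF f])
  moreover have "a \<odot>\<^bsub>J1 K \<Omega> ?J'\<^esub> x \<in> ?C" if "a \<in> grd \<Omega> 0" "x \<in> ?C" for a x
    using that by (simp add: lin_act[OF f] holonomic_smult[OF 0] lin_closed[OF f] act_simps[OF P])
  ultimately show ?case
    using restrict_carrier_module[OF P, of ?C] 1 unfolding Jn_Suc_Suc by blast
qed

lemmas Jn_module = Jn_module_incl[THEN conjunct1]
  and Jn_incl = Jn_module_incl[THEN conjunct2, THEN conjunct2]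

lemma jn_closed: "e \<in> carrier M \<Longrightarrow> jn K \<Omega> n M e \<in> carrier (Jn K \<Omega> n M)"
proof -
  assume e: "e \<in> carrier M"
  have "jn K \<Omega> n M e \<in> carrier (Jn K \<Omega> n M) \<and> jn K \<Omega> (Suc n) M e \<in> carrier (Jn K \<Omega> (Suc n) M)"
  proof (induction n)
    case 0
    then show ?case using e by (simp add: j1_simps(1)[OF M])
  next
    case (Suc n)
    let ?J = "Jn K \<Omega> n M" and ?J' = "Jn K \<Omega> (Suc n) M"
    from Suc have 0: "jn K \<Omega> n M e \<in> carrier ?J" and 1: "jn K \<Omega> (Suc n) M e \<in> carrier ?J'" by auto
    \<comment> \<open>Naturality of \<open>j1\<close> rewrites the image under \<open>J^1\<close> of
      the inclusion as a double \<open>j1\<close>, which is holonomic.\<close>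
    have "J1_map K \<Omega> (J1 K \<Omega> ?J) (\<lambda>m. m) (j1 K \<Omega> ?J' (jn K \<Omega> (Suc n) M e)) =
        j1 K \<Omega> (J1 K \<Omega> ?J) (j1 K \<Omega> ?J (jn K \<Omega> n M e))"
      using J1_map_j1[OF Jn_module J1_module[OF Jn_module] Jn_incl 1] by simp
    then have "holonomic ?J (J1_map K \<Omega> (J1 K \<Omega> ?J) (\<lambda>m. m) (jn K \<Omega> (Suc (Suc n)) M e))"
      using holonomic_j1_j1[OF Jn_module 0] by simp
    moreover have "jn K \<Omega> (Suc (Suc n)) M e \<in> carrier (J1 K \<Omega> ?J')"
      using j1_simps(1)[OF Jn_module 1] by simp
    ultimately show ?case using 1 by (simp only: Jn_Suc_Suc) simp
  qed
  then show ?thesis ..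
qed

end

text \<open>Iterating the functor \<open>J^1\<close> on \<open>g : J^m M \<rightarrow> N\<close>
  gives maps \<open>J^(n+m) M \<rightarrow> J^n N\<close>. The inclusions \<open>l^n\<close> do not
  appear since they are identities on carriers.\<close>

fun prolong :: "('w, ('w, 'e) jet) module \<Rightarrow> (('w, 'e) jet \<Rightarrow> ('w, 'e) jet) \<Rightarrow> nat \<Rightarrow> ('w, 'e) jet \<Rightarrow> ('w, 'e) jet" where
  "prolong N g 0 = g"
| "prolong N g (Suc n) = J1_map K \<Omega> (Jn K \<Omega> n N) (prolong N g n)"

context
  fixes M N :: "('w, ('w, 'e) jet) module" and m g
  assumes M: "left_module (deg0 \<Omega>) M" and N: "left_module (deg0 \<Omega>) N"
    and g: "lin (Jn K \<Omega> m M) N g"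
begin

text \<open>At level n + 2, linearity into \<open>J^1 J^(n+1) N\<close> is functoriality, whereas
  landing in \<open>J^(n+2) N\<close> requires transporting the holonomy of \<open>x\<close> along
  the map at level n. Hence the induction carries two levels.\<close>

lemma prolong_lin_Suc:
  "lin (Jn K \<Omega> (n + m) M) (Jn K \<Omega> n N) (prolong N g n) \<and>
   lin (Jn K \<Omega> (Suc n + m) M) (Jn K \<Omega> (Suc n) N) (prolong N g (Suc n))"
proof (induction n)
  case 0
  have "lin (Jn K \<Omega> (Suc m) M) (J1 K \<Omega> N) (\<lambda>x. J1_map K \<Omega> N g x)"
    by (rule lin_comp[OF Jn_incl[OF M] J1_map_lin[OF Jn_module[OF M] N g]])
  then show ?case using g by simp
next
  case (Suc n)
  let ?M = "Jn K \<Omega> (n + m) M" and ?M' = "Jn K \<Omega> (Suc (n + m)) M" and ?M2 = "Jn K \<Omega> (Suc (Suc (n + m))) M"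
    and ?N = "Jn K \<Omega> n N" and ?N' = "Jn K \<Omega> (Suc n) N" and ?N2 = "Jn K \<Omega> (Suc (Suc n)) N"
    and ?g = "prolong N g n" and ?g' = "prolong N g (Suc n)"
  from Suc have 0: "lin ?M ?N ?g" and 1: "lin ?M' ?N' ?g'" by simp_all
  note JM = Jn_module[OF M] and JN = Jn_module[OF N]
  have l: "lin ?M2 (J1 K \<Omega> ?N') (\<lambda>x. J1_map K \<Omega> ?N' ?g' x)"
    by (rule lin_comp[OF Jn_incl[OF M] J1_map_lin[OF JM JN 1]])
  have h: "J1_map K \<Omega> ?N' ?g' x \<in> carrier ?N2" if x: "x \<in> carrier ?M2" for x
  proof -
    have x1: "x \<in> carrier (J1 K \<Omega> ?M')" by (rule lin_closed[OF Jn_incl[OF M] x])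
    have xh: "holonomic ?M (J1_map K \<Omega> (J1 K \<Omega> ?M) (\<lambda>m. m) x)"
      using x by (simp only: Jn_Suc_Suc) simp
    \<comment> \<open>The square
      \<open>J^1 incl \<circ> J^1 g' = J^1 (J^1 g) \<circ> J^1 incl\<close>. As a function
      \<open>?g'\<close> is \<open>J1_map\<close> of \<open>?g\<close>, so the same composite
      factors through either inclusion.\<close>
    have "J1_map K \<Omega> (J1 K \<Omega> ?N) (\<lambda>m. m) (J1_map K \<Omega> ?N' ?g' x) = J1_map K \<Omega> (J1 K \<Omega> ?N) (\<lambda>m. ?g' m) x"
      by (rule J1_map_map[OF JM JN J1_module[OF JN] 1 Jn_incl[OF N] x1])
    also have "\<dots> = J1_map K \<Omega> (J1 K \<Omega> ?N) ?g' (J1_map K \<Omega> (J1 K \<Omega> ?M) (\<lambda>m. m) x)"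
      using J1_map_map[OF JM J1_module[OF JM] J1_module[OF JN] Jn_incl[OF M] J1_map_lin[OF JM JN 0] x1]
      by simp
    finally have e: "J1_map K \<Omega> (J1 K \<Omega> ?N) (\<lambda>m. m) (J1_map K \<Omega> ?N' ?g' x) =
      J1_map K \<Omega> (J1 K \<Omega> ?N) (J1_map K \<Omega> ?N ?g) (J1_map K \<Omega> (J1 K \<Omega> ?M) (\<lambda>m. m) x)" by simp
    have "J1_map K \<Omega> (J1 K \<Omega> ?M) (\<lambda>m. m) x \<in> carrier (J1 K \<Omega> (J1 K \<Omega> ?M))"
      by (rule lin_closed[OF J1_map_lin[OF JM J1_module[OF JM] Jn_incl[OF M]] x1])
    from holonomic_map[OF JM JN 0 this xh] have "holonomic ?N (J1_map K \<Omega> (J1 K \<Omega> ?N) (\<lambda>m. m) (J1_map K \<Omega> ?N' ?g' x))"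
      unfolding e .
    moreover have "J1_map K \<Omega> ?N' ?g' x \<in> carrier (J1 K \<Omega> ?N')" by (rule lin_closed[OF l x])
    ultimately show ?thesis by (simp only: Jn_Suc_Suc) simp
  qed
  have "lin ?M2 ?N2 (J1_map K \<Omega> ?N' ?g')"
    using l h unfolding lin_def additive_map_def by (simp add: Jn_Suc_Suc[of n N] Pi_iff)
  then show ?case using 1 by simp
qed

lemmas prolong_lin = prolong_lin_Suc[THEN conjunct1]

text \<open>Naturality of \<open>j1\<close>, iterated.\<close>

lemma prolong_jn: "e \<in> carrier M \<Longrightarrow> prolong N g n (jn K \<Omega> (n + m) M e) = jn K \<Omega> n N (g (jn K \<Omega> m M e))"
proof (induction n)
  case (Suc n)
  then show ?case
    using J1_map_j1[OF Jn_module[OF M] Jn_module[OF N] prolong_lin jn_closed[OF M]] by simp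
qed simp

end

lemma lin_hom_lin: "f \<in> lin_hom \<Omega> M N \<Longrightarrow> lin M N f"
  by (auto simp: lin_hom_def lin_def additive_map_def)

lemma lin_restrict:
  assumes "left_module (deg0 \<Omega>) M" "lin M N f"
  shows "restrict f (carrier M) \<in> lin_hom \<Omega> M N"
proof -
  interpret M: left_module "deg0 \<Omega>" M by fact
  show ?thesis using assms(2) by (auto simp: lin_hom_def lin_def additive_map_def act_simps[OF assms(1)])
qed

section \<open>The base module and the algebra of all scalar-linear endomorphisms of E\<close>

context
  fixes E :: "('w, 'e) module"
  assumes E: "left_module (deg0 \<Omega>) E"
begin

interpretation E: left_module "deg0 \<Omega>" E by (rule E)

lemma base_module: "left_module (deg0 \<Omega>) (base_module E)"
proof (intro left_module.intro left_module_axioms.intro deg0_ring abelian_groupI)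
  fix x assume "x \<in> carrier (base_module E)"
  then obtain e where e: "e \<in> carrier E" "x = Base e" by (auto simp: base_module_def)
  then show "\<exists>y\<in>carrier (base_module E). y \<oplus>\<^bsub>base_module E\<^esub> x = \<zero>\<^bsub>base_module E\<^esub>"
    by (intro bexI[of _ "Base (\<ominus>\<^bsub>E\<^esub> e)"]) (auto simp: base_module_def E.l_neg)
qed (auto simp: base_module_def E.a_ac act_rules[OF E] act_simps[OF E])

lemma Base_closed: "e \<in> carrier E \<Longrightarrow> Base e \<in> carrier (base_module E)"
  by (simp add: base_module_def)

lemma Base_lin: "lin E (base_module E) Base"
  by (auto simp: lin_def additive_map_def base_module_def)

lemma unbase_lin: "lin (base_module E) E unbase"
  by (auto simp: lin_def additive_map_def base_module_def)

text \<open>Trades the extensional witness for an arbitrary linear one; restriction to the carrier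
  does not change its values on prolongations.\<close>

lemma Diff_iff:
  "\<Delta> \<in> Diff K \<Omega> n E E \<longleftrightarrow> \<Delta> \<in> klin_hom K \<Omega> E E \<and>
    (\<exists>T. lin (Jn K \<Omega> n (base_module E)) E T \<and>
      (\<forall>e\<in>carrier E. T (jn K \<Omega> n (base_module E) (Base e)) = \<Delta> e))"
  (is "_ \<longleftrightarrow> _ \<and> (\<exists>T. ?P T)")
proof -
  let ?J = "Jn K \<Omega> n (base_module E)"
  have "(\<exists>T. ?P T) \<longleftrightarrow> (\<exists>T\<in>lin_hom \<Omega> ?J E. \<forall>e\<in>carrier E. T (jn K \<Omega> n (base_module E) (Base e)) = \<Delta> e)"
  proof
    assume "\<exists>T. ?P T"
    then obtain T where T: "?P T" ..
    then show "\<exists>T\<in>lin_hom \<Omega> ?J E. \<forall>e\<in>carrier E. T (jn K \<Omega> n (base_module E) (Base e)) = \<Delta> e"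
      using lin_restrict[OF Jn_module[OF base_module]] jn_closed[OF base_module Base_closed]
      by (intro bexI[of _ "restrict T (carrier ?J)"]) auto
  qed (use lin_hom_lin in blast)
  then show ?thesis unfolding Diff_def by blast
qed

lemma kact_closed [simp]: "c \<in> carrier K \<Longrightarrow> x \<in> carrier E \<Longrightarrow> kact \<Omega> E c x \<in> carrier E"
  by (simp add: kact_def act_simps[OF E] scalar_grd)

lemma kact_add: "c \<in> carrier K \<Longrightarrow> x \<in> carrier E \<Longrightarrow> y \<in> carrier E \<Longrightarrow>
    kact \<Omega> E c (x \<oplus>\<^bsub>E\<^esub> y) = kact \<Omega> E c x \<oplus>\<^bsub>E\<^esub> kact \<Omega> E c y"
  by (simp add: kact_def act_rules[OF E] scalar_grd)

lemma kact_plus: "c \<in> carrier K \<Longrightarrow> d \<in> carrier K \<Longrightarrow> x \<in> carrier E \<Longrightarrow>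
    kact \<Omega> E (c \<oplus>\<^bsub>K\<^esub> d) x = kact \<Omega> E c x \<oplus>\<^bsub>E\<^esub> kact \<Omega> E d x"
  by (simp add: kact_def smult_l_distr act_rules[OF E] scalar_grd)

lemma kact_mult: "c \<in> carrier K \<Longrightarrow> d \<in> carrier K \<Longrightarrow> x \<in> carrier E \<Longrightarrow>
    kact \<Omega> E (c \<otimes>\<^bsub>K\<^esub> d) x = kact \<Omega> E c (kact \<Omega> E d x)"
  by (simp add: kact_def smult_assoc1 act_rules(3)[OF E, symmetric] scalar_grd scalar_mult(1))

lemma kact_one: "x \<in> carrier E \<Longrightarrow> kact \<Omega> E \<one>\<^bsub>K\<^esub> x = x"
  by (simp add: kact_def act_simps[OF E])

lemma kact_lin: "c \<in> carrier K \<Longrightarrow> lin E E (kact \<Omega> E c)"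
proof -
  assume c: "c \<in> carrier K"
  have "kact \<Omega> E c (a \<odot>\<^bsub>E\<^esub> x) = a \<odot>\<^bsub>E\<^esub> kact \<Omega> E c x" if "a \<in> grd \<Omega> 0" "x \<in> carrier E" for a x
    using that c by (simp add: kact_def act_rules(3)[OF E, symmetric] scalar_grd scalar_mult grd_subset)
  then show ?thesis using c by (simp add: lin_def additive_map_def kact_add Pi_iff)
qed

lemma klin_lin: "lin E E f \<Longrightarrow> c \<in> carrier K \<Longrightarrow> x \<in> carrier E \<Longrightarrow> f (kact \<Omega> E c x) = kact \<Omega> E c (f x)"
  by (simp add: kact_def lin_act scalar_grd)

lemma klin_closed: "f \<in> klin_hom K \<Omega> E E \<Longrightarrow> x \<in> carrier E \<Longrightarrow> f x \<in> carrier E"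
  and klin_add: "f \<in> klin_hom K \<Omega> E E \<Longrightarrow> x \<in> carrier E \<Longrightarrow> y \<in> carrier E \<Longrightarrow>
    f (x \<oplus>\<^bsub>E\<^esub> y) = f x \<oplus>\<^bsub>E\<^esub> f y"
  and klin_kact: "f \<in> klin_hom K \<Omega> E E \<Longrightarrow> c \<in> carrier K \<Longrightarrow> x \<in> carrier E \<Longrightarrow>
    f (kact \<Omega> E c x) = kact \<Omega> E c (f x)"
  and klin_ext: "f \<in> klin_hom K \<Omega> E E \<Longrightarrow> g \<in> klin_hom K \<Omega> E E \<Longrightarrow>
    (\<And>x. x \<in> carrier E \<Longrightarrow> f x = g x) \<Longrightarrow> f = g"
  by (auto simp: klin_hom_def intro: PiE_ext)

lemma klin_homI:
  assumes "\<And>x. x \<in> carrier E \<Longrightarrow> f x \<in> carrier E"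
    "\<And>x y. x \<in> carrier E \<Longrightarrow> y \<in> carrier E \<Longrightarrow> f (x \<oplus>\<^bsub>E\<^esub> y) = f x \<oplus>\<^bsub>E\<^esub> f y"
    "\<And>c x. c \<in> carrier K \<Longrightarrow> x \<in> carrier E \<Longrightarrow> f (kact \<Omega> E c x) = kact \<Omega> E c (f x)"
  shows "restrict f (carrier E) \<in> klin_hom K \<Omega> E E"
  using assms by (auto simp: klin_hom_def)

lemma EndK_simps [simp]:
  "carrier (EndK K \<Omega> E) = klin_hom K \<Omega> E E" "mult (EndK K \<Omega> E) = compose (carrier E)"
  "one (EndK K \<Omega> E) = (\<lambda>e\<in>carrier E. e)" "zero (EndK K \<Omega> E) = (\<lambda>e\<in>carrier E. \<zero>\<^bsub>E\<^esub>)"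
  "add (EndK K \<Omega> E) = (\<lambda>f g. \<lambda>e\<in>carrier E. f e \<oplus>\<^bsub>E\<^esub> g e)"
  "smult (EndK K \<Omega> E) = (\<lambda>c f. \<lambda>e\<in>carrier E. kact \<Omega> E c (f e))"
  by (simp_all add: EndK_def)

lemma kact_zero [simp]: "c \<in> carrier K \<Longrightarrow> kact \<Omega> E c \<zero>\<^bsub>E\<^esub> = \<zero>\<^bsub>E\<^esub>"
  by (simp add: kact_def act_simps[OF E] scalar_grd)

lemma EndK_closed:
  "(\<lambda>e\<in>carrier E. \<zero>\<^bsub>E\<^esub>) \<in> klin_hom K \<Omega> E E"
  "(\<lambda>e\<in>carrier E. e) \<in> klin_hom K \<Omega> E E"
  "f \<in> klin_hom K \<Omega> E E \<Longrightarrow> g \<in> klin_hom K \<Omega> E E \<Longrightarrow> (\<lambda>e\<in>carrier E. f e \<oplus>\<^bsub>E\<^esub> g e) \<in> klin_hom K \<Omega> E E"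
  "f \<in> klin_hom K \<Omega> E E \<Longrightarrow> g \<in> klin_hom K \<Omega> E E \<Longrightarrow> compose (carrier E) f g \<in> klin_hom K \<Omega> E E"
  "c \<in> carrier K \<Longrightarrow> f \<in> klin_hom K \<Omega> E E \<Longrightarrow> (\<lambda>e\<in>carrier E. kact \<Omega> E c (f e)) \<in> klin_hom K \<Omega> E E"
proof -
  have cc: "kact \<Omega> E c (kact \<Omega> E d x) = kact \<Omega> E d (kact \<Omega> E c x)"
    if "c \<in> carrier K" "d \<in> carrier K" "x \<in> carrier E" for c d x
    using that by (rule klin_lin[OF kact_lin])
  show "(\<lambda>e\<in>carrier E. \<zero>\<^bsub>E\<^esub>) \<in> klin_hom K \<Omega> E E" "(\<lambda>e\<in>carrier E. e) \<in> klin_hom K \<Omega> E E"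
    by (intro klin_homI; simp)+
  show "f \<in> klin_hom K \<Omega> E E \<Longrightarrow> g \<in> klin_hom K \<Omega> E E \<Longrightarrow> (\<lambda>e\<in>carrier E. f e \<oplus>\<^bsub>E\<^esub> g e) \<in> klin_hom K \<Omega> E E"
    by (intro klin_homI) (simp_all add: klin_closed klin_add klin_kact kact_add E.a_ac)
  show "f \<in> klin_hom K \<Omega> E E \<Longrightarrow> g \<in> klin_hom K \<Omega> E E \<Longrightarrow> compose (carrier E) f g \<in> klin_hom K \<Omega> E E"
    unfolding compose_def by (intro klin_homI) (simp_all add: klin_closed klin_add klin_kact)
  show "c \<in> carrier K \<Longrightarrow> f \<in> klin_hom K \<Omega> E E \<Longrightarrow> (\<lambda>e\<in>carrier E. kact \<Omega> E c (f e)) \<in> klin_hom K \<Omega> E E"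
    by (intro klin_homI) (simp_all add: klin_closed klin_add klin_kact kact_add cc)
qed

lemma EndK_algebra: "assoc_algebra K (EndK K \<Omega> E)"
proof -
  note r = EndK_closed klin_closed klin_add klin_kact kact_add kact_plus kact_mult kact_one
    act_simps[OF E] scalar_grd compose_def
  let ?R = "EndK K \<Omega> E"
  have ag: "abelian_group ?R"
  proof (rule abelian_groupI)
    fix f assume f: "f \<in> carrier ?R"
    then have f': "f \<in> klin_hom K \<Omega> E E" by simp
    \<comment> \<open>The negative of \<open>f\<close> is taken through the scalar -1, for which
      closure is already established.\<close>
    have n: "(\<lambda>e\<in>carrier E. kact \<Omega> E (\<ominus>\<^bsub>K\<^esub> \<one>\<^bsub>K\<^esub>) (f e)) \<in> klin_hom K \<Omega> E E"
      by (rule EndK_closed(5)) (use f' in auto)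
    have "kact \<Omega> E (\<ominus>\<^bsub>K\<^esub> \<one>\<^bsub>K\<^esub>) (f e) \<oplus>\<^bsub>E\<^esub> f e = \<zero>\<^bsub>E\<^esub>" if e: "e \<in> carrier E" for e
    proof -
      have "kact \<Omega> E (\<ominus>\<^bsub>K\<^esub> \<one>\<^bsub>K\<^esub>) (f e) = \<ominus>\<^bsub>E\<^esub> (f e)"
        using klin_closed[OF f' e] act_minus[OF E one_grd]
        by (simp add: kact_def smult_l_minus act_simps[OF E])
      then show ?thesis using klin_closed[OF f' e] by (simp add: E.l_neg)
    qed
    then show "\<exists>g\<in>carrier ?R. g \<oplus>\<^bsub>?R\<^esub> f = \<zero>\<^bsub>?R\<^esub>"
      using n by (intro bexI[of _ "\<lambda>e\<in>carrier E. kact \<Omega> E (\<ominus>\<^bsub>K\<^esub> \<one>\<^bsub>K\<^esub>) (f e)"]) (auto intro!: restrict_ext)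
    show "\<zero>\<^bsub>?R\<^esub> \<oplus>\<^bsub>?R\<^esub> f = f"
      by (rule klin_ext) (use f' EndK_closed(3)[OF EndK_closed(1) f'] in \<open>simp_all add: klin_closed\<close>)
  next
    fix f g assume fg: "f \<in> carrier ?R" "g \<in> carrier ?R"
    then show "f \<oplus>\<^bsub>?R\<^esub> g \<in> carrier ?R" by (simp add: r)
    show "f \<oplus>\<^bsub>?R\<^esub> g = g \<oplus>\<^bsub>?R\<^esub> f"
      by (rule klin_ext) (use fg in \<open>simp_all add: EndK_closed del: restrict_apply\<close>, simp_all add: r E.a_comm)
    fix h assume h: "h \<in> carrier ?R"
    show "f \<oplus>\<^bsub>?R\<^esub> g \<oplus>\<^bsub>?R\<^esub> h = f \<oplus>\<^bsub>?R\<^esub> (g \<oplus>\<^bsub>?R\<^esub> h)"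
      by (rule klin_ext) (use fg h in \<open>simp_all add: EndK_closed del: restrict_apply\<close>, simp_all add: r E.a_assoc)
  qed (simp add: r)
  have md: "module K ?R"
  proof (rule moduleI[OF is_cring ag], goal_cases)
    case (1 a x) then show ?case by (simp add: r)
  next
    case (2 a b x) then show ?case by (intro klin_ext) (simp_all add: EndK_closed del: restrict_apply, simp_all add: r)
  next
    case (3 a x y) then show ?case by (intro klin_ext) (simp_all add: EndK_closed del: restrict_apply, simp_all add: r)
  next
    case (4 a b x) then show ?case by (intro klin_ext) (simp_all add: EndK_closed del: restrict_apply, simp_all add: r)
  next
    case (5 x) then show ?case by (intro klin_ext) (simp_all add: EndK_closed del: restrict_apply, simp_all add: r)
  qed
  have rg: "ring ?R"
  proof (rule ringI[OF ag])
    show "Group.monoid ?R"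
    proof (rule monoidI, goal_cases)
      case 1 then show ?case by (simp add: EndK_closed)
    next
      case 2 then show ?case by (simp add: r)
    next
      case 3 then show ?case by (intro klin_ext) (simp_all add: EndK_closed del: restrict_apply, simp_all add: r)
    next
      case 4 then show ?case by (intro klin_ext) (simp_all add: EndK_closed del: restrict_apply, simp_all add: r)
    next
      case 5 then show ?case by (intro klin_ext) (simp_all add: EndK_closed del: restrict_apply, simp_all add: r)
    qed
    fix x y z assume a: "x \<in> carrier ?R" "y \<in> carrier ?R" "z \<in> carrier ?R"
    show "(x \<oplus>\<^bsub>?R\<^esub> y) \<otimes>\<^bsub>?R\<^esub> z = x \<otimes>\<^bsub>?R\<^esub> z \<oplus>\<^bsub>?R\<^esub> y \<otimes>\<^bsub>?R\<^esub> z"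
      by (rule klin_ext) (use a in \<open>simp_all add: EndK_closed del: restrict_apply\<close>, simp_all add: r)
    show "z \<otimes>\<^bsub>?R\<^esub> (x \<oplus>\<^bsub>?R\<^esub> y) = z \<otimes>\<^bsub>?R\<^esub> x \<oplus>\<^bsub>?R\<^esub> z \<otimes>\<^bsub>?R\<^esub> y"
      by (rule klin_ext) (use a in \<open>simp_all add: EndK_closed del: restrict_apply\<close>, simp_all add: r)
  qed
  show ?thesis
    by (intro assoc_algebra.intro assoc_algebra_axioms.intro md rg; rule klin_ext) (simp_all add: EndK_closed del: restrict_apply, simp_all add: r)
qed

end

end

context jet_algebra
begin

section \<open>Composition and filtration of differential operators\<close>

context
  fixes E :: "('w, 'e) module"
  assumes E: "left_module (deg0 \<Omega>) E"
begin

interpretation E: left_module "deg0 \<Omega>" E by (rule E)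
interpretation D: assoc_algebra K "EndK K \<Omega> E" by (rule EndK_algebra[OF E])

lemma Diff_klin: "f \<in> Diff K \<Omega> n E E \<Longrightarrow> f \<in> klin_hom K \<Omega> E E"
  by (simp add: Diff_def)

lemma lin_zero: "left_module (deg0 \<Omega>) M \<Longrightarrow> lin M E (\<lambda>x. \<zero>\<^bsub>E\<^esub>)"
  by (simp add: lin_def additive_map_def act_simps[OF E])

lemma lin_plus:
  assumes "lin M E f" "lin M E g"
  shows "lin M E (\<lambda>x. f x \<oplus>\<^bsub>E\<^esub> g x)"
  unfolding lin_def
  using additive_map_plus[OF E.abelian_group_axioms lin_additive[OF assms(1)] lin_additive[OF assms(2)]]
  by (simp add: lin_act[OF assms(1)] lin_act[OF assms(2)] lin_closed[OF assms(1)] lin_closed[OF assms(2)]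
      act_rules[OF E])

lemma Diff_add_closed:
  assumes "f \<in> Diff K \<Omega> n E E" "g \<in> Diff K \<Omega> n E E"
  shows "f \<oplus>\<^bsub>EndK K \<Omega> E\<^esub> g \<in> Diff K \<Omega> n E E"
proof -
  let ?B = "base_module E"
  obtain S T where S: "lin (Jn K \<Omega> n ?B) E S" "\<forall>e\<in>carrier E. S (jn K \<Omega> n ?B (Base e)) = f e"
    and T: "lin (Jn K \<Omega> n ?B) E T" "\<forall>e\<in>carrier E. T (jn K \<Omega> n ?B (Base e)) = g e"
    and k: "f \<in> klin_hom K \<Omega> E E" "g \<in> klin_hom K \<Omega> E E"
    using assms by (auto simp: Diff_iff[OF E])
  show ?thesis unfolding Diff_iff[OF E]
    using S(2) T(2) k lin_plus[OF S(1) T(1)] EndK_closed[OF E]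
    by (auto simp: EndK_simps[OF E] intro!: exI[of _ "\<lambda>x. S x \<oplus>\<^bsub>E\<^esub> T x"])
qed

lemma lin_hom_klin: "f \<in> lin_hom \<Omega> E E \<Longrightarrow> f \<in> klin_hom K \<Omega> E E"
  using klin_lin[OF E lin_hom_lin] by (auto simp: lin_hom_def klin_hom_def)

lemma Diff_postcomp:
  assumes f: "f \<in> lin_hom \<Omega> E E" and g: "g \<in> Diff K \<Omega> n E E"
  shows "f \<otimes>\<^bsub>EndK K \<Omega> E\<^esub> g \<in> Diff K \<Omega> n E E"
proof -
  let ?B = "base_module E"
  obtain T where T: "lin (Jn K \<Omega> n ?B) E T" "\<forall>e\<in>carrier E. T (jn K \<Omega> n ?B (Base e)) = g e"
    and k: "g \<in> klin_hom K \<Omega> E E"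
    using g by (auto simp: Diff_iff[OF E])
  show ?thesis unfolding Diff_iff[OF E]
    using T(2) k EndK_closed[OF E] lin_hom_klin[OF f]
    by (auto simp: EndK_simps[OF E] compose_eq intro!: exI[of _ "\<lambda>x. f (T x)"] lin_comp[OF T(1) lin_hom_lin[OF f]])
qed

text \<open>If \<open>T\<close> represents \<open>g\<close> on \<open>J^m E\<close>, its
  prolongation goes from \<open>J^(n+m) E\<close> to \<open>J^n E\<close> and sends the jet of
  \<open>e\<close> to the jet of \<open>g e\<close>, to which the representative \<open>S\<close> of
  \<open>f\<close> applies.\<close>

lemma Diff_comp:
  assumes f: "f \<in> Diff K \<Omega> n E E" and g: "g \<in> Diff K \<Omega> m E E"
  shows "f \<otimes>\<^bsub>EndK K \<Omega> E\<^esub> g \<in> Diff K \<Omega> (n + m) E E"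
proof -
  let ?B = "base_module E"
  note B = base_module[OF E]
  obtain S T where S: "lin (Jn K \<Omega> n ?B) E S" "\<forall>e\<in>carrier E. S (jn K \<Omega> n ?B (Base e)) = f e"
    and T: "lin (Jn K \<Omega> m ?B) E T" "\<forall>e\<in>carrier E. T (jn K \<Omega> m ?B (Base e)) = g e"
    and k: "f \<in> klin_hom K \<Omega> E E" "g \<in> klin_hom K \<Omega> E E"
    using f g by (auto simp: Diff_iff[OF E])
  \<comment> \<open>\<open>prolong\<close> works between modules of jets, so the values of
    \<open>T\<close> are wrapped by \<open>Base\<close> into the copy of \<open>E\<close> at level
    zero.\<close>
  define G :: "('w, 'e) jet \<Rightarrow> ('w, 'e) jet" where "G = (\<lambda>x. Base (T x))"
  have G: "lin (Jn K \<Omega> m ?B) ?B G" unfolding G_def by (rule lin_comp[OF T(1) Base_lin[OF E]])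
  have "S (prolong ?B G n (jn K \<Omega> (n + m) ?B (Base e))) = f (g e)" if e: "e \<in> carrier E" for e
  proof -
    have "G (jn K \<Omega> m ?B (Base e)) = Base (g e)" using T(2) e by (simp add: G_def)
    then show ?thesis
      using S(2) klin_closed[OF E k(2) e] by (simp add: prolong_jn[OF B B G Base_closed[OF E e]])
  qed
  then show ?thesis unfolding Diff_iff[OF E]
    using k EndK_closed[OF E]
    by (auto simp: EndK_simps[OF E] compose_eq intro!: exI[of _ "\<lambda>x. S (prolong ?B G n x)"] lin_comp[OF prolong_lin[OF B B G] S(1)])
qed

text \<open>The value map \<open>jp\<close> restricts to the projection
  \<open>J^(n+1) \<rightarrow> J^n\<close> and takes each prolongation to the one of next lower
  order.\<close>

lemma Diff_mono_Suc: "Diff K \<Omega> n E E \<subseteq> Diff K \<Omega> (Suc n) E E"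
proof
  fix f assume "f \<in> Diff K \<Omega> n E E"
  let ?B = "base_module E"
  note B = base_module[OF E]
  obtain T where T: "lin (Jn K \<Omega> n ?B) E T" "\<forall>e\<in>carrier E. T (jn K \<Omega> n ?B (Base e)) = f e"
    and k: "f \<in> klin_hom K \<Omega> E E"
    using \<open>f \<in> _\<close> by (auto simp: Diff_iff[OF E])
  let ?T = "\<lambda>x. T (jp (Jn K \<Omega> n ?B) x)"
  have "lin (Jn K \<Omega> (Suc n) ?B) E ?T"
    by (rule lin_comp[OF lin_comp[OF Jn_incl[OF B] jp_lin[OF Jn_module[OF B]]] T(1)])
  moreover have "?T (jn K \<Omega> (Suc n) ?B (Base e)) = f e" if e: "e \<in> carrier E" for e
    using T(2) e by (simp add: j1_simps(2)[OF Jn_module[OF B] jn_closed[OF B Base_closed[OF E e]]])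
  ultimately show "f \<in> Diff K \<Omega> (Suc n) E E" unfolding Diff_iff[OF E] using k by blast
qed

lemma kact_lin_hom: "c \<in> carrier K \<Longrightarrow> (\<lambda>e\<in>carrier E. kact \<Omega> E c e) \<in> lin_hom \<Omega> E E"
  by (rule lin_restrict[OF E kact_lin[OF E]])

text \<open>Scalars act \<open>A\<close>-linearly, so scalar multiplication is a case of
  postcomposition. Statements about postcomposition, in particular for quantizations, thereby yield
  linearity over the scalars.\<close>

lemma smult_postcomp:
  assumes "c \<in> carrier K" "f \<in> klin_hom K \<Omega> E E"
  shows "c \<odot>\<^bsub>EndK K \<Omega> E\<^esub> f = (\<lambda>e\<in>carrier E. kact \<Omega> E c e) \<otimes>\<^bsub>EndK K \<Omega> E\<^esub> f"
  unfolding EndK_simps[OF E] compose_def by (rule restrict_ext) (simp add: klin_closed[OF E assms(2)])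

lemma Diff_submodule: "submodule (Diff K \<Omega> n E E) K (EndK K \<Omega> E)"
proof -
  have sm: "c \<odot>\<^bsub>EndK K \<Omega> E\<^esub> f \<in> Diff K \<Omega> n E E" if "c \<in> carrier K" "f \<in> Diff K \<Omega> n E E" for c f
    using that Diff_postcomp[OF kact_lin_hom] Diff_klin by (simp add: smult_postcomp)
  show ?thesis
  proof (rule D.submoduleI)
    show sub: "Diff K \<Omega> n E E \<subseteq> carrier (EndK K \<Omega> E)" using Diff_klin by (auto simp: EndK_simps[OF E])
    have "(\<lambda>e\<in>carrier E. \<zero>\<^bsub>E\<^esub>) \<in> Diff K \<Omega> n E E"
      unfolding Diff_iff[OF E] using EndK_closed(1)[OF E] lin_zero[OF Jn_module[OF base_module[OF E]]] by auto
    then show "\<zero>\<^bsub>EndK K \<Omega> E\<^esub> \<in> Diff K \<Omega> n E E" by (simp add: EndK_simps[OF E])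
    fix f assume f: "f \<in> Diff K \<Omega> n E E"
    have "(\<ominus>\<^bsub>K\<^esub> \<one>\<^bsub>K\<^esub>) \<odot>\<^bsub>EndK K \<Omega> E\<^esub> f = \<ominus>\<^bsub>EndK K \<Omega> E\<^esub> f"
      using f sub D.smult_l_minus[of "\<one>\<^bsub>K\<^esub>" f] D.smult_one[of f] by auto
    then show "\<ominus>\<^bsub>EndK K \<Omega> E\<^esub> f \<in> Diff K \<Omega> n E E" using sm[OF _ f, of "\<ominus>\<^bsub>K\<^esub> \<one>\<^bsub>K\<^esub>"] by simp
    show "c \<in> carrier K \<Longrightarrow> c \<odot>\<^bsub>EndK K \<Omega> E\<^esub> f \<in> Diff K \<Omega> n E E" for c using sm f by blast
    show "g \<in> Diff K \<Omega> n E E \<Longrightarrow> f \<oplus>\<^bsub>EndK K \<Omega> E\<^esub> g \<in> Diff K \<Omega> n E E" for g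
      using Diff_add_closed f by blast
  qed
qed

lemma lin_hom_Diff_0: "f \<in> lin_hom \<Omega> E E \<Longrightarrow> f \<in> Diff K \<Omega> 0 E E"
  unfolding Diff_iff[OF E] using lin_hom_klin lin_comp[OF unbase_lin[OF E] lin_hom_lin, of f]
  by (auto intro!: exI[of _ "\<lambda>x. f (unbase x)"])

lemma one_Diff_0: "\<one>\<^bsub>EndK K \<Omega> E\<^esub> \<in> Diff K \<Omega> 0 E E"
  using lin_hom_Diff_0[OF lin_restrict[OF E, of E "\<lambda>x. x"]]
  by (simp add: EndK_simps[OF E] lin_def additive_map_def)

end

end

section \<open>Symbols\<close>

locale star_setting = jet_algebra K \<Omega> for K :: "'k ring" and \<Omega> :: "('k, 'w) dga" (structure) +
  fixes E :: "('w, 'e) module" and q :: "nat \<Rightarrow> ('e \<Rightarrow> 'e) set \<Rightarrow> 'e \<Rightarrow> 'e"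
  assumes E_module: "left_module (deg0 \<Omega>) E"
    and quant: "full_quantization K \<Omega> E q"
begin

abbreviation "R \<equiv> EndK K \<Omega> E"
abbreviation "F n \<equiv> Diff K \<Omega> n E E"
abbreviation "B n \<equiv> Diff_below K \<Omega> n E E"
abbreviation "s \<equiv> symbol K \<Omega> E"
abbreviation "Y \<equiv> Symb K \<Omega> E"

sublocale D: ring "EndK K \<Omega> E" by (rule assoc_algebra.axioms(2)[OF EndK_algebra[OF E_module]])
sublocale DM: assoc_algebra K "EndK K \<Omega> E" by (rule EndK_algebra[OF E_module])

lemma F_closed: "f \<in> F n \<Longrightarrow> f \<in> carrier R"
  and F_zero: "\<zero>\<^bsub>R\<^esub> \<in> F n"
  and F_add: "f \<in> F n \<Longrightarrow> g \<in> F n \<Longrightarrow> f \<oplus>\<^bsub>R\<^esub> g \<in> F n"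
  and F_smult: "c \<in> carrier K \<Longrightarrow> f \<in> F n \<Longrightarrow> c \<odot>\<^bsub>R\<^esub> f \<in> F n"
proof -
  note F = DM.submoduleE[OF Diff_submodule[OF E_module]]
  show "f \<in> F n \<Longrightarrow> f \<in> carrier R" using F(1) by blast
  show "\<zero>\<^bsub>R\<^esub> \<in> F n"
    using subgroup.one_closed[OF submodule.axioms(1)[OF Diff_submodule[OF E_module]]] by simp
  show "f \<in> F n \<Longrightarrow> g \<in> F n \<Longrightarrow> f \<oplus>\<^bsub>R\<^esub> g \<in> F n" by (rule F(5))
  show "c \<in> carrier K \<Longrightarrow> f \<in> F n \<Longrightarrow> c \<odot>\<^bsub>R\<^esub> f \<in> F n" by (rule F(4))
qed

lemma F_mono: "n \<le> m \<Longrightarrow> F n \<subseteq> F m"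
  by (rule lift_Suc_mono_le[of F, OF Diff_mono_Suc[OF E_module]])

lemma F_mult: "f \<in> F n \<Longrightarrow> g \<in> F m \<Longrightarrow> f \<otimes>\<^bsub>R\<^esub> g \<in> F (n + m)"
  by (rule Diff_comp[OF E_module])

lemma B_0: "B 0 = {\<zero>\<^bsub>R\<^esub>}" and B_Suc: "B (Suc n) = F n"
  by (simp_all add: Diff_below_def EndK_simps[OF E_module])

lemma B_F: "B n \<subseteq> F n"
  using F_mono[of "n - 1" n] by (cases n) (auto simp: B_0 B_Suc F_zero)

lemma B_group: "abelian_subgroup (B n) R"
proof (rule abelian_subgroupI3[OF additive_subgroup.intro D.abelian_group_axioms])
  show "subgroup (B n) (add_monoid R)"
  proof (cases n)
    case 0
    then show ?thesis by (simp add: B_0 group.triv_subgroup[OF D.a_group, simplified])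
  next
    case (Suc m)
    then show ?thesis using submodule.axioms(1)[OF Diff_submodule[OF E_module]] by (simp add: B_Suc)
  qed
qed

lemma B_smult: "c \<in> carrier K \<Longrightarrow> f \<in> B n \<Longrightarrow> c \<odot>\<^bsub>R\<^esub> f \<in> B n"
  by (cases n) (auto simp: B_0 B_Suc F_smult)

text \<open>With its counterpart \<open>B_mult_left\<close>, the reason why the product of symbols
  is independent of representatives. In order zero \<open>Diff_below\<close> is the zero group and
  needs its own case.\<close>

lemma B_mult_right: "f \<in> B n \<Longrightarrow> g \<in> F m \<Longrightarrow> f \<otimes>\<^bsub>R\<^esub> g \<in> B (n + m)"
proof (cases n)
  case 0
  then show "f \<in> B n \<Longrightarrow> g \<in> F m \<Longrightarrow> f \<otimes>\<^bsub>R\<^esub> g \<in> B (n + m)"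
    using additive_subgroup.zero_closed[OF abelian_subgroup.axioms(1)[OF B_group]] by (simp add: B_0 F_closed)
qed (use F_mult B_Suc in auto)

lemma B_mult_left: "f \<in> F n \<Longrightarrow> g \<in> B m \<Longrightarrow> f \<otimes>\<^bsub>R\<^esub> g \<in> B (n + m)"
proof (cases m)
  case 0
  then show "f \<in> F n \<Longrightarrow> g \<in> B m \<Longrightarrow> f \<otimes>\<^bsub>R\<^esub> g \<in> B (n + m)"
    using additive_subgroup.zero_closed[OF abelian_subgroup.axioms(1)[OF B_group]] by (simp add: B_0 F_closed)
qed (use F_mult B_Suc in auto)

lemma B_sub: "f \<in> B n \<Longrightarrow> f \<in> carrier R"
  using B_F F_closed by blast

lemma B_ops: "\<zero>\<^bsub>R\<^esub> \<in> B n" "f \<in> B n \<Longrightarrow> g \<in> B n \<Longrightarrow> f \<oplus>\<^bsub>R\<^esub> g \<in> B n"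
  using additive_subgroup.zero_closed[OF abelian_subgroup.axioms(1)[OF B_group]]
    additive_subgroup.a_closed[OF abelian_subgroup.axioms(1)[OF B_group]] by auto

lemma s_eq_iff: "f \<in> carrier R \<Longrightarrow> g \<in> carrier R \<Longrightarrow> s n f = s n g \<longleftrightarrow> f \<ominus>\<^bsub>R\<^esub> g \<in> B n"
  unfolding symbol_def
  using abelian_subgroup.a_rcos_module_minus[OF B_group D.ring_axioms, of g f n]
    abelian_subgroup.a_repr_independence'[OF B_group, of f n g] abelian_subgroup.a_rcos_self[OF B_group, of f n]
  by auto

lemma s_zero: "s n \<zero>\<^bsub>R\<^esub> = B n"
  unfolding symbol_def by (rule abelian_subgroup.a_rcos_const[OF B_group B_ops(1)])

lemma s_add: "f \<in> carrier R \<Longrightarrow> g \<in> carrier R \<Longrightarrow> s n f <+>\<^bsub>R\<^esub> s n g = s n (f \<oplus>\<^bsub>R\<^esub> g)"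
  unfolding symbol_def by (rule abelian_subgroup.a_rcos_sum[OF B_group])

lemma s_member:
  assumes "f \<in> carrier R" "g \<in> s n f"
  obtains b where "b \<in> B n" "g = b \<oplus>\<^bsub>R\<^esub> f" "g \<in> carrier R"
  using assms D.add.m_closed[OF B_sub assms(1)] by (auto simp: symbol_def a_r_coset_def')

lemma s_self: "f \<in> carrier R \<Longrightarrow> f \<in> s n f"
  unfolding symbol_def by (rule abelian_subgroup.a_rcos_self[OF B_group])

lemma s_absorb: "b \<in> B n \<Longrightarrow> f \<in> carrier R \<Longrightarrow> s n (b \<oplus>\<^bsub>R\<^esub> f) = s n f"
  using s_add[of b f n] s_add[of "\<zero>\<^bsub>R\<^esub>" f n] B_sub[of b n]
    abelian_subgroup.a_rcos_const[OF B_group, of b n] s_zero[of n] by (simp add: symbol_def)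

text \<open>The operations on cosets are unions over all representatives. Such a union is a single
  coset once all representatives give the same one and the index coset is nonempty.\<close>

lemma smult_symbol: "c \<in> carrier K \<Longrightarrow> f \<in> carrier R \<Longrightarrow> symbol_smult K \<Omega> E n c (s n f) = s n (c \<odot>\<^bsub>R\<^esub> f)"
proof -
  assume c: "c \<in> carrier K" and f: "f \<in> carrier R"
  have "s n (c \<odot>\<^bsub>R\<^esub> g) = s n (c \<odot>\<^bsub>R\<^esub> f)" if "g \<in> s n f" for g
    using that
    by (rule s_member[OF f]) (use c f B_smult B_sub in \<open>auto simp: DM.smult_r_distr s_absorb\<close>)
  then show ?thesis unfolding symbol_smult_def using s_self[OF f] by blast
qed

lemma postcomp_symbol:
  assumes f: "f \<in> lin_hom \<Omega> E E" and g: "g \<in> carrier R"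
  shows "symbol_postcomp K \<Omega> E n f (s n g) = s n (f \<otimes>\<^bsub>R\<^esub> g)"
proof -
  have f0: "f \<in> F 0" by (rule lin_hom_Diff_0[OF E_module f])
  have "s n (f \<otimes>\<^bsub>R\<^esub> h) = s n (f \<otimes>\<^bsub>R\<^esub> g)" if "h \<in> s n g" for h
    using that
    by (rule s_member[OF g]) (use F_closed[OF f0] g B_mult_left[OF f0] B_sub in \<open>auto simp: D.r_distr s_absorb\<close>)
  then show ?thesis unfolding symbol_postcomp_def using s_self[OF g] by blast
qed

text \<open>One factor is changed at a time, and each change alters the product by an element of
  \<open>B (n + m)\<close>.\<close>

lemma mult_symbol:
  assumes f: "f \<in> F n" and g: "g \<in> F m"
  shows "symbol_mult K \<Omega> E n m (s n f) (s m g) = s (n + m) (f \<otimes>\<^bsub>R\<^esub> g)"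
proof -
  note fc = F_closed[OF f] and gc = F_closed[OF g]
  have "s (n + m) (f' \<otimes>\<^bsub>R\<^esub> g') = s (n + m) (f \<otimes>\<^bsub>R\<^esub> g)" if f': "f' \<in> s n f" and g': "g' \<in> s m g" for f' g'
  proof -
    obtain b where b: "b \<in> B n" "f' = b \<oplus>\<^bsub>R\<^esub> f" by (rule s_member[OF fc f'])
    obtain c where c: "c \<in> B m" "g' = c \<oplus>\<^bsub>R\<^esub> g" by (rule s_member[OF gc g'])
    have cc: "b \<in> carrier R" "c \<in> carrier R" "b \<in> F n" "c \<in> F m" using b(1) c(1) B_F B_sub by blast+
    have g'F: "g' \<in> F m" unfolding c(2) by (rule F_add[OF cc(4) g])
    have "f \<otimes>\<^bsub>R\<^esub> g' = f \<otimes>\<^bsub>R\<^esub> c \<oplus>\<^bsub>R\<^esub> f \<otimes>\<^bsub>R\<^esub> g"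
      unfolding c(2) by (rule D.r_distr[OF cc(2) gc fc])
    then have "s (n + m) (f \<otimes>\<^bsub>R\<^esub> g') = s (n + m) (f \<otimes>\<^bsub>R\<^esub> g)"
      using s_absorb[OF B_mult_left[OF f c(1)] D.m_closed[OF fc gc]] by (simp only:)
    moreover have "f' \<otimes>\<^bsub>R\<^esub> g' = b \<otimes>\<^bsub>R\<^esub> g' \<oplus>\<^bsub>R\<^esub> f \<otimes>\<^bsub>R\<^esub> g'"
      unfolding b(2) by (rule D.l_distr[OF cc(1) fc F_closed[OF g'F]])
    then have "s (n + m) (f' \<otimes>\<^bsub>R\<^esub> g') = s (n + m) (f \<otimes>\<^bsub>R\<^esub> g')"
      using s_absorb[OF B_mult_right[OF b(1) g'F] D.m_closed[OF fc F_closed[OF g'F]]] by (simp only:)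
    ultimately show ?thesis by (simp only:)
  qed
  then have "symbol_mult K \<Omega> E n m (s n f) (s m g) = (\<Union>f'\<in>s n f. \<Union>g'\<in>s m g. s (n + m) (f \<otimes>\<^bsub>R\<^esub> g))"
    unfolding symbol_mult_def by (auto intro!: SUP_cong)
  moreover have "s n f \<noteq> {}" "s m g \<noteq> {}" using s_self[OF fc] s_self[OF gc] by blast+
  ultimately show ?thesis by simp
qed

lemma Y_cases: "U \<in> Y n \<Longrightarrow> (\<And>f. f \<in> F n \<Longrightarrow> U = s n f \<Longrightarrow> P) \<Longrightarrow> P"
  by (auto simp: Symb_def)

lemma s_Y: "f \<in> F n \<Longrightarrow> s n f \<in> Y n"
  by (simp add: Symb_def)

lemma B_Y: "B n \<in> Y n"
  using s_Y[OF F_zero, of n] by (simp add: s_zero)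

lemma q_F: "U \<in> Y n \<Longrightarrow> q n U \<in> F n"
  and q_add: "U \<in> Y n \<Longrightarrow> V \<in> Y n \<Longrightarrow> q n (U <+>\<^bsub>R\<^esub> V) = q n U \<oplus>\<^bsub>R\<^esub> q n V"
  and q_postcomp: "f \<in> lin_hom \<Omega> E E \<Longrightarrow> U \<in> Y n \<Longrightarrow> q n (symbol_postcomp K \<Omega> E n f U) = f \<otimes>\<^bsub>R\<^esub> q n U"
  and s_q: "U \<in> Y n \<Longrightarrow> s n (q n U) = U"
  using quant unfolding full_quantization_def quantization_def by blast+

lemma q_closed: "U \<in> Y n \<Longrightarrow> q n U \<in> carrier R"
  using q_F F_closed by blast

lemma q_inj: "U \<in> Y n \<Longrightarrow> V \<in> Y n \<Longrightarrow> q n U = q n V \<Longrightarrow> U = V"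
  using s_q by metis

lemma Y_add: "U \<in> Y n \<Longrightarrow> V \<in> Y n \<Longrightarrow> U <+>\<^bsub>R\<^esub> V \<in> Y n"
  by (elim Y_cases) (auto simp: s_add F_closed intro!: s_Y F_add)

lemma smult_postcomp_symbol:
  assumes "c \<in> carrier K" "U \<in> Y n"
  shows "symbol_smult K \<Omega> E n c U = symbol_postcomp K \<Omega> E n (\<lambda>e\<in>carrier E. kact \<Omega> E c e) U"
  using assms(2)
  by (rule Y_cases) (use assms F_closed in \<open>simp add: smult_symbol postcomp_symbol kact_lin_hom[OF E_module]
    smult_postcomp[OF E_module] Diff_klin[OF E_module]\<close>)

lemma Y_smult: "c \<in> carrier K \<Longrightarrow> U \<in> Y n \<Longrightarrow> symbol_smult K \<Omega> E n c U \<in> Y n"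
  by (elim Y_cases) (auto simp: smult_symbol F_closed intro!: s_Y F_smult)

text \<open>A quantization is required to be additive and linear for postcomposition; applied to the
  scalar endomorphisms this gives linearity over the base ring.\<close>

lemma q_smult: "c \<in> carrier K \<Longrightarrow> U \<in> Y n \<Longrightarrow> q n (symbol_smult K \<Omega> E n c U) = c \<odot>\<^bsub>R\<^esub> q n U"
  by (simp add: smult_postcomp_symbol q_postcomp kact_lin_hom[OF E_module]
    smult_postcomp[OF E_module] Diff_klin[OF E_module q_F])

lemma q_zero: "q n (B n) = \<zero>\<^bsub>R\<^esub>"
proof -
  have "B n <+>\<^bsub>R\<^esub> B n = B n" using s_add[of "\<zero>\<^bsub>R\<^esub>" "\<zero>\<^bsub>R\<^esub>" n] by (simp add: s_zero)
  then have "q n (B n) \<oplus>\<^bsub>R\<^esub> q n (B n) = q n (B n)" using q_add[OF B_Y B_Y, of n] by simp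
  then show ?thesis using q_closed[OF B_Y, of n] by simp
qed

lemma q_zero_iff: "U \<in> Y n \<Longrightarrow> q n U = \<zero>\<^bsub>R\<^esub> \<longleftrightarrow> U = B n"
  using q_inj[OF _ B_Y] q_zero by metis

section \<open>Truncations\<close>

abbreviation "tr \<equiv> truncate K \<Omega> E q"

lemma tr_top: "n \<le> k \<Longrightarrow> tr n f k = f"
  by (simp add: truncate.simps)

lemma tr_step: "k < n \<Longrightarrow> tr n f k = tr n f (Suc k) \<ominus>\<^bsub>R\<^esub> q (Suc k) (s (Suc k) (tr n f (Suc k)))"
  by (subst truncate.simps) simp

text \<open>\<open>q (Suc k)\<close> of a symbol has that symbol, so the subtraction cancels the
  leading part. The induction descends from n, like the recursion.\<close>

lemma tr_F:
  assumes "f \<in> F n" "k \<le> n"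
  shows "tr n f k \<in> F k"
  using assms(2)
proof (induction k rule: inc_induct)
  case base
  then show ?case using assms by (simp add: tr_top)
next
  case (step k)
  let ?g = "tr n f (Suc k)"
  have g: "?g \<in> F (Suc k)" using step by simp
  note c = F_closed[OF g] q_closed[OF s_Y[OF g]]
  have "?g \<ominus>\<^bsub>R\<^esub> q (Suc k) (s (Suc k) ?g) \<in> B (Suc k)"
    using s_eq_iff[OF c, of "Suc k"] s_q[OF s_Y[OF g]] by simp
  then show ?case using step by (simp add: tr_step B_Suc)
qed

text \<open>In order zero the symbol map divides by the zero group, so the last truncation is
  recovered exactly; this starts the induction in \<open>tr_sum\<close>.\<close>

lemma q_s_0: "f \<in> F 0 \<Longrightarrow> q 0 (s 0 f) = f"
  using s_eq_iff[of f "q 0 (s 0 f)" 0] s_q[OF s_Y, of f 0] q_closed[OF s_Y, of f 0] F_closed[of f 0]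
  by (auto simp: B_0 D.minus_eq dest: D.minus_equality)

text \<open>Telescoping: each recursion step says that \<open>tr n f (Suc k)\<close> is
  \<open>tr n f k\<close> plus the quantization of its own symbol. For k = n this recovers the
  operator from its symbols.\<close>

lemma tr_sum:
  assumes f: "f \<in> F n" and k: "k \<le> n"
  shows "(\<Oplus>\<^bsub>R\<^esub>j\<in>{..k}. q j (s j (tr n f j))) = tr n f k"
  using k
proof (induction k)
  case 0
  then show ?case using tr_F[OF f, of 0] by (simp add: q_s_0 F_closed)
next
  case (Suc k)
  have c: "q j (s j (tr n f j)) \<in> carrier R" if "j \<le> Suc k" for j
    using tr_F[OF f, of j] that Suc.prems by (intro q_closed s_Y) simp
  have t: "tr n f (Suc k) \<in> carrier R" using tr_F[OF f Suc.prems] F_closed by blast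
  have "(\<Oplus>\<^bsub>R\<^esub>j\<in>{..Suc k}. q j (s j (tr n f j))) =
      q (Suc k) (s (Suc k) (tr n f (Suc k))) \<oplus>\<^bsub>R\<^esub> (\<Oplus>\<^bsub>R\<^esub>j\<in>{..k}. q j (s j (tr n f j)))"
    by (rule D.finsum_Suc) (use c in auto)
  also have "\<dots> = q (Suc k) (s (Suc k) (tr n f (Suc k))) \<oplus>\<^bsub>R\<^esub> tr n f k" using Suc by simp
  also have "\<dots> = tr n f (Suc k)"
    using Suc.prems t c[of "Suc k"] by (simp add: tr_step D.minus_eq D.a_ac D.r_neg1 D.r_neg2 D.r_neg)
  finally show ?case .
qed

end

section \<open>Direct sums and polynomials\<close>

lemma additive_map_finsum:
  assumes G: "abelian_group G" and H: "abelian_group H" and h: "additive_map G H h"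
    and f: "f \<in> A \<rightarrow> carrier G"
  shows "h (finsum G f A) = finsum H (\<lambda>i. h (f i)) A"
proof -
  interpret G: abelian_group G by fact
  interpret H: abelian_group H by fact
  show ?thesis using f
  proof (induction A rule: infinite_finite_induct)
    case (insert x A)
    then have "f x \<in> carrier G" "f \<in> A \<rightarrow> carrier G" by auto
    then show ?case using insert additive_map_closed[OF h]
      by (simp add: additive_map_add[OF h] Pi_iff)
  qed (simp_all add: additive_map_zero[OF G H h])
qed

text \<open>The modules of symbols and of polynomials occur in several records that differ in
  \<open>mult\<close> and \<open>one\<close>; finite sums depend on the additive part alone.\<close>

lemma finsum_add_monoid:
  fixes G H :: "('a, 'b) ring_scheme"
  shows "carrier G = carrier H \<Longrightarrow> add G = add H \<Longrightarrow> zero G = zero H \<Longrightarrow> finsum G f A = finsum H f A"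
  by (simp add: finsum_def)

lemma module_cong:
  assumes "module K M" "carrier N = carrier M" "add N = add M" "zero N = zero M" "smult N = smult M"
  shows "module K N"
proof -
  interpret M: module K M by fact
  have ag: "abelian_group N"
  proof (rule abelian_groupI)
    fix x assume "x \<in> carrier N"
    then show "\<exists>y\<in>carrier N. y \<oplus>\<^bsub>N\<^esub> x = \<zero>\<^bsub>N\<^esub>"
      using M.l_neg[of x] by (auto simp: assms(2-5) intro!: bexI[of _ "\<ominus>\<^bsub>M\<^esub> x"])
  qed (simp_all add: assms(2-5) M.a_ac)
  show ?thesis
    by (rule moduleI[OF M.is_cring ag])
      (simp_all add: assms(2-5) M.smult_l_distr M.smult_r_distr M.smult_assoc1)
qed

lemma (in abelian_monoid) finsum_delta:
  assumes "finite A" "f \<in> A \<rightarrow> carrier G"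
  shows "(\<Oplus>i\<in>A. if i = m then f i else \<zero>) = (if m \<in> A then f m else \<zero>)"
proof (cases "m \<in> A")
  case True
  have "(\<Oplus>i\<in>A. if i = m then f i else \<zero>) = (\<Oplus>i\<in>A. if m = i then f i else \<zero>)"
    by (rule finsum_cong') (use assms in auto)
  also have "\<dots> = f m" by (rule finsum_singleton[OF True assms])
  finally show ?thesis using True by simp
next
  case False
  then have "(\<Oplus>i\<in>A. if i = m then f i else \<zero>) = (\<Oplus>i\<in>A. \<zero>)"
    by (intro finsum_cong') auto
  then show ?thesis using False by simp
qed

text \<open>\<open>up\<close> is phrased by an upper bound for exponents, families of symbols by a
  finite support; on the natural numbers the two agree.\<close>

lemma up_iff: "x \<in> up M \<longleftrightarrow> (\<forall>i. x i \<in> carrier M) \<and> finite {i. x i \<noteq> \<zero>\<^bsub>M\<^esub>}"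
proof
  assume x: "x \<in> up M"
  then obtain n where "bound \<zero>\<^bsub>M\<^esub> n x" by (auto simp: up_def)
  then have "{i. x i \<noteq> \<zero>\<^bsub>M\<^esub>} \<subseteq> {..n}" by (auto dest: bound_below)
  then show "(\<forall>i. x i \<in> carrier M) \<and> finite {i. x i \<noteq> \<zero>\<^bsub>M\<^esub>}"
    using finite_subset[of _ "{..n}"] x by (simp add: mem_upD)
next
  assume x: "(\<forall>i. x i \<in> carrier M) \<and> finite {i. x i \<noteq> \<zero>\<^bsub>M\<^esub>}"
  then have "bound \<zero>\<^bsub>M\<^esub> (Max (insert 0 {i. x i \<noteq> \<zero>\<^bsub>M\<^esub>})) x"
    by (intro bound.intro) (metis Max_ge finite_insert insertCI linorder_not_le mem_Collect_eq)
  then show "x \<in> up M" using x by (intro mem_upI) auto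
qed

lemma poly_module_simps [simp]:
  "carrier (poly_module M) = up M" "zero (poly_module M) = (\<lambda>i. \<zero>\<^bsub>M\<^esub>)"
  "add (poly_module M) = (\<lambda>x y i. x i \<oplus>\<^bsub>M\<^esub> y i)" "smult (poly_module M) = (\<lambda>c x i. c \<odot>\<^bsub>M\<^esub> x i)"
  by (simp_all add: poly_module_def)

lemma poly_module_module:
  assumes "module K M"
  shows "module K (poly_module M)"
proof -
  interpret M: module K M by fact
  have cl: "(\<lambda>i. f (x i) (y i)) \<in> up M"
    if "x \<in> up M" "y \<in> up M" "\<And>a b. a \<in> carrier M \<Longrightarrow> b \<in> carrier M \<Longrightarrow> f a b \<in> carrier M"
      "f \<zero>\<^bsub>M\<^esub> \<zero>\<^bsub>M\<^esub> = \<zero>\<^bsub>M\<^esub>" for x y f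
  proof -
    have "{i. f (x i) (y i) \<noteq> \<zero>\<^bsub>M\<^esub>} \<subseteq> {i. x i \<noteq> \<zero>\<^bsub>M\<^esub>} \<union> {i. y i \<noteq> \<zero>\<^bsub>M\<^esub>}" using that(4) by auto
    moreover have "finite ({i. x i \<noteq> \<zero>\<^bsub>M\<^esub>} \<union> {i. y i \<noteq> \<zero>\<^bsub>M\<^esub>})" using that(1,2) by (simp add: up_iff)
    ultimately have "finite {i. f (x i) (y i) \<noteq> \<zero>\<^bsub>M\<^esub>}" by (rule finite_subset)
    then show ?thesis using that(1-3) by (simp add: up_iff)
  qed
  have z: "(\<lambda>i. \<zero>\<^bsub>M\<^esub>) \<in> up M" by (simp add: up_iff)
  have cM: "x \<in> up M \<Longrightarrow> x i \<in> carrier M" for x i by (simp add: up_iff)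
  have ag: "abelian_group (poly_module M)"
  proof (rule abelian_groupI)
    fix x assume x: "x \<in> carrier (poly_module M)"
    then have "(\<lambda>i. \<ominus>\<^bsub>M\<^esub> x i) \<in> up M" using cl[of x x "\<lambda>a b. \<ominus>\<^bsub>M\<^esub> a"] by simp
    then show "\<exists>y\<in>carrier (poly_module M). y \<oplus>\<^bsub>poly_module M\<^esub> x = \<zero>\<^bsub>poly_module M\<^esub>"
      using x cM by (intro bexI[of _ "\<lambda>i. \<ominus>\<^bsub>M\<^esub> x i"]) (auto simp: M.l_neg)
    show "\<zero>\<^bsub>poly_module M\<^esub> \<oplus>\<^bsub>poly_module M\<^esub> x = x" using x cM by auto
  next
    fix x y assume xy: "x \<in> carrier (poly_module M)" "y \<in> carrier (poly_module M)"
    then show "x \<oplus>\<^bsub>poly_module M\<^esub> y \<in> carrier (poly_module M)"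
      using cl[of x y "\<lambda>a b. a \<oplus>\<^bsub>M\<^esub> b"] by simp
    show "x \<oplus>\<^bsub>poly_module M\<^esub> y = y \<oplus>\<^bsub>poly_module M\<^esub> x" using xy cM by (auto simp: M.a_comm)
    fix w assume "w \<in> carrier (poly_module M)"
    then show "x \<oplus>\<^bsub>poly_module M\<^esub> y \<oplus>\<^bsub>poly_module M\<^esub> w = x \<oplus>\<^bsub>poly_module M\<^esub> (y \<oplus>\<^bsub>poly_module M\<^esub> w)"
      using xy cM by (auto simp: M.a_assoc)
  qed (use z in simp)
  show ?thesis
  proof (rule moduleI[OF M.is_cring ag], goal_cases)
    case (1 a x)
    then show ?case using cl[of x x "\<lambda>b c. a \<odot>\<^bsub>M\<^esub> b"] by simp
  qed (auto simp: cM M.smult_l_distr M.smult_r_distr M.smult_assoc1)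
qed

lemma poly_component:
  "additive_map (poly_module M) M (\<lambda>x. x i)"
  by (auto simp: additive_map_def up_iff)

lemma hmonom_closed [simp]:
  assumes "abelian_monoid M" "a \<in> carrier M"
  shows "hmonom M i a \<in> up M"
proof -
  have "{j. hmonom M i a j \<noteq> \<zero>\<^bsub>M\<^esub>} \<subseteq> {i}" by (auto simp: hmonom_def)
  then have "finite {j. hmonom M i a j \<noteq> \<zero>\<^bsub>M\<^esub>}" by (rule finite_subset) simp
  moreover have "hmonom M i a j \<in> carrier M" for j
    using assms abelian_monoid.zero_closed[OF assms(1)] by (simp add: hmonom_def)
  ultimately show ?thesis unfolding up_iff by simp
qed

lemma hshift_closed [simp]:
  assumes "abelian_monoid M" "x \<in> up M"
  shows "hshift M l x \<in> up M"
proof -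
  have "{i. hshift M l x i \<noteq> \<zero>\<^bsub>M\<^esub>} \<subseteq> (\<lambda>i. i + l) ` {i. x i \<noteq> \<zero>\<^bsub>M\<^esub>}"
  proof
    fix i assume "i \<in> {i. hshift M l x i \<noteq> \<zero>\<^bsub>M\<^esub>}"
    then have "\<not> i < l" "x (i - l) \<noteq> \<zero>\<^bsub>M\<^esub>" by (auto simp: hshift_def split: if_splits)
    then show "i \<in> (\<lambda>i. i + l) ` {i. x i \<noteq> \<zero>\<^bsub>M\<^esub>}" by (intro image_eqI[of _ _ "i - l"]) auto
  qed
  moreover have "finite ((\<lambda>i. i + l) ` {i. x i \<noteq> \<zero>\<^bsub>M\<^esub>})" using assms(2) by (simp add: up_iff)
  ultimately have "finite {i. hshift M l x i \<noteq> \<zero>\<^bsub>M\<^esub>}" by (rule finite_subset)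
  moreover have "hshift M l x j \<in> carrier M" for j
    using assms(2) abelian_monoid.zero_closed[OF assms(1)] by (simp add: hshift_def up_iff)
  ultimately show ?thesis unfolding up_iff by simp
qed

lemma hmonom_additive:
  assumes "abelian_group M"
  shows "additive_map M (poly_module M) (hmonom M i)"
proof -
  interpret M: abelian_group M by fact
  have "hmonom M i (a \<oplus>\<^bsub>M\<^esub> b) = (\<lambda>j. hmonom M i a j \<oplus>\<^bsub>M\<^esub> hmonom M i b j)" for a b
    by (rule ext) (simp add: hmonom_def)
  then show ?thesis by (simp add: additive_map_def Pi_iff M.abelian_monoid_axioms)
qed

lemma hshift_additive:
  assumes "abelian_group M"
  shows "additive_map (poly_module M) (poly_module M) (hshift M l)"
proof -
  interpret M: abelian_group M by fact
  have "hshift M l (\<lambda>i. x i \<oplus>\<^bsub>M\<^esub> y i) = (\<lambda>i. hshift M l x i \<oplus>\<^bsub>M\<^esub> hshift M l y i)" for x y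
    by (rule ext) (simp add: hshift_def)
  then show ?thesis by (simp add: additive_map_def Pi_iff M.abelian_monoid_axioms)
qed

lemma hshift_hmonom: "hshift M l (hmonom M i a) = hmonom M (l + i) a"
  by (auto simp: hshift_def hmonom_def fun_eq_iff)

lemma poly_decomp:
  assumes "module K M" "x \<in> up M" "finite A" "{i. x i \<noteq> \<zero>\<^bsub>M\<^esub>} \<subseteq> A"
  shows "x = (\<Oplus>\<^bsub>poly_module M\<^esub>i\<in>A. hmonom M i (x i))"
proof (rule ext)
  interpret M: module K M by fact
  interpret P: module K "poly_module M" by (rule poly_module_module[OF assms(1)])
  fix j
  have cM: "x i \<in> carrier M" for i using assms(2) by (simp add: up_iff)
  have "(\<Oplus>\<^bsub>poly_module M\<^esub>i\<in>A. hmonom M i (x i)) j = (\<Oplus>\<^bsub>M\<^esub>i\<in>A. hmonom M i (x i) j)"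
    by (rule additive_map_finsum[OF P.abelian_group_axioms M.abelian_group_axioms poly_component])
      (use cM M.abelian_monoid_axioms in auto)
  also have "\<dots> = (\<Oplus>\<^bsub>M\<^esub>i\<in>A. if i = j then x i else \<zero>\<^bsub>M\<^esub>)"
    by (rule M.finsum_cong') (use cM in \<open>auto simp: hmonom_def\<close>)
  also have "\<dots> = (if j \<in> A then x j else \<zero>\<^bsub>M\<^esub>)"
    by (rule M.finsum_delta[OF assms(3)]) (use cM in auto)
  also have "\<dots> = x j"
  proof -
    have "j \<notin> A \<Longrightarrow> x j = \<zero>\<^bsub>M\<^esub>" using assms(4) by blast
    then show ?thesis by auto
  qed
  finally show "x j = (\<Oplus>\<^bsub>poly_module M\<^esub>i\<in>A. hmonom M i (x i)) j" by simp
qed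

section \<open>The module of symbols and the polynomials in h over it\<close>

context star_setting
begin

abbreviation "S \<equiv> symb_algebra K \<Omega> E"
abbreviation "PM \<equiv> poly_module S"
abbreviation "\<iota> \<equiv> symb_in K \<Omega> E"

lemma S_carrier: "a \<in> carrier S \<longleftrightarrow> (\<forall>n. a n \<in> Y n) \<and> finite {n. a n \<noteq> B n}"
  and S_zero: "\<zero>\<^bsub>S\<^esub> = (\<lambda>n. B n)"
  and S_add: "(a \<oplus>\<^bsub>S\<^esub> b) n = a n <+>\<^bsub>R\<^esub> b n"
  and S_smult: "(c \<odot>\<^bsub>S\<^esub> a) n = symbol_smult K \<Omega> E n c (a n)"
  by (simp_all add: symb_algebra_def symb_module_def)

lemma S_Y: "a \<in> carrier S \<Longrightarrow> a n \<in> Y n"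
  by (simp add: S_carrier)

lemma S_q: "a \<in> carrier S \<Longrightarrow> q n (a n) \<in> carrier R"
  by (simp add: S_Y q_closed)

lemma q_S: "a \<in> carrier S \<Longrightarrow> b \<in> carrier S \<Longrightarrow> q n ((a \<oplus>\<^bsub>S\<^esub> b) n) = q n (a n) \<oplus>\<^bsub>R\<^esub> q n (b n)"
  "c \<in> carrier K \<Longrightarrow> a \<in> carrier S \<Longrightarrow> q n ((c \<odot>\<^bsub>S\<^esub> a) n) = c \<odot>\<^bsub>R\<^esub> q n (a n)"
  "q n (\<zero>\<^bsub>S\<^esub> n) = \<zero>\<^bsub>R\<^esub>"
  by (simp_all add: S_add S_smult S_zero S_Y q_add q_smult q_zero)

text \<open>Quantizing each component embeds the families of symbols into sequences of operators.
  The module axioms for cosets are transported from \<open>R\<close> along this embedding.\<close>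

lemma S_eqI: "a \<in> carrier S \<Longrightarrow> b \<in> carrier S \<Longrightarrow> (\<And>n. q n (a n) = q n (b n)) \<Longrightarrow> a = b"
  using q_inj S_Y by (metis ext)

lemma S_closed:
  "\<zero>\<^bsub>S\<^esub> \<in> carrier S" "a \<in> carrier S \<Longrightarrow> b \<in> carrier S \<Longrightarrow> a \<oplus>\<^bsub>S\<^esub> b \<in> carrier S"
  "c \<in> carrier K \<Longrightarrow> a \<in> carrier S \<Longrightarrow> c \<odot>\<^bsub>S\<^esub> a \<in> carrier S"
proof -
  show "\<zero>\<^bsub>S\<^esub> \<in> carrier S" by (simp add: S_carrier S_zero B_Y)
  assume a: "a \<in> carrier S"
  { assume b: "b \<in> carrier S"
    have y: "(a \<oplus>\<^bsub>S\<^esub> b) n \<in> Y n" for n using a b by (simp add: S_add S_Y Y_add)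
    have "{n. (a \<oplus>\<^bsub>S\<^esub> b) n \<noteq> B n} \<subseteq> {n. a n \<noteq> B n} \<union> {n. b n \<noteq> B n}"
    proof
      fix n assume "n \<in> {n. (a \<oplus>\<^bsub>S\<^esub> b) n \<noteq> B n}"
      then have "q n ((a \<oplus>\<^bsub>S\<^esub> b) n) \<noteq> \<zero>\<^bsub>R\<^esub>" using q_zero_iff[OF y] by simp
      then have "\<not> (q n (a n) = \<zero>\<^bsub>R\<^esub> \<and> q n (b n) = \<zero>\<^bsub>R\<^esub>)" using q_S(1)[OF a b] by auto
      then show "n \<in> {n. a n \<noteq> B n} \<union> {n. b n \<noteq> B n}" using q_zero by auto
    qed
    moreover have "finite ({n. a n \<noteq> B n} \<union> {n. b n \<noteq> B n})" using a b by (simp add: S_carrier)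
    ultimately have "finite {n. (a \<oplus>\<^bsub>S\<^esub> b) n \<noteq> B n}" by (rule finite_subset)
    then show "a \<oplus>\<^bsub>S\<^esub> b \<in> carrier S" using y by (simp add: S_carrier) }
  assume c: "c \<in> carrier K"
  have y: "(c \<odot>\<^bsub>S\<^esub> a) n \<in> Y n" for n using a c by (simp add: S_smult S_Y Y_smult)
  have "{n. (c \<odot>\<^bsub>S\<^esub> a) n \<noteq> B n} \<subseteq> {n. a n \<noteq> B n}"
  proof
    fix n assume "n \<in> {n. (c \<odot>\<^bsub>S\<^esub> a) n \<noteq> B n}"
    then have "q n ((c \<odot>\<^bsub>S\<^esub> a) n) \<noteq> \<zero>\<^bsub>R\<^esub>" using q_zero_iff[OF y] by simp
    then have "q n (a n) \<noteq> \<zero>\<^bsub>R\<^esub>" using q_S(2)[OF c a] DM.smult_r_null[OF c] by auto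
    then show "n \<in> {n. a n \<noteq> B n}" using q_zero by auto
  qed
  moreover have "finite {n. a n \<noteq> B n}" using a by (simp add: S_carrier)
  ultimately have "finite {n. (c \<odot>\<^bsub>S\<^esub> a) n \<noteq> B n}" by (rule finite_subset)
  then show "c \<odot>\<^bsub>S\<^esub> a \<in> carrier S" using y by (simp add: S_carrier)
qed

lemma S_module: "module K S"
proof -
  note r = S_closed q_S S_q D.a_assoc
  have ag: "abelian_group S"
  proof (rule abelian_groupI)
    fix a assume a: "a \<in> carrier S"
    let ?b = "(\<ominus>\<^bsub>K\<^esub> \<one>\<^bsub>K\<^esub>) \<odot>\<^bsub>S\<^esub> a"
    have b: "?b \<in> carrier S" by (rule S_closed(3)) (use a in auto)
    have "?b \<oplus>\<^bsub>S\<^esub> a = \<zero>\<^bsub>S\<^esub>"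
      by (rule S_eqI) (use a b in \<open>simp_all add: r DM.smult_l_minus D.l_neg\<close>)
    then show "\<exists>y\<in>carrier S. y \<oplus>\<^bsub>S\<^esub> a = \<zero>\<^bsub>S\<^esub>" using b by blast
    show "\<zero>\<^bsub>S\<^esub> \<oplus>\<^bsub>S\<^esub> a = a" by (rule S_eqI) (use a in \<open>simp_all add: r\<close>)
  next
    fix a b assume ab: "a \<in> carrier S" "b \<in> carrier S"
    show "a \<oplus>\<^bsub>S\<^esub> b \<in> carrier S" by (rule S_closed(2)[OF ab])
    show "a \<oplus>\<^bsub>S\<^esub> b = b \<oplus>\<^bsub>S\<^esub> a" by (rule S_eqI) (use ab in \<open>simp_all add: r D.a_comm\<close>)
    fix c assume c: "c \<in> carrier S"
    show "a \<oplus>\<^bsub>S\<^esub> b \<oplus>\<^bsub>S\<^esub> c = a \<oplus>\<^bsub>S\<^esub> (b \<oplus>\<^bsub>S\<^esub> c)" by (rule S_eqI) (use ab c in \<open>simp_all add: r\<close>)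
  qed (rule S_closed(1))
  show ?thesis
  proof (rule moduleI[OF is_cring ag])
    fix c a assume c: "c \<in> carrier K" and a: "a \<in> carrier S"
    show "c \<odot>\<^bsub>S\<^esub> a \<in> carrier S" by (rule S_closed(3)[OF c a])
    { fix b assume b: "b \<in> carrier S"
      show "c \<odot>\<^bsub>S\<^esub> (a \<oplus>\<^bsub>S\<^esub> b) = c \<odot>\<^bsub>S\<^esub> a \<oplus>\<^bsub>S\<^esub> c \<odot>\<^bsub>S\<^esub> b"
        by (rule S_eqI) (use a b c in \<open>simp_all add: r DM.smult_r_distr\<close>) }
    fix d assume d: "d \<in> carrier K"
    show "(c \<oplus>\<^bsub>K\<^esub> d) \<odot>\<^bsub>S\<^esub> a = c \<odot>\<^bsub>S\<^esub> a \<oplus>\<^bsub>S\<^esub> d \<odot>\<^bsub>S\<^esub> a"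
      by (rule S_eqI) (use a c d in \<open>simp_all add: r DM.smult_l_distr\<close>)
    show "(c \<otimes>\<^bsub>K\<^esub> d) \<odot>\<^bsub>S\<^esub> a = c \<odot>\<^bsub>S\<^esub> (d \<odot>\<^bsub>S\<^esub> a)"
      by (rule S_eqI) (use a c d in \<open>simp_all add: r DM.smult_assoc1\<close>)
  next
    fix a assume a: "a \<in> carrier S"
    show "\<one>\<^bsub>K\<^esub> \<odot>\<^bsub>S\<^esub> a = a" by (rule S_eqI) (use a in \<open>simp_all add: r\<close>)
  qed
qed

sublocale S: module K "symb_algebra K \<Omega> E" by (rule S_module)
sublocale PM: module K "poly_module (symb_algebra K \<Omega> E)" by (rule poly_module_module[OF S_module])

lemma S_component: "additive_map S R (\<lambda>a. q n (a n))"
  by (simp add: additive_map_def Pi_iff S_q q_S)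

lemma symb_in_closed [simp]: "U \<in> Y n \<Longrightarrow> \<iota> n U \<in> carrier S"
  unfolding S_carrier symb_in_def by (auto simp: B_Y intro: finite_subset[of _ "{n}"])

lemma q_symb_in: "q m (\<iota> n U m) = (if m = n then q n U else \<zero>\<^bsub>R\<^esub>)"
  by (auto simp: symb_in_def q_zero)

lemma S_decomp:
  assumes a: "a \<in> carrier S" and A: "finite A" "{n. a n \<noteq> B n} \<subseteq> A"
  shows "a = (\<Oplus>\<^bsub>S\<^esub>n\<in>A. \<iota> n (a n))"
proof (rule S_eqI[OF a])
  have c: "(\<lambda>n. \<iota> n (a n)) \<in> A \<rightarrow> carrier S" using a by (simp add: S_Y)
  then show "(\<Oplus>\<^bsub>S\<^esub>n\<in>A. \<iota> n (a n)) \<in> carrier S" by (rule S.finsum_closed)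
  fix m
  have "q m ((\<Oplus>\<^bsub>S\<^esub>n\<in>A. \<iota> n (a n)) m) = (\<Oplus>\<^bsub>R\<^esub>n\<in>A. q m (\<iota> n (a n) m))"
    by (rule additive_map_finsum[OF S.abelian_group_axioms D.abelian_group_axioms S_component c])
  also have "\<dots> = (\<Oplus>\<^bsub>R\<^esub>n\<in>A. if n = m then q n (a n) else \<zero>\<^bsub>R\<^esub>)"
    by (rule D.finsum_cong') (use a S_q in \<open>auto simp: q_symb_in\<close>)
  also have "\<dots> = (if m \<in> A then q m (a m) else \<zero>\<^bsub>R\<^esub>)"
    by (rule D.finsum_delta[OF A(1)]) (use a S_q in auto)
  also have "\<dots> = q m (a m)"
  proof -
    have "m \<notin> A \<Longrightarrow> a m = B m" using A(2) by blast
    then show ?thesis by (auto simp: q_zero)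
  qed
  finally show "q m (a m) = q m ((\<Oplus>\<^bsub>S\<^esub>n\<in>A. \<iota> n (a n)) m)" by simp
qed

lemma S_additive_expand:
  assumes "abelian_group G" "additive_map S G h" "a \<in> carrier S"
  shows "h a = (\<Oplus>\<^bsub>G\<^esub>n\<in>{n. a n \<noteq> B n}. h (\<iota> n (a n)))"
proof -
  have "finite {n. a n \<noteq> B n}" using assms(3) by (simp add: S_carrier)
  note d = S_decomp[OF assms(3) this subset_refl]
  show ?thesis
    by (subst (1) d) (rule additive_map_finsum[OF S.abelian_group_axioms assms(1,2)], use assms(3) S_Y in auto)
qed

lemma PM_additive_expand:
  assumes "abelian_group G" "additive_map PM G h" "x \<in> up S"
  shows "h x = (\<Oplus>\<^bsub>G\<^esub>i\<in>{i. x i \<noteq> \<zero>\<^bsub>S\<^esub>}. h (hmonom S i (x i)))"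
proof -
  have "finite {i. x i \<noteq> \<zero>\<^bsub>S\<^esub>}" using assms(3) by (simp add: up_iff)
  note d = poly_decomp[OF S_module assms(3) this subset_refl]
  show ?thesis
    by (subst (1) d) (rule additive_map_finsum[OF PM.abelian_group_axioms assms(1,2)],
      use mem_upD[OF assms(3)] S.abelian_monoid_axioms in auto)
qed

text \<open>Polynomials with a single power of \<open>h\<close> and a single degree of symbols
  generate \<open>Symb[h]\<close> additively; later identities between additive maps are reduced to
  them.\<close>

lemma PM_additive_eqI:
  assumes G: "abelian_group G" and h: "additive_map PM G h" and g: "additive_map PM G g"
    and eq: "\<And>i n U. U \<in> Y n \<Longrightarrow> h (hmonom S i (\<iota> n U)) = g (hmonom S i (\<iota> n U))"
    and x: "x \<in> up S"
  shows "h x = g x"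
proof -
  interpret G: abelian_group G by fact
  note m = hmonom_additive[OF S.abelian_group_axioms]
  have xS: "x i \<in> carrier S" for i using x by (simp add: up_iff)
  have "h (hmonom S i a) = g (hmonom S i a)" if a: "a \<in> carrier S" for i a
  proof -
    have "h (hmonom S i a) = (\<Oplus>\<^bsub>G\<^esub>n\<in>{n. a n \<noteq> B n}. h (hmonom S i (\<iota> n (a n))))"
      by (rule S_additive_expand[OF G additive_map_comp[OF m h] a])
    also have "\<dots> = (\<Oplus>\<^bsub>G\<^esub>n\<in>{n. a n \<noteq> B n}. g (hmonom S i (\<iota> n (a n))))"
      by (rule G.finsum_cong') (use a additive_map_closed[OF additive_map_comp[OF m g]] in \<open>auto simp: eq S_Y\<close>)
    also have "\<dots> = g (hmonom S i a)"
      by (rule S_additive_expand[OF G additive_map_comp[OF m g] a, symmetric])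
    finally show ?thesis .
  qed
  then have "(\<Oplus>\<^bsub>G\<^esub>i\<in>{i. x i \<noteq> \<zero>\<^bsub>S\<^esub>}. h (hmonom S i (x i))) = (\<Oplus>\<^bsub>G\<^esub>i\<in>{i. x i \<noteq> \<zero>\<^bsub>S\<^esub>}. g (hmonom S i (x i)))"
    using xS additive_map_closed[OF additive_map_comp[OF m g]] by (intro G.finsum_cong') auto
  then show ?thesis using PM_additive_expand[OF G h x] PM_additive_expand[OF G g x] by simp
qed

end

section \<open>The formal star product as an algebra of polynomials over operators\<close>

text \<open>The zero family \<open>z\<close> is a parameter because the lemma is used at two levels:
  for the sum over degrees of symbols and for the sum over powers of \<open>h\<close>. The images
  \<open>f n\<close> and \<open>g m\<close> are prescribed for the given \<open>a\<close> and
  \<open>b\<close>, so multiplicativity is asked of their components only.\<close>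

lemma additive_bilinear_ext:
  assumes G: "abelian_group G" and L: "ring L" and h: "additive_map G L h"
    and fin: "finite {n. a n \<noteq> z n}" "finite {m. b m \<noteq> z m}"
    and \<beta>: "\<And>n m. \<beta> n m (a n) (b m) \<in> carrier G"
    and f: "\<And>n. f n \<in> carrier L" and g: "\<And>m. g m \<in> carrier L"
    and eq: "\<And>n m. h (\<beta> n m (a n) (b m)) = f n \<otimes>\<^bsub>L\<^esub> g m"
  shows "h (bilinear_ext G z \<beta> a b) =
    (\<Oplus>\<^bsub>L\<^esub>n\<in>{n. a n \<noteq> z n}. f n) \<otimes>\<^bsub>L\<^esub> (\<Oplus>\<^bsub>L\<^esub>m\<in>{m. b m \<noteq> z m}. g m)"
proof -
  interpret G: abelian_group G by fact
  interpret L: ring L by fact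
  note hs = additive_map_finsum[OF G L.abelian_group_axioms h]
  have "h (bilinear_ext G z \<beta> a b) =
      (\<Oplus>\<^bsub>L\<^esub>n\<in>{n. a n \<noteq> z n}. h (\<Oplus>\<^bsub>G\<^esub>m\<in>{m. b m \<noteq> z m}. \<beta> n m (a n) (b m)))"
    unfolding bilinear_ext_def by (rule hs) (use \<beta> in \<open>auto intro!: G.finsum_closed\<close>)
  also have "\<dots> = (\<Oplus>\<^bsub>L\<^esub>n\<in>{n. a n \<noteq> z n}. f n \<otimes>\<^bsub>L\<^esub> (\<Oplus>\<^bsub>L\<^esub>m\<in>{m. b m \<noteq> z m}. g m))"
  proof (rule L.finsum_cong')
    fix n
    have "h (\<Oplus>\<^bsub>G\<^esub>m\<in>{m. b m \<noteq> z m}. \<beta> n m (a n) (b m)) =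
        (\<Oplus>\<^bsub>L\<^esub>m\<in>{m. b m \<noteq> z m}. f n \<otimes>\<^bsub>L\<^esub> g m)"
      by (subst hs) (use \<beta> in \<open>auto simp: eq\<close>)
    then show "h (\<Oplus>\<^bsub>G\<^esub>m\<in>{m. b m \<noteq> z m}. \<beta> n m (a n) (b m)) =
        f n \<otimes>\<^bsub>L\<^esub> (\<Oplus>\<^bsub>L\<^esub>m\<in>{m. b m \<noteq> z m}. g m)"
      using L.finsum_rdistr[OF fin(2) f[of n], of g] g by (simp add: Pi_iff)
  qed (use f g in \<open>auto intro!: L.m_closed L.finsum_closed\<close>)
  also have "\<dots> = (\<Oplus>\<^bsub>L\<^esub>n\<in>{n. a n \<noteq> z n}. f n) \<otimes>\<^bsub>L\<^esub> (\<Oplus>\<^bsub>L\<^esub>m\<in>{m. b m \<noteq> z m}. g m)"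
    by (rule L.finsum_ldistr[OF fin(1), symmetric]) (use f g in \<open>auto intro!: L.finsum_closed\<close>)
  finally show ?thesis .
qed

lemma bilinear_ext_closed:
  assumes "abelian_group G" "\<And>n m. \<beta> n m (a n) (b m) \<in> carrier G"
  shows "bilinear_ext G z \<beta> a b \<in> carrier G"
proof -
  interpret G: abelian_group G by fact
  show ?thesis unfolding bilinear_ext_def using assms(2) by (intro G.finsum_closed) auto
qed

context star_setting
begin

abbreviation "P \<equiv> UP R"
abbreviation "H \<equiv> formal_star_algebra K \<Omega> E q"

lemma UP_R_ring: "ring P"
  by (rule UP_ring.UP_ring) (rule UP_ring.intro[OF D.ring_axioms])

sublocale P: ring "UP (EndK K \<Omega> E)" by (rule UP_R_ring)
sublocale U: UP_ring "EndK K \<Omega> E" "UP (EndK K \<Omega> E)" by (rule UP_ring.intro[OF D.ring_axioms])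

abbreviation "tmon \<equiv> monom P"

lemma P_carrier: "carrier P = up R"
  by (simp add: UP_def)

text \<open>The coefficient of \<open>t^N\<close> in the sum of all
  \<open>q n (x i n) t^(i + n)\<close>: degree n meets the power \<open>N - n\<close> of
  \<open>h\<close>.\<close>

definition \<Phi> :: "(nat \<Rightarrow> nat \<Rightarrow> ('e \<Rightarrow> 'e) set) \<Rightarrow> nat \<Rightarrow> 'e \<Rightarrow> 'e" where
  "\<Phi> x N = (\<Oplus>\<^bsub>R\<^esub>n\<in>{..N}. q n (x (N - n) n))"

lemma up_S: "x \<in> up S \<Longrightarrow> x i \<in> carrier S"
  by (simp add: up_iff)

lemma \<Phi>_terms: "x \<in> up S \<Longrightarrow> (\<lambda>n. q n (x (N - n) n)) \<in> A \<rightarrow> carrier R"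
  by (simp add: up_S S_q)

lemma \<Phi>_up: "x \<in> up S \<Longrightarrow> \<Phi> x \<in> up R"
proof -
  assume x: "x \<in> up S"
  \<comment> \<open>The nonzero bihomogeneous components of \<open>x\<close>; every nonzero
    coefficient of \<open>\<Phi> x\<close> must come from one of them.\<close>
  let ?I = "SIGMA i:{i. x i \<noteq> \<zero>\<^bsub>S\<^esub>}. {n. x i n \<noteq> B n}"
  have "finite ?I" using x up_S[OF x] by (auto simp: up_iff S_carrier)
  moreover have "{N. \<Phi> x N \<noteq> \<zero>\<^bsub>R\<^esub>} \<subseteq> (\<lambda>(i, n). i + n) ` ?I"
  proof (rule subsetI, rule ccontr)
    fix N assume N: "N \<in> {N. \<Phi> x N \<noteq> \<zero>\<^bsub>R\<^esub>}" "N \<notin> (\<lambda>(i, n). i + n) ` ?I"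
    have "q n (x (N - n) n) = \<zero>\<^bsub>R\<^esub>" if n: "n \<le> N" for n
    proof (rule ccontr)
      assume "q n (x (N - n) n) \<noteq> \<zero>\<^bsub>R\<^esub>"
      then have "x (N - n) n \<noteq> B n" using q_zero by auto
      moreover from this have "x (N - n) \<noteq> \<zero>\<^bsub>S\<^esub>" by (auto simp: S_zero)
      ultimately have "(N - n, n) \<in> ?I" by simp
      then have "N \<in> (\<lambda>(i, n). i + n) ` ?I" using n by (intro image_eqI[of _ _ "(N - n, n)"]) simp_all
      then show False using N by blast
    qed
    then have "\<Phi> x N = (\<Oplus>\<^bsub>R\<^esub>n\<in>{..N}. \<zero>\<^bsub>R\<^esub>)"
      unfolding \<Phi>_def by (intro D.finsum_cong') auto
    then show False using N by simp
  qed
  ultimately have "finite {N. \<Phi> x N \<noteq> \<zero>\<^bsub>R\<^esub>}" using finite_subset by blast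
  moreover have "\<Phi> x N \<in> carrier R" for N unfolding \<Phi>_def by (rule D.finsum_closed[OF \<Phi>_terms[OF x]])
  ultimately show ?thesis by (simp add: up_iff)
qed

lemma P_add: "p \<in> up R \<Longrightarrow> r \<in> up R \<Longrightarrow> p \<oplus>\<^bsub>P\<^esub> r = (\<lambda>n. p n \<oplus>\<^bsub>R\<^esub> r n)"
  by (simp add: UP_def)

lemma mon_apply: "a \<in> carrier R \<Longrightarrow> tmon a n = (\<lambda>i. if i = n then a else \<zero>\<^bsub>R\<^esub>)"
  by (simp add: UP_def)

lemma \<Phi>_additive: "additive_map PM P \<Phi>"
proof -
  have "\<Phi> (\<lambda>i. x i \<oplus>\<^bsub>S\<^esub> y i) = \<Phi> x \<oplus>\<^bsub>P\<^esub> \<Phi> y" if x: "x \<in> up S" and y: "y \<in> up S" for x y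
  proof (rule ext)
    fix N
    have "\<Phi> (\<lambda>i. x i \<oplus>\<^bsub>S\<^esub> y i) N = (\<Oplus>\<^bsub>R\<^esub>n\<in>{..N}. q n (x (N - n) n) \<oplus>\<^bsub>R\<^esub> q n (y (N - n) n))"
      unfolding \<Phi>_def by (simp add: q_S up_S[OF x] up_S[OF y])
    also have "\<dots> = \<Phi> x N \<oplus>\<^bsub>R\<^esub> \<Phi> y N"
      unfolding \<Phi>_def by (rule D.finsum_addf[OF \<Phi>_terms[OF x] \<Phi>_terms[OF y]])
    finally show "\<Phi> (\<lambda>i. x i \<oplus>\<^bsub>S\<^esub> y i) N = (\<Phi> x \<oplus>\<^bsub>P\<^esub> \<Phi> y) N"
      by (simp add: P_add[OF \<Phi>_up[OF x] \<Phi>_up[OF y]])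
  qed
  then show ?thesis by (simp add: additive_map_def Pi_iff P_carrier \<Phi>_up)
qed

lemma q_sum_F: "(\<And>n. u n \<in> Y n) \<Longrightarrow> (\<Oplus>\<^bsub>R\<^esub>n\<in>{..N}. q n (u n)) \<in> F N"
proof (induction N)
  case 0
  then show ?case using q_F[of "u 0" 0] F_closed[OF q_F[of "u 0" 0]] by simp
next
  case (Suc N)
  have "(\<Oplus>\<^bsub>R\<^esub>n\<in>{..Suc N}. q n (u n)) = q (Suc N) (u (Suc N)) \<oplus>\<^bsub>R\<^esub> (\<Oplus>\<^bsub>R\<^esub>n\<in>{..N}. q n (u n))"
    by (rule D.finsum_Suc) (use Suc.prems q_closed in auto)
  moreover have "(\<Oplus>\<^bsub>R\<^esub>n\<in>{..N}. q n (u n)) \<in> F (Suc N)"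
    using Suc F_mono[of N "Suc N"] by auto
  ultimately show ?case using F_add[OF q_F[OF Suc.prems]] by metis
qed

text \<open>The symbol of order \<open>N\<close> of \<open>\<Sum>\<^sub>n\<^sub>\<le>\<^sub>N q\<^sup>n(u\<^sub>n)\<close> is \<open>u\<^sub>N\<close>, so that the \<open>u\<^sub>n\<close> can be read off from the top.\<close>

lemma q_sum_inj:
  assumes "\<And>n. u n \<in> Y n" "\<And>n. v n \<in> Y n"
    and "(\<Oplus>\<^bsub>R\<^esub>n\<in>{..N}. q n (u n)) = (\<Oplus>\<^bsub>R\<^esub>n\<in>{..N}. q n (v n))" "n \<le> N"
  shows "u n = v n"
  using assms(3,4)
proof (induction N)
  case 0
  then show ?case using q_inj[OF assms(1,2), of 0] q_closed[OF assms(1), of 0] q_closed[OF assms(2), of 0] by simp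
next
  case (Suc N)
  have e: "(\<Oplus>\<^bsub>R\<^esub>n\<in>{..Suc N}. q n (w n)) = (\<Oplus>\<^bsub>R\<^esub>n\<in>{..N}. q n (w n)) \<oplus>\<^bsub>R\<^esub> q (Suc N) (w (Suc N))"
    and b: "(\<Oplus>\<^bsub>R\<^esub>n\<in>{..N}. q n (w n)) \<in> B (Suc N)"
    if "\<And>n. w n \<in> Y n" for w
  proof -
    have "(\<Oplus>\<^bsub>R\<^esub>n\<in>{..Suc N}. q n (w n)) = q (Suc N) (w (Suc N)) \<oplus>\<^bsub>R\<^esub> (\<Oplus>\<^bsub>R\<^esub>n\<in>{..N}. q n (w n))"
      by (rule D.finsum_Suc) (use that q_closed in auto)
    then show "(\<Oplus>\<^bsub>R\<^esub>n\<in>{..Suc N}. q n (w n)) = (\<Oplus>\<^bsub>R\<^esub>n\<in>{..N}. q n (w n)) \<oplus>\<^bsub>R\<^esub> q (Suc N) (w (Suc N))"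
      using that q_closed by (simp add: D.a_comm D.finsum_closed Pi_iff)
    show "(\<Oplus>\<^bsub>R\<^esub>n\<in>{..N}. q n (w n)) \<in> B (Suc N)" unfolding B_Suc by (rule q_sum_F[OF that])
  qed
  have t: "s (Suc N) (\<Oplus>\<^bsub>R\<^esub>n\<in>{..Suc N}. q n (w n)) = w (Suc N)" if w: "\<And>n. w n \<in> Y n" for w
    unfolding e[OF w] s_absorb[OF b[OF w] q_closed[OF w]] by (rule s_q[OF w])
  have top: "u (Suc N) = v (Suc N)" using t[OF assms(1)] t[OF assms(2)] Suc.prems(1) by simp
  have "(\<Oplus>\<^bsub>R\<^esub>n\<in>{..N}. q n (u n)) \<oplus>\<^bsub>R\<^esub> q (Suc N) (u (Suc N)) = (\<Oplus>\<^bsub>R\<^esub>n\<in>{..N}. q n (v n)) \<oplus>\<^bsub>R\<^esub> q (Suc N) (u (Suc N))"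
    using Suc.prems(1) e[OF assms(1)] e[OF assms(2)] top by simp
  then have "(\<Oplus>\<^bsub>R\<^esub>n\<in>{..N}. q n (u n)) = (\<Oplus>\<^bsub>R\<^esub>n\<in>{..N}. q n (v n))"
    using B_sub[OF b[OF assms(1)]] B_sub[OF b[OF assms(2)]] q_closed[OF assms(1), of "Suc N"] by (simp add: D.add.right_cancel)
  then show ?case using Suc top by (cases "n = Suc N") auto
qed

text \<open>The component of bidegree \<open>(i, n)\<close> is read off at exponent
  \<open>i + n\<close>. There each degree m occurs just once, with the power
  \<open>i + n - m\<close> of \<open>h\<close>, so \<open>q_sum_inj\<close> applies.\<close>

lemma \<Phi>_inj:
  assumes "x \<in> up S" "y \<in> up S" "\<Phi> x = \<Phi> y"
  shows "x = y"
proof (intro ext)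
  fix i n
  have "(\<Oplus>\<^bsub>R\<^esub>m\<in>{..i + n}. q m (x (i + n - m) m)) = (\<Oplus>\<^bsub>R\<^esub>m\<in>{..i + n}. q m (y (i + n - m) m))"
    using fun_cong[OF assms(3), of "i + n"] by (simp add: \<Phi>_def)
  from q_sum_inj[OF _ _ this, of n] show "x i n = y i n"
    using up_S[OF assms(1)] up_S[OF assms(2)] S_Y by simp
qed

lemma \<Phi>_hmonom:
  assumes U: "U \<in> Y n"
  shows "\<Phi> (hmonom S i (\<iota> n U)) = tmon (q n U) (i + n)"
proof (rule ext)
  fix N
  have "\<Phi> (hmonom S i (\<iota> n U)) N = (\<Oplus>\<^bsub>R\<^esub>m\<in>{..N}. if m = n then if N - m = i then q n U else \<zero>\<^bsub>R\<^esub> else \<zero>\<^bsub>R\<^esub>)"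
    unfolding \<Phi>_def by (rule D.finsum_cong') (use U q_closed in \<open>auto simp: hmonom_def q_symb_in q_S(3)\<close>)
  also have "\<dots> = (if n \<in> {..N} then if N - n = i then q n U else \<zero>\<^bsub>R\<^esub> else \<zero>\<^bsub>R\<^esub>)"
    by (rule D.finsum_delta) (use U q_closed in auto)
  also have "\<dots> = tmon (q n U) (i + n) N" by (auto simp: mon_apply[OF q_closed[OF U]])
  finally show "\<Phi> (hmonom S i (\<iota> n U)) N = tmon (q n U) (i + n) N" .
qed

lemma mon_closed: "a \<in> carrier R \<Longrightarrow> tmon a n \<in> carrier P"
  by (rule U.monom_closed)

lemma mon_mult: "a \<in> carrier R \<Longrightarrow> b \<in> carrier R \<Longrightarrow> tmon a n \<otimes>\<^bsub>P\<^esub> tmon b m = tmon (a \<otimes>\<^bsub>R\<^esub> b) (n + m)"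
  by (rule U.monom_mult[symmetric])

lemma mon_additive: "additive_map R P (\<lambda>a. tmon a n)"
  unfolding additive_map_def using U.monom_add mon_closed by blast

lemma \<Phi>_closed: "x \<in> up S \<Longrightarrow> \<Phi> x \<in> carrier P"
  by (simp add: P_carrier \<Phi>_up)

lemma mult_left_additive: "p \<in> carrier P \<Longrightarrow> additive_map P P (\<lambda>r. p \<otimes>\<^bsub>P\<^esub> r)"
  and mult_right_additive: "p \<in> carrier P \<Longrightarrow> additive_map P P (\<lambda>r. r \<otimes>\<^bsub>P\<^esub> p)"
  unfolding additive_map_def by (simp_all add: P.l_distr P.r_distr)

text \<open>\<open>h\<close> corresponds to \<open>t\<close>, which is central among the polynomials
  although \<open>R\<close> need not be commutative. Both sides are recorded in order to see that
  \<open>h\<close> is central.\<close>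

lemma \<Phi>_shift:
  assumes x: "x \<in> up S"
  shows "\<Phi> (hshift S l x) = tmon \<one>\<^bsub>R\<^esub> l \<otimes>\<^bsub>P\<^esub> \<Phi> x" "\<Phi> (hshift S l x) = \<Phi> x \<otimes>\<^bsub>P\<^esub> tmon \<one>\<^bsub>R\<^esub> l"
proof -
  note m = mon_closed[OF D.one_closed]
  note h = additive_map_comp[OF hshift_additive[OF S.abelian_group_axioms] \<Phi>_additive]
  show "\<Phi> (hshift S l x) = tmon \<one>\<^bsub>R\<^esub> l \<otimes>\<^bsub>P\<^esub> \<Phi> x"
    by (rule PM_additive_eqI[OF P.abelian_group_axioms h additive_map_comp[OF \<Phi>_additive mult_left_additive[OF m]] _ x])
      (simp add: hshift_hmonom \<Phi>_hmonom mon_mult q_closed add.assoc)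
  show "\<Phi> (hshift S l x) = \<Phi> x \<otimes>\<^bsub>P\<^esub> tmon \<one>\<^bsub>R\<^esub> l"
    by (rule PM_additive_eqI[OF P.abelian_group_axioms h additive_map_comp[OF \<Phi>_additive mult_right_additive[OF m]] _ x])
      (simp add: hshift_hmonom \<Phi>_hmonom mon_mult q_closed add.commute add.left_commute)
qed

lemma PM_smult_additive: "c \<in> carrier K \<Longrightarrow> additive_map PM PM (\<lambda>x. c \<odot>\<^bsub>PM\<^esub> x)"
  unfolding additive_map_def using PM.smult_closed PM.smult_r_distr by blast

lemma smult_symb_in: "c \<in> carrier K \<Longrightarrow> U \<in> Y n \<Longrightarrow> c \<odot>\<^bsub>S\<^esub> \<iota> n U = \<iota> n (symbol_smult K \<Omega> E n c U)"
  by (rule S_eqI) (auto simp: q_S q_symb_in q_smult Y_smult S_closed)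

lemma \<Phi>_smult:
  assumes c: "c \<in> carrier K" and x: "x \<in> up S"
  shows "\<Phi> (c \<odot>\<^bsub>PM\<^esub> x) = tmon (c \<odot>\<^bsub>R\<^esub> \<one>\<^bsub>R\<^esub>) 0 \<otimes>\<^bsub>P\<^esub> \<Phi> x"
    "\<Phi> (c \<odot>\<^bsub>PM\<^esub> x) = \<Phi> x \<otimes>\<^bsub>P\<^esub> tmon (c \<odot>\<^bsub>R\<^esub> \<one>\<^bsub>R\<^esub>) 0"
proof -
  have c1: "c \<odot>\<^bsub>R\<^esub> \<one>\<^bsub>R\<^esub> \<in> carrier R" using c by (rule DM.smult_closed) (rule D.one_closed)
  note m = mon_closed[OF c1]
  note h = additive_map_comp[OF PM_smult_additive[OF c] \<Phi>_additive]
  have g: "c \<odot>\<^bsub>PM\<^esub> hmonom S i (\<iota> n U) = hmonom S i (\<iota> n (symbol_smult K \<Omega> E n c U))" if "U \<in> Y n" for i n U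
    using c that by (auto simp: hmonom_def fun_eq_iff smult_symb_in)
  have l: "(c \<odot>\<^bsub>R\<^esub> \<one>\<^bsub>R\<^esub>) \<otimes>\<^bsub>R\<^esub> a = c \<odot>\<^bsub>R\<^esub> a" and r: "a \<otimes>\<^bsub>R\<^esub> (c \<odot>\<^bsub>R\<^esub> \<one>\<^bsub>R\<^esub>) = c \<odot>\<^bsub>R\<^esub> a"
    if a: "a \<in> carrier R" for a
    using DM.smult_mult_left[OF c D.one_closed a] DM.smult_mult_right[OF c a D.one_closed]
      D.l_one[OF a] D.r_one[OF a] by (simp_all only:)
  have e1: "\<Phi> (c \<odot>\<^bsub>PM\<^esub> hmonom S i (\<iota> n U)) = tmon (c \<odot>\<^bsub>R\<^esub> \<one>\<^bsub>R\<^esub>) 0 \<otimes>\<^bsub>P\<^esub> \<Phi> (hmonom S i (\<iota> n U))"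
    and e2: "\<Phi> (c \<odot>\<^bsub>PM\<^esub> hmonom S i (\<iota> n U)) = \<Phi> (hmonom S i (\<iota> n U)) \<otimes>\<^bsub>P\<^esub> tmon (c \<odot>\<^bsub>R\<^esub> \<one>\<^bsub>R\<^esub>) 0"
    if U: "U \<in> Y n" for i n U
    unfolding g[OF U] \<Phi>_hmonom[OF U] \<Phi>_hmonom[OF Y_smult[OF c U]] q_smult[OF c U]
      mon_mult[OF c1 q_closed[OF U]] mon_mult[OF q_closed[OF U] c1] l[OF q_closed[OF U]] r[OF q_closed[OF U]]
    by simp_all
  show "\<Phi> (c \<odot>\<^bsub>PM\<^esub> x) = tmon (c \<odot>\<^bsub>R\<^esub> \<one>\<^bsub>R\<^esub>) 0 \<otimes>\<^bsub>P\<^esub> \<Phi> x"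
    by (rule PM_additive_eqI[OF P.abelian_group_axioms h additive_map_comp[OF \<Phi>_additive mult_left_additive[OF m]] e1 x])
  show "\<Phi> (c \<odot>\<^bsub>PM\<^esub> x) = \<Phi> x \<otimes>\<^bsub>P\<^esub> tmon (c \<odot>\<^bsub>R\<^esub> \<one>\<^bsub>R\<^esub>) 0"
    by (rule PM_additive_eqI[OF P.abelian_group_axioms h additive_map_comp[OF \<Phi>_additive mult_right_additive[OF m]] e2 x])
qed

section \<open>Star products of homogeneous symbols\<close>

abbreviation "st_term \<equiv> star_term K \<Omega> E q"

lemma star_symbol_F:
  assumes "U \<in> Y n" "V \<in> Y m" "k \<le> n + m"
  shows "tr (n + m) (q n U \<otimes>\<^bsub>R\<^esub> q m V) (n + m - k) \<in> F (n + m - k)"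
  by (rule tr_F[OF F_mult[OF q_F[OF assms(1)] q_F[OF assms(2)]]]) simp

lemma st_term_closed: "U \<in> Y n \<Longrightarrow> V \<in> Y m \<Longrightarrow> k \<le> n + m \<Longrightarrow> st_term n m U V k \<in> carrier S"
  unfolding star_term_def by (intro symb_in_closed s_Y star_symbol_F)

definition hprod where
  "hprod n m U V = (\<Oplus>\<^bsub>PM\<^esub>k\<in>{..n + m}. hmonom S k (st_term n m U V k))"

text \<open>The inner of the two extensions in \<open>formal_star_algebra\<close>: the formal star
  product of two symbols free of \<open>h\<close>.\<close>

definition formal_prod where
  "formal_prod = bilinear_ext PM (\<lambda>n. B n) hprod"

lemma hprod_closed: "U \<in> Y n \<Longrightarrow> V \<in> Y m \<Longrightarrow> hprod n m U V \<in> carrier PM"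
  unfolding hprod_def
  by (rule PM.finsum_closed) (use st_term_closed S.abelian_monoid_axioms in auto)

text \<open>The truncations of \<open>\<Delta>\<close> recover \<open>\<Delta> = \<Sum>\<^sub>k q\<^sup>k([\<Delta>]\<^sup>k)\<close>; hence \<open>\<Phi>\<close> turns the star product of
  homogeneous symbols into the composition of their quantizations.\<close>

lemma \<Phi>_hprod:
  assumes U: "U \<in> Y n" and V: "V \<in> Y m"
  shows "\<Phi> (hprod n m U V) = tmon (q n U) n \<otimes>\<^bsub>P\<^esub> tmon (q m V) m"
proof -
  let ?f = "q n U \<otimes>\<^bsub>R\<^esub> q m V" and ?N = "n + m"
  let ?g = "\<lambda>j. q j (s j (tr ?N ?f j))"
  have f: "?f \<in> F ?N" by (rule F_mult[OF q_F[OF U] q_F[OF V]])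
  have g: "?g j \<in> carrier R" if "j \<le> ?N" for j by (rule q_closed[OF s_Y[OF tr_F[OF f that]]])
  have "\<Phi> (hprod n m U V) = (\<Oplus>\<^bsub>P\<^esub>k\<in>{..?N}. \<Phi> (hmonom S k (st_term n m U V k)))"
    unfolding hprod_def
    by (rule additive_map_finsum[OF PM.abelian_group_axioms P.abelian_group_axioms \<Phi>_additive])
      (use st_term_closed[OF U V] S.abelian_monoid_axioms in auto)
  also have "\<dots> = (\<Oplus>\<^bsub>P\<^esub>k\<in>{..?N}. tmon (?g (?N - k)) ?N)"
  proof (rule P.finsum_cong')
    \<comment> \<open>The k-th term carries \<open>h^k\<close> and a symbol of degree
      \<open>?N - k\<close>, so all terms land on the same power of \<open>t\<close>.\<close>
    fix k assume "k \<in> {..?N}"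
    then have k: "k \<le> ?N" by simp
    show "\<Phi> (hmonom S k (st_term n m U V k)) = tmon (?g (?N - k)) ?N"
      unfolding star_term_def \<Phi>_hmonom[OF s_Y[OF star_symbol_F[OF U V k]]] using k by simp
  qed (use g mon_closed in auto)
  also have "\<dots> = tmon (\<Oplus>\<^bsub>R\<^esub>k\<in>{..?N}. ?g (?N - k)) ?N"
    by (rule additive_map_finsum[OF D.abelian_group_axioms P.abelian_group_axioms mon_additive, symmetric])
      (use g in auto)
  \<comment> \<open>The drop k in order is replaced by the order j itself, as \<open>tr_sum\<close>
    is indexed.\<close>
  also have "(\<Oplus>\<^bsub>R\<^esub>k\<in>{..?N}. ?g (?N - k)) = (\<Oplus>\<^bsub>R\<^esub>j\<in>(\<lambda>k. ?N - k) ` {..?N}. ?g j)"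
    by (rule D.finsum_reindex[symmetric]) (use g in \<open>auto simp: inj_on_def\<close>)
  also have "(\<lambda>k. ?N - k) ` {..?N} = {..?N}"
  proof (intro equalityI subsetI)
    fix j assume "j \<in> {..?N}"
    then show "j \<in> (\<lambda>k. ?N - k) ` {..?N}" by (intro image_eqI[of _ _ "?N - j"]) auto
  qed auto
  also have "(\<Oplus>\<^bsub>R\<^esub>j\<in>{..?N}. ?g j) = ?f"
    using tr_sum[OF f order_refl] by (simp add: tr_top)
  finally show ?thesis by (simp only: mon_mult[OF q_closed[OF U] q_closed[OF V]])
qed

lemma \<Phi>_hmonom_0:
  assumes "a \<in> carrier S"
  shows "\<Phi> (hmonom S 0 a) = (\<Oplus>\<^bsub>P\<^esub>n\<in>{n. a n \<noteq> B n}. tmon (q n (a n)) n)"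
proof -
  have "\<Phi> (hmonom S 0 a) = (\<Oplus>\<^bsub>P\<^esub>n\<in>{n. a n \<noteq> B n}. \<Phi> (hmonom S 0 (\<iota> n (a n))))"
    by (rule S_additive_expand[OF P.abelian_group_axioms
        additive_map_comp[OF hmonom_additive[OF S.abelian_group_axioms] \<Phi>_additive] assms])
  also have "\<dots> = (\<Oplus>\<^bsub>P\<^esub>n\<in>{n. a n \<noteq> B n}. tmon (q n (a n)) n)"
    by (rule P.finsum_cong') (use S_Y[OF assms] S_q[OF assms] mon_closed in \<open>auto simp: \<Phi>_hmonom\<close>)
  finally show ?thesis .
qed

lemma formal_prod_closed: "a \<in> carrier S \<Longrightarrow> b \<in> carrier S \<Longrightarrow> formal_prod a b \<in> up S"
  using bilinear_ext_closed[OF PM.abelian_group_axioms, of hprod a b] hprod_closed S_Y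
  by (simp add: formal_prod_def)

lemma \<Phi>_formal_prod:
  assumes a: "a \<in> carrier S" and b: "b \<in> carrier S"
  shows "\<Phi> (formal_prod a b) = \<Phi> (hmonom S 0 a) \<otimes>\<^bsub>P\<^esub> \<Phi> (hmonom S 0 b)"
  unfolding formal_prod_def \<Phi>_hmonom_0[OF a] \<Phi>_hmonom_0[OF b]
proof (rule additive_bilinear_ext[OF PM.abelian_group_axioms P.ring_axioms \<Phi>_additive])
  show "finite {n. a n \<noteq> B n}" "finite {n. b n \<noteq> B n}" using a b by (simp_all add: S_carrier)
  fix n m
  show "hprod n m (a n) (b m) \<in> carrier PM" by (rule hprod_closed[OF S_Y[OF a] S_Y[OF b]])
  show "tmon (q n (a n)) n \<in> carrier P" "tmon (q m (b m)) m \<in> carrier P"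
    by (rule mon_closed[OF S_q[OF a]], rule mon_closed[OF S_q[OF b]])
  show "\<Phi> (hprod n m (a n) (b m)) = tmon (q n (a n)) n \<otimes>\<^bsub>P\<^esub> tmon (q m (b m)) m"
    by (rule \<Phi>_hprod[OF S_Y[OF a] S_Y[OF b]])
qed

section \<open>The formal star algebra\<close>

lemma H_simps:
  "carrier H = up S" "zero H = (\<lambda>i. \<zero>\<^bsub>S\<^esub>)" "add H = add PM" "smult H = smult PM"
  "one H = hmonom S 0 \<one>\<^bsub>S\<^esub>"
  "mult H = bilinear_ext PM (\<lambda>i. \<zero>\<^bsub>S\<^esub>) (\<lambda>i j a b. hshift S (i + j) (formal_prod a b))"
  by (simp_all add: formal_star_algebra_def Let_def formal_prod_def hprod_def[abs_def])

lemma S_one: "\<one>\<^bsub>S\<^esub> = \<iota> 0 (s 0 \<one>\<^bsub>R\<^esub>)"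
  by (simp add: symb_algebra_def)

lemma S_one_closed: "\<one>\<^bsub>S\<^esub> \<in> carrier S"
  unfolding S_one by (rule symb_in_closed[OF s_Y[OF one_Diff_0[OF E_module]]])

lemma H_one_closed: "\<one>\<^bsub>H\<^esub> \<in> up S"
  by (simp add: H_simps S_one_closed S.abelian_monoid_axioms)

lemma \<Phi>_hmonom_one: "\<Phi> (hmonom S i \<one>\<^bsub>S\<^esub>) = tmon \<one>\<^bsub>R\<^esub> i"
  unfolding S_one \<Phi>_hmonom[OF s_Y[OF one_Diff_0[OF E_module]]] q_s_0[OF one_Diff_0[OF E_module]] by simp

lemma \<Phi>_one: "\<Phi> \<one>\<^bsub>H\<^esub> = \<one>\<^bsub>P\<^esub>"
  by (simp only: H_simps \<Phi>_hmonom_one U.monom_one)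

lemma H_mult_closed: "x \<in> up S \<Longrightarrow> y \<in> up S \<Longrightarrow> x \<otimes>\<^bsub>H\<^esub> y \<in> up S"
  unfolding H_simps
  using bilinear_ext_closed[OF PM.abelian_group_axioms,
      of "\<lambda>i j a b. hshift S (i + j) (formal_prod a b)" x y "\<lambda>i. \<zero>\<^bsub>S\<^esub>"]
  by (simp add: formal_prod_closed up_S S.abelian_monoid_axioms)

lemma \<Phi>_mult:
  assumes x: "x \<in> up S" and y: "y \<in> up S"
  shows "\<Phi> (x \<otimes>\<^bsub>H\<^esub> y) = \<Phi> x \<otimes>\<^bsub>P\<^esub> \<Phi> y"
proof -
  let ?f = "\<lambda>i x. tmon \<one>\<^bsub>R\<^esub> i \<otimes>\<^bsub>P\<^esub> \<Phi> (hmonom S 0 x)"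
  note m = mon_closed[OF D.one_closed]
  have h0: "hmonom S 0 a \<in> up S" if "a \<in> carrier S" for a using that S.abelian_monoid_axioms by simp
  have f: "?f i a \<in> carrier P" if "a \<in> carrier S" for i a by (rule P.m_closed[OF m \<Phi>_closed[OF h0[OF that]]])
  have fx: "(\<Oplus>\<^bsub>P\<^esub>i\<in>{i. z i \<noteq> \<zero>\<^bsub>S\<^esub>}. ?f i (z i)) = \<Phi> z" if z: "z \<in> up S" for z
  proof -
    have "\<Phi> (hmonom S i (z i)) = ?f i (z i)" for i
      using \<Phi>_shift(1)[OF h0[OF up_S[OF z, of i]], of i] by (simp add: hshift_hmonom)
    then show ?thesis using PM_additive_expand[OF P.abelian_group_axioms \<Phi>_additive z] by simp
  qed
  have "\<Phi> (x \<otimes>\<^bsub>H\<^esub> y) =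
    (\<Oplus>\<^bsub>P\<^esub>i\<in>{i. x i \<noteq> \<zero>\<^bsub>S\<^esub>}. ?f i (x i)) \<otimes>\<^bsub>P\<^esub> (\<Oplus>\<^bsub>P\<^esub>j\<in>{j. y j \<noteq> \<zero>\<^bsub>S\<^esub>}. ?f j (y j))"
    unfolding H_simps
  proof (rule additive_bilinear_ext[OF PM.abelian_group_axioms P.ring_axioms \<Phi>_additive])
    show "finite {i. x i \<noteq> \<zero>\<^bsub>S\<^esub>}" "finite {i. y i \<noteq> \<zero>\<^bsub>S\<^esub>}" using x y by (simp_all add: up_iff)
    fix i j
    note a = up_S[OF x, of i] and b = up_S[OF y, of j]
    show "hshift S (i + j) (formal_prod (x i) (y j)) \<in> carrier PM"
      using formal_prod_closed[OF a b] S.abelian_monoid_axioms by simp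
    show "?f i (x i) \<in> carrier P" "?f j (y j) \<in> carrier P" using f a b by blast+
    let ?a = "\<Phi> (hmonom S 0 (x i))" and ?b = "\<Phi> (hmonom S 0 (y j))"
    have ac: "?a \<in> carrier P" and bc: "?b \<in> carrier P" using \<Phi>_closed h0 a b by blast+
    \<comment> \<open>\<open>t^j\<close> has to pass the first symbol in order to reach the second;
      this uses the centrality of \<open>t\<close>.\<close>
    have comm: "?a \<otimes>\<^bsub>P\<^esub> tmon \<one>\<^bsub>R\<^esub> j = tmon \<one>\<^bsub>R\<^esub> j \<otimes>\<^bsub>P\<^esub> ?a"
      using \<Phi>_shift[OF h0[OF a], of j] by simp
    have "\<Phi> (hshift S (i + j) (formal_prod (x i) (y j))) = tmon \<one>\<^bsub>R\<^esub> (i + j) \<otimes>\<^bsub>P\<^esub> (?a \<otimes>\<^bsub>P\<^esub> ?b)"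
      by (simp only: \<Phi>_shift(1)[OF formal_prod_closed[OF a b]] \<Phi>_formal_prod[OF a b])
    also have "tmon \<one>\<^bsub>R\<^esub> (i + j) = tmon \<one>\<^bsub>R\<^esub> i \<otimes>\<^bsub>P\<^esub> tmon \<one>\<^bsub>R\<^esub> j"
      using mon_mult[OF D.one_closed D.one_closed, of i j] D.l_one[OF D.one_closed] by (simp only:)
    also have "tmon \<one>\<^bsub>R\<^esub> i \<otimes>\<^bsub>P\<^esub> tmon \<one>\<^bsub>R\<^esub> j \<otimes>\<^bsub>P\<^esub> (?a \<otimes>\<^bsub>P\<^esub> ?b) =
        tmon \<one>\<^bsub>R\<^esub> i \<otimes>\<^bsub>P\<^esub> ((tmon \<one>\<^bsub>R\<^esub> j \<otimes>\<^bsub>P\<^esub> ?a) \<otimes>\<^bsub>P\<^esub> ?b)"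
      using m ac bc by (simp only: P.m_assoc P.m_closed)
    also have "\<dots> = ?f i (x i) \<otimes>\<^bsub>P\<^esub> ?f j (y j)"
      unfolding comm[symmetric] using m ac bc by (simp only: P.m_assoc P.m_closed)
    finally show "\<Phi> (hshift S (i + j) (formal_prod (x i) (y j))) = ?f i (x i) \<otimes>\<^bsub>P\<^esub> ?f j (y j)" .
  qed
  then show ?thesis by (simp only: fx[OF x] fx[OF y])
qed

lemma H_module: "module K H"
  by (rule module_cong[OF PM.module_axioms]) (simp_all add: H_simps)

text \<open>Beyond the module axioms, each law becomes after \<open>\<Phi>\<close> a law of the ring
  of polynomials over \<open>R\<close>, and injectivity brings it back. Scalars turn into constant
  polynomials that commute with the image of \<open>\<Phi>\<close>.\<close>

lemma H_algebra: "assoc_algebra K H"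
proof -
  interpret HM: module K H by (rule H_module)
  have \<Phi>_add: "\<Phi> (x \<oplus>\<^bsub>H\<^esub> y) = \<Phi> x \<oplus>\<^bsub>P\<^esub> \<Phi> y" if "x \<in> up S" "y \<in> up S" for x y
    using additive_map_add[OF \<Phi>_additive, of x y] that by (simp only: H_simps poly_module_simps)
  have \<Phi>_sm: "\<Phi> (c \<odot>\<^bsub>H\<^esub> x) = tmon (c \<odot>\<^bsub>R\<^esub> \<one>\<^bsub>R\<^esub>) 0 \<otimes>\<^bsub>P\<^esub> \<Phi> x"
    "\<Phi> (c \<odot>\<^bsub>H\<^esub> x) = \<Phi> x \<otimes>\<^bsub>P\<^esub> tmon (c \<odot>\<^bsub>R\<^esub> \<one>\<^bsub>R\<^esub>) 0"
    if "c \<in> carrier K" "x \<in> up S" for c x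
    using \<Phi>_smult[OF that] by (simp_all only: H_simps)
  have c: "carrier H = up S" by (rule H_simps(1))
  have ac: "x \<oplus>\<^bsub>H\<^esub> y \<in> up S" if "x \<in> up S" "y \<in> up S" for x y using HM.a_closed that c by blast
  have sc: "k \<odot>\<^bsub>H\<^esub> x \<in> up S" if "k \<in> carrier K" "x \<in> up S" for k x using HM.smult_closed that c by blast
  note cl = ac sc H_mult_closed H_one_closed \<Phi>_closed
  have rg: "ring H"
  proof (rule ringI[OF HM.abelian_group_axioms])
    show "Group.monoid H"
    proof (rule monoidI, unfold c)
      fix x y z assume x: "x \<in> up S" and y: "y \<in> up S" and z: "z \<in> up S"
      show "x \<otimes>\<^bsub>H\<^esub> y \<otimes>\<^bsub>H\<^esub> z = x \<otimes>\<^bsub>H\<^esub> (y \<otimes>\<^bsub>H\<^esub> z)"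
        by (rule \<Phi>_inj) (use x y z in \<open>simp_all only: cl \<Phi>_mult P.m_assoc\<close>)
    next
      fix x assume x: "x \<in> up S"
      show "\<one>\<^bsub>H\<^esub> \<otimes>\<^bsub>H\<^esub> x = x"
        by (rule \<Phi>_inj) (use x in \<open>simp_all only: cl \<Phi>_mult \<Phi>_one P.l_one\<close>)
      show "x \<otimes>\<^bsub>H\<^esub> \<one>\<^bsub>H\<^esub> = x"
        by (rule \<Phi>_inj) (use x in \<open>simp_all only: cl \<Phi>_mult \<Phi>_one P.r_one\<close>)
    qed (rule H_mult_closed H_one_closed; assumption?)+
    fix x y z assume "x \<in> carrier H" "y \<in> carrier H" "z \<in> carrier H"
    then have x: "x \<in> up S" and y: "y \<in> up S" and z: "z \<in> up S" by (simp_all only: c)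
    show "(x \<oplus>\<^bsub>H\<^esub> y) \<otimes>\<^bsub>H\<^esub> z = x \<otimes>\<^bsub>H\<^esub> z \<oplus>\<^bsub>H\<^esub> y \<otimes>\<^bsub>H\<^esub> z"
      by (rule \<Phi>_inj) (use x y z in \<open>simp_all only: cl \<Phi>_mult \<Phi>_add P.l_distr\<close>)
    show "z \<otimes>\<^bsub>H\<^esub> (x \<oplus>\<^bsub>H\<^esub> y) = z \<otimes>\<^bsub>H\<^esub> x \<oplus>\<^bsub>H\<^esub> z \<otimes>\<^bsub>H\<^esub> y"
      by (rule \<Phi>_inj) (use x y z in \<open>simp_all only: cl \<Phi>_mult \<Phi>_add P.r_distr\<close>)
  qed
  show ?thesis
  proof (intro assoc_algebra.intro assoc_algebra_axioms.intro H_module rg)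
    fix k x y assume k: "k \<in> carrier K" and xy: "x \<in> carrier H" "y \<in> carrier H"
    then have x: "x \<in> up S" and y: "y \<in> up S" by (simp_all only: c)
    have m: "tmon (k \<odot>\<^bsub>R\<^esub> \<one>\<^bsub>R\<^esub>) 0 \<in> carrier P"
      by (rule mon_closed) (rule DM.smult_closed[OF k D.one_closed])
    show "(k \<odot>\<^bsub>H\<^esub> x) \<otimes>\<^bsub>H\<^esub> y = k \<odot>\<^bsub>H\<^esub> (x \<otimes>\<^bsub>H\<^esub> y)"
      by (rule \<Phi>_inj) (use k x y m in \<open>simp_all only: cl \<Phi>_mult \<Phi>_sm(1) P.m_assoc\<close>)
    show "x \<otimes>\<^bsub>H\<^esub> (k \<odot>\<^bsub>H\<^esub> y) = k \<odot>\<^bsub>H\<^esub> (x \<otimes>\<^bsub>H\<^esub> y)"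
      by (rule \<Phi>_inj) (use k x y m in \<open>simp_all only: cl \<Phi>_mult \<Phi>_sm(2) P.m_assoc\<close>)
  qed
qed

end

section \<open>Specialisation of the formal parameter\<close>

locale star_point = star_setting K \<Omega> E q
  for K :: "'k ring" and \<Omega> :: "('k, 'w) dga" (structure)
    and E :: "('w, 'e) module" and q :: "nat \<Rightarrow> ('e \<Rightarrow> 'e) set \<Rightarrow> 'e \<Rightarrow> 'e" +
  fixes hbar :: 'k
  assumes hbar: "hbar \<in> carrier K"
begin

sublocale HA: assoc_algebra K "formal_star_algebra K \<Omega> E q" by (rule H_algebra)

abbreviation "SA \<equiv> star_algebra K \<Omega> E q hbar"
abbreviation "hat \<equiv> hmonom S 0"

lemma pow_closed: "hbar [^]\<^bsub>K\<^esub> (k::nat) \<in> carrier K"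
  using hbar by (induction k) auto

text \<open>Evaluation at \<open>h = hbar\<close>. It is visibly linear; that it is multiplicative
  is shown only in \<open>ev_mult\<close>.\<close>

definition ev :: "(nat \<Rightarrow> nat \<Rightarrow> ('e \<Rightarrow> 'e) set) \<Rightarrow> nat \<Rightarrow> ('e \<Rightarrow> 'e) set" where
  "ev x = (\<Oplus>\<^bsub>S\<^esub>i\<in>{i. x i \<noteq> \<zero>\<^bsub>S\<^esub>}. hbar [^]\<^bsub>K\<^esub> i \<odot>\<^bsub>S\<^esub> x i)"

text \<open>Frees the sum from the support of \<open>x\<close>, so that the values of two
  polynomials can be added over a common index set.\<close>

lemma ev_superset:
  assumes "x \<in> up S" "finite A" "{i. x i \<noteq> \<zero>\<^bsub>S\<^esub>} \<subseteq> A"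
  shows "ev x = (\<Oplus>\<^bsub>S\<^esub>i\<in>A. hbar [^]\<^bsub>K\<^esub> i \<odot>\<^bsub>S\<^esub> x i)"
  unfolding ev_def
proof (rule S.add.finprod_mono_neutral_cong_left[OF assms(2,3)])
  fix i assume "i \<in> A - {i. x i \<noteq> \<zero>\<^bsub>S\<^esub>}"
  then show "hbar [^]\<^bsub>K\<^esub> i \<odot>\<^bsub>S\<^esub> x i = \<zero>\<^bsub>S\<^esub>" using S.smult_r_null[OF pow_closed] by simp
qed (use S.smult_closed[OF pow_closed up_S[OF assms(1)]] in auto)

lemma ev_additive: "additive_map PM S ev"
  unfolding additive_map_def
proof (intro conjI ballI funcsetI)
  fix x assume "x \<in> carrier PM"
  then have x: "x \<in> up S" by simp
  have c: "hbar [^]\<^bsub>K\<^esub> i \<odot>\<^bsub>S\<^esub> x i \<in> carrier S" if "x \<in> up S" for i x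
    by (rule S.smult_closed[OF pow_closed up_S[OF that]])
  show "ev x \<in> carrier S" unfolding ev_def by (rule S.finsum_closed) (use c[OF x] in auto)
  fix y assume "y \<in> carrier PM"
  then have y: "y \<in> up S" by simp
  let ?A = "{i. x i \<noteq> \<zero>\<^bsub>S\<^esub>} \<union> {i. y i \<noteq> \<zero>\<^bsub>S\<^esub>}"
  have A: "finite ?A" using x y by (simp add: up_iff)
  have xy: "(\<lambda>i. x i \<oplus>\<^bsub>S\<^esub> y i) \<in> up S" using PM.a_closed[of x y] x y by simp
  have "{i. x i \<oplus>\<^bsub>S\<^esub> y i \<noteq> \<zero>\<^bsub>S\<^esub>} \<subseteq> ?A" by auto
  then have "ev (x \<oplus>\<^bsub>PM\<^esub> y) = (\<Oplus>\<^bsub>S\<^esub>i\<in>?A. hbar [^]\<^bsub>K\<^esub> i \<odot>\<^bsub>S\<^esub> (x i \<oplus>\<^bsub>S\<^esub> y i))"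
    using ev_superset[OF xy A] by simp
  also have "\<dots> = (\<Oplus>\<^bsub>S\<^esub>i\<in>?A. hbar [^]\<^bsub>K\<^esub> i \<odot>\<^bsub>S\<^esub> x i \<oplus>\<^bsub>S\<^esub> hbar [^]\<^bsub>K\<^esub> i \<odot>\<^bsub>S\<^esub> y i)"
    by (simp only: S.smult_r_distr[OF pow_closed up_S[OF x] up_S[OF y]])
  also have "\<dots> = (\<Oplus>\<^bsub>S\<^esub>i\<in>?A. hbar [^]\<^bsub>K\<^esub> i \<odot>\<^bsub>S\<^esub> x i) \<oplus>\<^bsub>S\<^esub> (\<Oplus>\<^bsub>S\<^esub>i\<in>?A. hbar [^]\<^bsub>K\<^esub> i \<odot>\<^bsub>S\<^esub> y i)"
    by (rule S.finsum_addf) (use c[OF x] c[OF y] in auto)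
  also have "\<dots> = ev x \<oplus>\<^bsub>S\<^esub> ev y"
    using ev_superset[OF x A] ev_superset[OF y A] by simp
  finally show "ev (x \<oplus>\<^bsub>PM\<^esub> y) = ev x \<oplus>\<^bsub>S\<^esub> ev y" .
qed

lemma ev_closed: "x \<in> up S \<Longrightarrow> ev x \<in> carrier S"
  using additive_map_closed[OF ev_additive] by simp

lemma hmonom_up: "a \<in> carrier S \<Longrightarrow> hmonom S i a \<in> up S"
  using S.abelian_monoid_axioms by simp

lemma ev_hmonom:
  assumes a: "a \<in> carrier S"
  shows "ev (hmonom S i a) = hbar [^]\<^bsub>K\<^esub> i \<odot>\<^bsub>S\<^esub> a"
proof -
  have "ev (hmonom S i a) = (\<Oplus>\<^bsub>S\<^esub>j\<in>{i}. hbar [^]\<^bsub>K\<^esub> j \<odot>\<^bsub>S\<^esub> hmonom S i a j)"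
    by (rule ev_superset[OF hmonom_up[OF a]]) (auto simp: hmonom_def)
  also have "\<dots> = hbar [^]\<^bsub>K\<^esub> i \<odot>\<^bsub>S\<^esub> a"
    using S.smult_closed[OF pow_closed a] by (simp add: hmonom_def)
  finally show ?thesis .
qed

lemma ev_hat: "a \<in> carrier S \<Longrightarrow> ev (hat a) = a"
  by (simp add: ev_hmonom)

lemma smult_hmonom: "c \<in> carrier K \<Longrightarrow> c \<odot>\<^bsub>PM\<^esub> hmonom S i a = hmonom S i (c \<odot>\<^bsub>S\<^esub> a)"
  by (auto simp: hmonom_def fun_eq_iff)

lemma S_smult_additive: "c \<in> carrier K \<Longrightarrow> additive_map S S (\<lambda>a. c \<odot>\<^bsub>S\<^esub> a)"
  unfolding additive_map_def using S.smult_closed S.smult_r_distr by blast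

lemma smult_pow_comm:
  assumes "c \<in> carrier K" "d \<in> carrier K" "a \<in> carrier S"
  shows "c \<odot>\<^bsub>S\<^esub> (d \<odot>\<^bsub>S\<^esub> a) = d \<odot>\<^bsub>S\<^esub> (c \<odot>\<^bsub>S\<^esub> a)"
  using S.smult_assoc1[OF assms] S.smult_assoc1[OF assms(2,1,3)] R.m_comm[OF assms(1,2)] by simp

lemma ev_smult:
  assumes c: "c \<in> carrier K" and x: "x \<in> up S"
  shows "ev (c \<odot>\<^bsub>PM\<^esub> x) = c \<odot>\<^bsub>S\<^esub> ev x"
proof (rule PM_additive_eqI[OF S.abelian_group_axioms additive_map_comp[OF PM_smult_additive[OF c] ev_additive]
      additive_map_comp[OF ev_additive S_smult_additive[OF c]] _ x])
  fix i n :: nat and U assume U: "U \<in> Y n"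
  show "ev (c \<odot>\<^bsub>PM\<^esub> hmonom S i (\<iota> n U)) = c \<odot>\<^bsub>S\<^esub> ev (hmonom S i (\<iota> n U))"
    using symb_in_closed[OF U] c
    by (simp only: smult_hmonom ev_hmonom S_closed smult_pow_comm[OF pow_closed])
qed

lemma ev_hshift:
  assumes x: "x \<in> up S"
  shows "ev (hshift S 1 x) = hbar \<odot>\<^bsub>S\<^esub> ev x"
proof (rule PM_additive_eqI[OF S.abelian_group_axioms
      additive_map_comp[OF hshift_additive[OF S.abelian_group_axioms] ev_additive]
      additive_map_comp[OF ev_additive S_smult_additive[OF hbar]] _ x])
  fix i n :: nat and U assume U: "U \<in> Y n"
  have "hbar [^]\<^bsub>K\<^esub> (1 + i) \<odot>\<^bsub>S\<^esub> \<iota> n U = hbar \<odot>\<^bsub>S\<^esub> (hbar [^]\<^bsub>K\<^esub> i \<odot>\<^bsub>S\<^esub> \<iota> n U)"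
    using S.smult_assoc1[OF hbar pow_closed symb_in_closed[OF U], of i] R.m_comm[OF hbar pow_closed, of i]
    by simp
  then show "ev (hshift S 1 (hmonom S i (\<iota> n U))) = hbar \<odot>\<^bsub>S\<^esub> ev (hmonom S i (\<iota> n U))"
    by (simp only: hshift_hmonom ev_hmonom[OF symb_in_closed[OF U]])
qed

text \<open>The algebra structures of \<open>H\<close> and \<open>poly_module S\<close> differ, but they have the same addition.\<close>

lemma H_carrier: "carrier H = up S"
  by (rule H_simps(1))

lemma ev_H:
  "x \<in> up S \<Longrightarrow> y \<in> up S \<Longrightarrow> ev (x \<oplus>\<^bsub>H\<^esub> y) = ev x \<oplus>\<^bsub>S\<^esub> ev y"
  "c \<in> carrier K \<Longrightarrow> x \<in> up S \<Longrightarrow> ev (c \<odot>\<^bsub>H\<^esub> x) = c \<odot>\<^bsub>S\<^esub> ev x"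
  using additive_map_add[OF ev_additive, of x y] ev_smult by (simp_all only: H_simps poly_module_simps)

lemma ev_H_additive: "additive_map H S ev"
  unfolding additive_map_def using ev_H(1) ev_closed by (simp add: H_carrier)

lemma ev_H_minus: "x \<in> up S \<Longrightarrow> ev (\<ominus>\<^bsub>H\<^esub> x) = \<ominus>\<^bsub>S\<^esub> ev x"
  using additive_map_a_inv[OF HA.abelian_group_axioms S.abelian_group_axioms ev_H_additive, of x]
  by (simp add: H_carrier)

lemma H_closed:
  "x \<in> up S \<Longrightarrow> y \<in> up S \<Longrightarrow> x \<oplus>\<^bsub>H\<^esub> y \<in> up S" "x \<in> up S \<Longrightarrow> y \<in> up S \<Longrightarrow> x \<otimes>\<^bsub>H\<^esub> y \<in> up S"
  "c \<in> carrier K \<Longrightarrow> x \<in> up S \<Longrightarrow> c \<odot>\<^bsub>H\<^esub> x \<in> up S" "x \<in> up S \<Longrightarrow> \<ominus>\<^bsub>H\<^esub> x \<in> up S" "\<one>\<^bsub>H\<^esub> \<in> up S"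
  using HA.a_closed[of x y] HA.m_closed[of x y] HA.smult_closed[of c x] HA.a_inv_closed[of x] HA.one_closed
  by (simp_all only: H_carrier)

section \<open>The element h - hbar and reduction modulo it\<close>

abbreviation "\<eta> \<equiv> h_minus K \<Omega> E q hbar"

lemma eta_def: "\<eta> = hmonom S 1 \<one>\<^bsub>S\<^esub> \<oplus>\<^bsub>H\<^esub> \<ominus>\<^bsub>H\<^esub> (hbar \<odot>\<^bsub>H\<^esub> \<one>\<^bsub>H\<^esub>)"
  by (simp only: h_minus_def Let_def a_minus_def)

lemma eta_closed: "\<eta> \<in> up S"
  unfolding eta_def by (intro H_closed hmonom_up S_one_closed hbar)

text \<open>The product of \<open>H\<close> is a nested sum over supports. Both formulas are instead
  read off after \<open>\<Phi>\<close>, where they express multiplication by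
  \<open>t\<close>.\<close>

lemma h_mult:
  assumes x: "x \<in> up S"
  shows "hmonom S 1 \<one>\<^bsub>S\<^esub> \<otimes>\<^bsub>H\<^esub> x = hshift S 1 x" "x \<otimes>\<^bsub>H\<^esub> hmonom S 1 \<one>\<^bsub>S\<^esub> = hshift S 1 x"
proof -
  note h = hmonom_up[OF S_one_closed, of 1]
  have sh: "hshift S 1 x \<in> up S" using x S.abelian_monoid_axioms by simp
  show "hmonom S 1 \<one>\<^bsub>S\<^esub> \<otimes>\<^bsub>H\<^esub> x = hshift S 1 x"
    by (rule \<Phi>_inj[OF H_closed(2)[OF h x] sh])
      (simp only: \<Phi>_mult[OF h x] \<Phi>_hmonom_one \<Phi>_shift(1)[OF x])
  show "x \<otimes>\<^bsub>H\<^esub> hmonom S 1 \<one>\<^bsub>S\<^esub> = hshift S 1 x"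
    by (rule \<Phi>_inj[OF H_closed(2)[OF x h] sh])
      (simp only: \<Phi>_mult[OF x h] \<Phi>_hmonom_one \<Phi>_shift(2)[OF x])
qed

text \<open>Both \<open>h\<close> and the scalars are central, hence so is \<open>h - hbar\<close>,
  and its multiples already form the two-sided ideal that it generates.\<close>

lemma eta_mult:
  assumes x: "x \<in> up S"
  shows "\<eta> \<otimes>\<^bsub>H\<^esub> x = hshift S 1 x \<oplus>\<^bsub>H\<^esub> \<ominus>\<^bsub>H\<^esub> (hbar \<odot>\<^bsub>H\<^esub> x)" "x \<otimes>\<^bsub>H\<^esub> \<eta> = \<eta> \<otimes>\<^bsub>H\<^esub> x"
proof -
  have h: "hmonom S 1 \<one>\<^bsub>S\<^esub> \<in> carrier H" and xc: "x \<in> carrier H" and o: "hbar \<odot>\<^bsub>H\<^esub> \<one>\<^bsub>H\<^esub> \<in> carrier H"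
    using hmonom_up[OF S_one_closed] x H_closed(3)[OF hbar H_closed(5)] by (simp_all only: H_carrier)
  have l: "(hbar \<odot>\<^bsub>H\<^esub> \<one>\<^bsub>H\<^esub>) \<otimes>\<^bsub>H\<^esub> x = hbar \<odot>\<^bsub>H\<^esub> x" and r: "x \<otimes>\<^bsub>H\<^esub> (hbar \<odot>\<^bsub>H\<^esub> \<one>\<^bsub>H\<^esub>) = hbar \<odot>\<^bsub>H\<^esub> x"
    using HA.smult_mult_left[OF hbar HA.one_closed xc] HA.smult_mult_right[OF hbar xc HA.one_closed]
      HA.l_one[OF xc] HA.r_one[OF xc] by (simp_all only:)
  show e: "\<eta> \<otimes>\<^bsub>H\<^esub> x = hshift S 1 x \<oplus>\<^bsub>H\<^esub> \<ominus>\<^bsub>H\<^esub> (hbar \<odot>\<^bsub>H\<^esub> x)"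
    unfolding eta_def using h xc o by (simp only: HA.l_distr HA.a_inv_closed HA.l_minus l h_mult(1)[OF x])
  show "x \<otimes>\<^bsub>H\<^esub> \<eta> = \<eta> \<otimes>\<^bsub>H\<^esub> x"
    unfolding e unfolding eta_def
    using h xc o by (simp only: HA.r_distr HA.a_inv_closed HA.r_minus r h_mult(2)[OF x])
qed

lemma ev_eta_mult:
  assumes x: "x \<in> up S"
  shows "ev (\<eta> \<otimes>\<^bsub>H\<^esub> x) = \<zero>\<^bsub>S\<^esub>"
proof -
  have sh: "hshift S 1 x \<in> up S" using x S.abelian_monoid_axioms by simp
  show ?thesis
    unfolding eta_mult(1)[OF x] ev_H(1)[OF sh H_closed(4)[OF H_closed(3)[OF hbar x]]]
      ev_H_minus[OF H_closed(3)[OF hbar x]] ev_H(2)[OF hbar x] ev_hshift[OF x]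
    by (rule S.r_neg) (rule S.smult_closed[OF hbar ev_closed[OF x]])
qed

text \<open>Modulo \<open>h - hbar\<close> every polynomial is congruent to its value at \<open>hbar\<close>.\<close>

definition reducible :: "(nat \<Rightarrow> nat \<Rightarrow> ('e \<Rightarrow> 'e) set) \<Rightarrow> bool" where
  "reducible x \<longleftrightarrow> x \<in> up S \<and> (\<exists>z\<in>up S. x = hat (ev x) \<oplus>\<^bsub>H\<^esub> \<eta> \<otimes>\<^bsub>H\<^esub> z)"

lemma hat_add: "a \<in> carrier S \<Longrightarrow> b \<in> carrier S \<Longrightarrow> hat (a \<oplus>\<^bsub>S\<^esub> b) = hat a \<oplus>\<^bsub>H\<^esub> hat b"
  using additive_map_add[OF hmonom_additive[OF S.abelian_group_axioms], of a b 0] by (simp only: H_simps)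

lemma hat_smult: "c \<in> carrier K \<Longrightarrow> hat (c \<odot>\<^bsub>S\<^esub> a) = c \<odot>\<^bsub>H\<^esub> hat a"
  using smult_hmonom[of c 0 a] by (simp only: H_simps)

lemma reducible_add:
  assumes "reducible x" "reducible y"
  shows "reducible (x \<oplus>\<^bsub>H\<^esub> y)"
proof -
  obtain z w where x: "x \<in> up S" and z: "z \<in> up S" "x = hat (ev x) \<oplus>\<^bsub>H\<^esub> \<eta> \<otimes>\<^bsub>H\<^esub> z"
    and y: "y \<in> up S" and w: "w \<in> up S" "y = hat (ev y) \<oplus>\<^bsub>H\<^esub> \<eta> \<otimes>\<^bsub>H\<^esub> w"
    using assms unfolding reducible_def by blast
  note ec = ev_closed[OF x] ev_closed[OF y]
  have c: "hat (ev x) \<in> carrier H" "hat (ev y) \<in> carrier H" "\<eta> \<in> carrier H" "z \<in> carrier H" "w \<in> carrier H"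
    using hmonom_up ec eta_closed z w by (simp_all only: H_carrier)
  have "x \<oplus>\<^bsub>H\<^esub> y = (hat (ev x) \<oplus>\<^bsub>H\<^esub> \<eta> \<otimes>\<^bsub>H\<^esub> z) \<oplus>\<^bsub>H\<^esub> (hat (ev y) \<oplus>\<^bsub>H\<^esub> \<eta> \<otimes>\<^bsub>H\<^esub> w)"
    using z(2) w(2) by simp
  also have "\<dots> = (hat (ev x) \<oplus>\<^bsub>H\<^esub> hat (ev y)) \<oplus>\<^bsub>H\<^esub> \<eta> \<otimes>\<^bsub>H\<^esub> (z \<oplus>\<^bsub>H\<^esub> w)"
    using c by (simp only: HA.r_distr HA.a_ac HA.m_closed HA.a_closed)
  also have "hat (ev x) \<oplus>\<^bsub>H\<^esub> hat (ev y) = hat (ev (x \<oplus>\<^bsub>H\<^esub> y))"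
    by (simp only: hat_add[OF ec] ev_H(1)[OF x y])
  finally show ?thesis unfolding reducible_def using H_closed(1) x y z w by blast
qed

text \<open>Division by \<open>h - hbar\<close> in the manner of Horner:
  \<open>h^(i+1) a = (h - hbar) h^i a + hbar h^i a\<close>, where the last summand is reducible by
  induction. The new quotient is \<open>h^i a + hbar z\<close>.\<close>

lemma reducible_hmonom:
  assumes a: "a \<in> carrier S"
  shows "reducible (hmonom S i a)"
proof (induction i)
  case 0
  have z: "\<zero>\<^bsub>H\<^esub> \<in> up S" using HA.zero_closed by (simp only: H_carrier)
  have "hat a = hat (ev (hat a)) \<oplus>\<^bsub>H\<^esub> \<eta> \<otimes>\<^bsub>H\<^esub> \<zero>\<^bsub>H\<^esub>"
    using HA.r_null[of \<eta>] HA.r_zero[of "hat a"] eta_closed hmonom_up[OF a] by (simp only: ev_hat[OF a] H_carrier)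
  then show ?case unfolding reducible_def using z hmonom_up[OF a] by blast
next
  case (Suc i)
  let ?x = "hmonom S i a"
  note x = hmonom_up[OF a, of i]
  obtain z where z: "z \<in> up S" "?x = hat (ev ?x) \<oplus>\<^bsub>H\<^esub> \<eta> \<otimes>\<^bsub>H\<^esub> z"
    using Suc unfolding reducible_def by blast
  have c: "?x \<in> carrier H" "\<eta> \<in> carrier H" "z \<in> carrier H" "hat (ev ?x) \<in> carrier H"
    using x eta_closed z hmonom_up[OF ev_closed[OF x]] by (simp_all only: H_carrier)
  note hc = HA.smult_closed[OF hbar]
  have sh: "hshift S 1 ?x = hmonom S (Suc i) a" by (simp add: hshift_hmonom)
  then have shc: "hmonom S (Suc i) a \<in> carrier H" using hmonom_up[OF a] by (simp only: H_carrier)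
  have "hmonom S (Suc i) a = \<eta> \<otimes>\<^bsub>H\<^esub> ?x \<oplus>\<^bsub>H\<^esub> hbar \<odot>\<^bsub>H\<^esub> ?x"
    unfolding eta_mult(1)[OF x] sh using shc hc[OF c(1)]
    by (simp only: HA.a_assoc HA.a_inv_closed HA.l_neg HA.r_zero)
  also have "hbar \<odot>\<^bsub>H\<^esub> ?x = hbar \<odot>\<^bsub>H\<^esub> (hat (ev ?x) \<oplus>\<^bsub>H\<^esub> \<eta> \<otimes>\<^bsub>H\<^esub> z)" using z(2) by simp
  also have "\<dots> = hbar \<odot>\<^bsub>H\<^esub> hat (ev ?x) \<oplus>\<^bsub>H\<^esub> \<eta> \<otimes>\<^bsub>H\<^esub> (hbar \<odot>\<^bsub>H\<^esub> z)"
    unfolding HA.smult_mult_right[OF hbar c(2,3)] by (rule HA.smult_r_distr[OF hbar c(4) HA.m_closed[OF c(2,3)]])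
  also have "\<eta> \<otimes>\<^bsub>H\<^esub> ?x \<oplus>\<^bsub>H\<^esub> (hbar \<odot>\<^bsub>H\<^esub> hat (ev ?x) \<oplus>\<^bsub>H\<^esub> \<eta> \<otimes>\<^bsub>H\<^esub> (hbar \<odot>\<^bsub>H\<^esub> z)) =
      hbar \<odot>\<^bsub>H\<^esub> hat (ev ?x) \<oplus>\<^bsub>H\<^esub> \<eta> \<otimes>\<^bsub>H\<^esub> (?x \<oplus>\<^bsub>H\<^esub> hbar \<odot>\<^bsub>H\<^esub> z)"
    using c hc by (simp only: HA.r_distr HA.a_ac HA.m_closed HA.a_closed)
  also have "hbar \<odot>\<^bsub>H\<^esub> hat (ev ?x) = hat (ev (hmonom S (Suc i) a))"
    using ev_hshift[OF x] by (simp only: sh hat_smult[OF hbar])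
  finally have "hmonom S (Suc i) a =
      hat (ev (hmonom S (Suc i) a)) \<oplus>\<^bsub>H\<^esub> \<eta> \<otimes>\<^bsub>H\<^esub> (?x \<oplus>\<^bsub>H\<^esub> hbar \<odot>\<^bsub>H\<^esub> z)" .
  moreover have "?x \<oplus>\<^bsub>H\<^esub> hbar \<odot>\<^bsub>H\<^esub> z \<in> up S" by (intro H_closed x z(1) hbar)
  ultimately show ?case unfolding reducible_def using hmonom_up[OF a] by blast
qed

lemma reducible:
  assumes x: "x \<in> up S"
  shows "reducible x"
proof -
  have fin: "finite {i. x i \<noteq> \<zero>\<^bsub>S\<^esub>}" using x by (simp add: up_iff)
  have "reducible (\<Oplus>\<^bsub>H\<^esub>i\<in>A. hmonom S i (x i))" if "finite A" for A
    using that
  proof (induction A)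
    case empty
    have "\<zero>\<^bsub>H\<^esub> = hmonom S 0 \<zero>\<^bsub>S\<^esub>" unfolding H_simps by (auto simp: hmonom_def)
    then show ?case using reducible_hmonom[OF S.zero_closed, of 0] by (simp only: HA.finsum_empty)
  next
    case (insert i A)
    have "(\<lambda>i. hmonom S i (x i)) \<in> A \<rightarrow> carrier H" "hmonom S i (x i) \<in> carrier H"
      using hmonom_up up_S[OF x] by (auto simp: H_carrier)
    then show ?case
      using reducible_add[OF reducible_hmonom[OF up_S[OF x]] insert.IH] HA.finsum_insert[OF insert.hyps]
      by (simp only:)
  qed
  from this[OF fin] have "reducible (\<Oplus>\<^bsub>H\<^esub>i\<in>{i. x i \<noteq> \<zero>\<^bsub>S\<^esub>}. hmonom S i (x i))" .
  moreover have "x = (\<Oplus>\<^bsub>H\<^esub>i\<in>{i. x i \<noteq> \<zero>\<^bsub>S\<^esub>}. hmonom S i (x i))"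
  proof -
    have "finsum H f A = finsum PM f A" for f :: "nat \<Rightarrow> nat \<Rightarrow> nat \<Rightarrow> ('e \<Rightarrow> 'e) set" and A
      by (rule finsum_add_monoid) (simp_all only: H_simps poly_module_simps)
    from this[symmetric] show ?thesis by (rule HOL.trans[OF poly_decomp[OF S_module x fin subset_refl]])
  qed
  ultimately show ?thesis by (rule ssubst[rotated])
qed

section \<open>The star product at a point\<close>

lemma SA_simps:
  "carrier SA = carrier S" "zero SA = zero S" "add SA = add S" "smult SA = smult S" "one SA = one S"
  "mult SA = bilinear_ext S (\<lambda>n. B n)
    (\<lambda>n m U V. \<Oplus>\<^bsub>S\<^esub>k\<in>{..n + m}. hbar [^]\<^bsub>K\<^esub> k \<odot>\<^bsub>S\<^esub> st_term n m U V k)"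
  by (simp_all add: star_algebra_def)

definition sprod where
  "sprod n m U V = (\<Oplus>\<^bsub>S\<^esub>k\<in>{..n + m}. hbar [^]\<^bsub>K\<^esub> k \<odot>\<^bsub>S\<^esub> st_term n m U V k)"

lemma ev_hprod:
  assumes U: "U \<in> Y n" and V: "V \<in> Y m"
  shows "ev (hprod n m U V) = sprod n m U V"
proof -
  note c = st_term_closed[OF U V]
  have "ev (hprod n m U V) = (\<Oplus>\<^bsub>S\<^esub>k\<in>{..n + m}. ev (hmonom S k (st_term n m U V k)))"
    unfolding hprod_def
    by (rule additive_map_finsum[OF PM.abelian_group_axioms S.abelian_group_axioms ev_additive])
      (use c hmonom_up in auto)
  also have "\<dots> = sprod n m U V"
    unfolding sprod_def
    by (rule S.finsum_cong') (use c ev_hmonom S.smult_closed[OF pow_closed] in auto)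
  finally show ?thesis .
qed

lemma sprod_closed: "U \<in> Y n \<Longrightarrow> V \<in> Y m \<Longrightarrow> sprod n m U V \<in> carrier S"
  using ev_closed hprod_closed by (simp flip: ev_hprod)

text \<open>Evaluation commutes with finite sums and replaces \<open>h^k\<close> by
  \<open>hbar^k\<close>, which turns each summand of the formal product into one of the star
  product.\<close>

lemma star_formal_prod:
  assumes a: "a \<in> carrier S" and b: "b \<in> carrier S"
  shows "a \<otimes>\<^bsub>SA\<^esub> b = ev (formal_prod a b)"
proof -
  let ?A = "{n. a n \<noteq> B n}" and ?B = "{m. b m \<noteq> B m}"
  note Ya = S_Y[OF a] and Yb = S_Y[OF b]
  have hc: "hprod n m (a n) (b m) \<in> carrier PM" for n m by (rule hprod_closed[OF Ya Yb])
  note ef = additive_map_finsum[OF PM.abelian_group_axioms S.abelian_group_axioms ev_additive]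
  have "ev (formal_prod a b) = (\<Oplus>\<^bsub>S\<^esub>n\<in>?A. ev (\<Oplus>\<^bsub>PM\<^esub>m\<in>?B. hprod n m (a n) (b m)))"
    unfolding formal_prod_def bilinear_ext_def
    by (rule ef) (use hc in \<open>blast intro: PM.finsum_closed\<close>)
  also have "\<dots> = (\<Oplus>\<^bsub>S\<^esub>n\<in>?A. \<Oplus>\<^bsub>S\<^esub>m\<in>?B. ev (hprod n m (a n) (b m)))"
    using ef[of "\<lambda>m. hprod _ m (a _) (b m)" ?B] hc
    by (intro S.finsum_cong') (auto intro!: ef S.finsum_closed simp: ev_hprod[OF Ya Yb] sprod_closed[OF Ya Yb])
  also have "\<dots> = bilinear_ext S (\<lambda>n. B n) sprod a b"
    unfolding bilinear_ext_def by (simp only: ev_hprod[OF Ya Yb])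
  finally show ?thesis unfolding SA_simps sprod_def[abs_def] by simp
qed

text \<open>Identifies the inner extension with the product in \<open>H\<close> of polynomials
  constant in \<open>h\<close>; \<open>\<Phi>\<close> takes the same value on both.\<close>

lemma formal_prod_hat:
  assumes a: "a \<in> carrier S" and b: "b \<in> carrier S"
  shows "formal_prod a b = hat a \<otimes>\<^bsub>H\<^esub> hat b"
  by (rule \<Phi>_inj[OF formal_prod_closed[OF a b] H_closed(2)[OF hmonom_up[OF a] hmonom_up[OF b]]])
    (simp only: \<Phi>_formal_prod[OF a b] \<Phi>_mult[OF hmonom_up[OF a] hmonom_up[OF b]])

lemma star_hat: "a \<in> carrier S \<Longrightarrow> b \<in> carrier S \<Longrightarrow> a \<otimes>\<^bsub>SA\<^esub> b = ev (hat a \<otimes>\<^bsub>H\<^esub> hat b)"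
  by (simp only: star_formal_prod formal_prod_hat)

text \<open>Both factors are replaced by their values modulo \<open>\<eta>\<close>. Centrality moves
  every \<open>\<eta>\<close> to the front, where evaluation kills it, and the remaining product of
  two constants is \<open>star_hat\<close>.\<close>

lemma ev_mult:
  assumes x: "x \<in> up S" and y: "y \<in> up S"
  shows "ev (x \<otimes>\<^bsub>H\<^esub> y) = ev x \<otimes>\<^bsub>SA\<^esub> ev y"
proof -
  obtain z where z: "z \<in> up S" "x = hat (ev x) \<oplus>\<^bsub>H\<^esub> \<eta> \<otimes>\<^bsub>H\<^esub> z"
    using reducible[OF x] unfolding reducible_def by blast
  obtain w where w: "w \<in> up S" "y = hat (ev y) \<oplus>\<^bsub>H\<^esub> \<eta> \<otimes>\<^bsub>H\<^esub> w"
    using reducible[OF y] unfolding reducible_def by blast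
  let ?x = "hat (ev x)" and ?y = "hat (ev y)"
  note xu = hmonom_up[OF ev_closed[OF x], of 0] and yu = hmonom_up[OF ev_closed[OF y], of 0]
  have c: "?x \<in> carrier H" "?y \<in> carrier H" "\<eta> \<in> carrier H" "z \<in> carrier H" "w \<in> carrier H" "y \<in> carrier H"
    using xu yu eta_closed z(1) w(1) y by (simp_all only: H_carrier)
  have 1: "x \<otimes>\<^bsub>H\<^esub> y = ?x \<otimes>\<^bsub>H\<^esub> y \<oplus>\<^bsub>H\<^esub> \<eta> \<otimes>\<^bsub>H\<^esub> (z \<otimes>\<^bsub>H\<^esub> y)"
    by (subst (1) z(2)) (use c in \<open>simp only: HA.l_distr HA.m_assoc HA.m_closed\<close>)
  have 2: "?x \<otimes>\<^bsub>H\<^esub> y = ?x \<otimes>\<^bsub>H\<^esub> ?y \<oplus>\<^bsub>H\<^esub> \<eta> \<otimes>\<^bsub>H\<^esub> (?x \<otimes>\<^bsub>H\<^esub> w)"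
  proof -
    have "?x \<otimes>\<^bsub>H\<^esub> y = ?x \<otimes>\<^bsub>H\<^esub> ?y \<oplus>\<^bsub>H\<^esub> (?x \<otimes>\<^bsub>H\<^esub> \<eta>) \<otimes>\<^bsub>H\<^esub> w"
      by (subst (1) w(2)) (use c in \<open>simp only: HA.r_distr HA.m_assoc HA.m_closed\<close>)
    also have "(?x \<otimes>\<^bsub>H\<^esub> \<eta>) \<otimes>\<^bsub>H\<^esub> w = \<eta> \<otimes>\<^bsub>H\<^esub> (?x \<otimes>\<^bsub>H\<^esub> w)"
      unfolding eta_mult(2)[OF xu] by (rule HA.m_assoc[OF c(3,1,5)])
    finally show ?thesis .
  qed
  have e: "ev (u \<oplus>\<^bsub>H\<^esub> \<eta> \<otimes>\<^bsub>H\<^esub> v) = ev u" if "u \<in> up S" "v \<in> up S" for u v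
    using ev_H(1)[OF that(1) H_closed(2)[OF eta_closed that(2)]] ev_eta_mult[OF that(2)]
      S.r_zero[OF ev_closed[OF that(1)]] by (simp only:)
  have "ev (x \<otimes>\<^bsub>H\<^esub> y) = ev (?x \<otimes>\<^bsub>H\<^esub> y)"
    unfolding 1 by (rule e[OF H_closed(2)[OF xu y] H_closed(2)[OF z(1) y]])
  also have "\<dots> = ev (?x \<otimes>\<^bsub>H\<^esub> ?y)"
    unfolding 2 by (rule e[OF H_closed(2)[OF xu yu] H_closed(2)[OF xu w(1)]])
  finally show ?thesis by (simp only: star_hat[OF ev_closed[OF x] ev_closed[OF y]])
qed

lemma SA_module: "module K SA"
  by (rule module_cong[OF S_module]) (simp_all only: SA_simps)

lemma ev_one: "ev \<one>\<^bsub>H\<^esub> = \<one>\<^bsub>SA\<^esub>"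
  by (simp only: H_simps SA_simps ev_hat[OF S_one_closed])

text \<open>The axioms are pushed forward from \<open>H\<close> along the surjection
  \<open>ev\<close>, for which \<open>hat\<close> provides preimages. This works for every hbar,
  zero divisors included.\<close>

lemma SA_algebra: "assoc_algebra K SA"
proof -
  interpret SM: module K SA by (rule SA_module)
  have c: "carrier SA = carrier S" by (rule SA_simps)
  have mc: "a \<otimes>\<^bsub>SA\<^esub> b \<in> carrier S" if "a \<in> carrier S" "b \<in> carrier S" for a b
    using that by (simp only: star_hat) (intro ev_closed H_closed hmonom_up)
  have add: "ev (x \<oplus>\<^bsub>H\<^esub> y) = ev x \<oplus>\<^bsub>SA\<^esub> ev y" if "x \<in> up S" "y \<in> up S" for x y
    using ev_H(1)[OF that] by (simp only: SA_simps)
  have sm: "ev (k \<odot>\<^bsub>H\<^esub> x) = k \<odot>\<^bsub>SA\<^esub> ev x" if "k \<in> carrier K" "x \<in> up S" for k x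
    using ev_H(2)[OF that] by (simp only: SA_simps)
  note r = ev_mult[symmetric] add[symmetric] sm[symmetric] ev_one[symmetric] H_closed
  have lift: "\<exists>x\<in>up S. a = ev x" if "a \<in> carrier S" for a
    using ev_hat[OF that] hmonom_up[OF that] by metis
  have rg: "ring SA"
  proof (rule ringI[OF SM.abelian_group_axioms])
    show "Group.monoid SA"
    proof (rule monoidI, unfold c)
      show "\<And>a b. a \<in> carrier S \<Longrightarrow> b \<in> carrier S \<Longrightarrow> a \<otimes>\<^bsub>SA\<^esub> b \<in> carrier S" by (rule mc)
      show "\<one>\<^bsub>SA\<^esub> \<in> carrier S" by (simp only: SA_simps S_one_closed)
      fix a b d assume "a \<in> carrier S" "b \<in> carrier S" "d \<in> carrier S"
      then obtain x y z where x: "x \<in> up S" "a = ev x" and y: "y \<in> up S" "b = ev y" and z: "z \<in> up S" "d = ev z"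
        using lift by metis
      have "(x \<otimes>\<^bsub>H\<^esub> y) \<otimes>\<^bsub>H\<^esub> z = x \<otimes>\<^bsub>H\<^esub> (y \<otimes>\<^bsub>H\<^esub> z)"
        by (rule HA.m_assoc) (use x y z in \<open>simp_all only: H_carrier\<close>)
      then show "a \<otimes>\<^bsub>SA\<^esub> b \<otimes>\<^bsub>SA\<^esub> d = a \<otimes>\<^bsub>SA\<^esub> (b \<otimes>\<^bsub>SA\<^esub> d)" using x y z by (simp only: r)
    next
      fix a assume "a \<in> carrier S"
      then obtain x where x: "x \<in> up S" "a = ev x" using lift by metis
      have "\<one>\<^bsub>H\<^esub> \<otimes>\<^bsub>H\<^esub> x = x" "x \<otimes>\<^bsub>H\<^esub> \<one>\<^bsub>H\<^esub> = x"
        using HA.l_one[of x] HA.r_one[of x] x(1) by (simp_all only: H_carrier)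
      then show "\<one>\<^bsub>SA\<^esub> \<otimes>\<^bsub>SA\<^esub> a = a" "a \<otimes>\<^bsub>SA\<^esub> \<one>\<^bsub>SA\<^esub> = a" using x by (simp_all only: r)
    qed
    fix a b d assume "a \<in> carrier SA" "b \<in> carrier SA" "d \<in> carrier SA"
    then obtain x y z where x: "x \<in> up S" "a = ev x" and y: "y \<in> up S" "b = ev y" and z: "z \<in> up S" "d = ev z"
      using lift unfolding c by metis
    have "(x \<oplus>\<^bsub>H\<^esub> y) \<otimes>\<^bsub>H\<^esub> z = x \<otimes>\<^bsub>H\<^esub> z \<oplus>\<^bsub>H\<^esub> y \<otimes>\<^bsub>H\<^esub> z" "z \<otimes>\<^bsub>H\<^esub> (x \<oplus>\<^bsub>H\<^esub> y) = z \<otimes>\<^bsub>H\<^esub> x \<oplus>\<^bsub>H\<^esub> z \<otimes>\<^bsub>H\<^esub> y"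
      using HA.l_distr[of x y z] HA.r_distr[of x y z] x(1) y(1) z(1) by (simp_all only: H_carrier)
    then show "(a \<oplus>\<^bsub>SA\<^esub> b) \<otimes>\<^bsub>SA\<^esub> d = a \<otimes>\<^bsub>SA\<^esub> d \<oplus>\<^bsub>SA\<^esub> b \<otimes>\<^bsub>SA\<^esub> d"
      "d \<otimes>\<^bsub>SA\<^esub> (a \<oplus>\<^bsub>SA\<^esub> b) = d \<otimes>\<^bsub>SA\<^esub> a \<oplus>\<^bsub>SA\<^esub> d \<otimes>\<^bsub>SA\<^esub> b"
      using x y z by (simp_all only: r)
  qed
  show ?thesis
  proof (intro assoc_algebra.intro assoc_algebra_axioms.intro SA_module rg)
    fix k a b assume k: "k \<in> carrier K" and "a \<in> carrier SA" "b \<in> carrier SA"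
    then obtain x y where x: "x \<in> up S" "a = ev x" and y: "y \<in> up S" "b = ev y"
      using lift unfolding c by metis
    have "(k \<odot>\<^bsub>H\<^esub> x) \<otimes>\<^bsub>H\<^esub> y = k \<odot>\<^bsub>H\<^esub> (x \<otimes>\<^bsub>H\<^esub> y)" "x \<otimes>\<^bsub>H\<^esub> (k \<odot>\<^bsub>H\<^esub> y) = k \<odot>\<^bsub>H\<^esub> (x \<otimes>\<^bsub>H\<^esub> y)"
      using HA.smult_mult_left[OF k, of x y] HA.smult_mult_right[OF k, of x y] x(1) y(1) by (simp_all only: H_carrier)
    then show "(k \<odot>\<^bsub>SA\<^esub> a) \<otimes>\<^bsub>SA\<^esub> b = k \<odot>\<^bsub>SA\<^esub> (a \<otimes>\<^bsub>SA\<^esub> b)"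
      "a \<otimes>\<^bsub>SA\<^esub> (k \<odot>\<^bsub>SA\<^esub> b) = k \<odot>\<^bsub>SA\<^esub> (a \<otimes>\<^bsub>SA\<^esub> b)"
      using x y k by (simp_all only: r)
  qed
qed

end

section \<open>Filtration, quotient and classical limit\<close>

context star_point
begin

sublocale SAA: assoc_algebra K "star_algebra K \<Omega> E q hbar" by (rule SA_algebra)

abbreviation "below \<equiv> symb_below K \<Omega> E"

text \<open>The bound in \<open>symb_below\<close> is strict: step n of the filtration is
  \<open>below (n + 1)\<close>, while the error term of the classical limit lies in
  \<open>below (m + n)\<close>, which is zero for n = m = 0.\<close>

lemma below_iff: "a \<in> below n \<longleftrightarrow> a \<in> carrier S \<and> (\<forall>k\<ge>n. a k = B k)"
  by (simp add: symb_below_def)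

lemma below_zero: "\<zero>\<^bsub>S\<^esub> \<in> below n"
  using S_closed(1) by (simp add: below_iff S_zero)

lemma below_add: "a \<in> below n \<Longrightarrow> b \<in> below n \<Longrightarrow> a \<oplus>\<^bsub>S\<^esub> b \<in> below n"
  using s_add[OF D.zero_closed D.zero_closed] by (simp add: below_iff S_closed S_add s_zero)

lemma below_smult: "c \<in> carrier K \<Longrightarrow> a \<in> below n \<Longrightarrow> c \<odot>\<^bsub>S\<^esub> a \<in> below n"
  using smult_symbol[OF _ D.zero_closed, of c] DM.smult_r_null[of c] by (simp add: below_iff S_closed S_smult s_zero)

lemma below_finsum:
  assumes "\<And>i. i \<in> A \<Longrightarrow> f i \<in> below n"
  shows "(\<Oplus>\<^bsub>S\<^esub>i\<in>A. f i) \<in> below n"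
  using assms
proof (induction A rule: infinite_finite_induct)
  case (insert i A)
  then have "f \<in> A \<rightarrow> carrier S" "f i \<in> carrier S" by (auto simp: below_iff)
  then show ?case using insert below_add by simp
qed (simp_all add: below_zero)

lemma below_symb_in: "U \<in> Y k \<Longrightarrow> k < n \<Longrightarrow> \<iota> k U \<in> below n"
  using symb_in_closed by (auto simp: below_iff symb_in_def)

lemma below_submodule: "submodule (below n) K SA"
proof (rule SAA.submoduleI)
  show "below n \<subseteq> carrier SA" by (auto simp: below_iff SA_simps)
  show "\<zero>\<^bsub>SA\<^esub> \<in> below n" by (simp only: SA_simps below_zero)
  fix a assume a: "a \<in> below n"
  then have c: "a \<in> carrier SA" by (simp add: below_iff SA_simps)
  have "\<ominus>\<^bsub>SA\<^esub> a = (\<ominus>\<^bsub>K\<^esub> \<one>\<^bsub>K\<^esub>) \<odot>\<^bsub>SA\<^esub> a"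
    using SAA.smult_l_minus[OF R.one_closed c] SAA.smult_one[OF c] by (simp only:)
  then show "\<ominus>\<^bsub>SA\<^esub> a \<in> below n"
    using below_smult[OF R.a_inv_closed[OF R.one_closed] a] by (simp only: SA_simps)
  show "b \<in> below n \<Longrightarrow> a \<oplus>\<^bsub>SA\<^esub> b \<in> below n" for b using below_add[OF a] by (simp only: SA_simps)
  show "c \<in> carrier K \<Longrightarrow> c \<odot>\<^bsub>SA\<^esub> a \<in> below n" for c using below_smult[OF _ a] by (simp only: SA_simps)
qed

lemma st_term_below:
  assumes "U \<in> Y n" "V \<in> Y m" "k \<le> n + m" "n + m - k < l"
  shows "st_term n m U V k \<in> below l"
  unfolding star_term_def by (rule below_symb_in[OF s_Y[OF star_symbol_F[OF assms(1-3)]] assms(4)])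

text \<open>Truncation only lowers the order, so each term of a product of degrees i and j has
  degree at most i + j.\<close>

lemma star_below:
  assumes a: "a \<in> below (m + 1)" and b: "b \<in> below (n + 1)"
  shows "a \<otimes>\<^bsub>SA\<^esub> b \<in> below (m + n + 1)"
proof -
  have ab: "a \<in> carrier S" "b \<in> carrier S" using a b by (simp_all add: below_iff)
  have i: "i < m + 1" if "i \<in> {i. a i \<noteq> B i}" for i using a that by (auto simp: below_iff not_le[symmetric])
  have j: "j < n + 1" if "j \<in> {j. b j \<noteq> B j}" for j using b that by (auto simp: below_iff not_le[symmetric])
  show ?thesis
    unfolding SA_simps bilinear_ext_def
  proof (intro below_finsum below_smult pow_closed st_term_below S_Y[OF ab(1)] S_Y[OF ab(2)])
    fix i' j' k assume "i' \<in> {i. a i \<noteq> B i}" "j' \<in> {j. b j \<noteq> B j}" "k \<in> {..i' + j'}"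
    with i[of i'] j[of j'] show "k \<le> i' + j'" "i' + j' - k < m + n + 1" by auto
  qed
qed

lemma SA_filtered: "filtered_algebra K SA (\<lambda>n. below (n + 1))"
proof (intro filtered_algebra.intro filtered_algebra_axioms.intro SA_algebra below_submodule star_below)
  show "below (n + 1) \<subseteq> below (Suc n + 1)" for n by (auto simp: below_iff)
  show "(\<Union>n. below (n + 1)) = carrier SA"
  proof (intro equalityI subsetI)
    fix a assume "a \<in> carrier SA"
    then have a: "a \<in> carrier S" by (simp only: SA_simps)
    then have "finite {n. a n \<noteq> B n}" by (simp add: S_carrier)
    then obtain N where N: "\<forall>n\<in>{n. a n \<noteq> B n}. n < N" using finite_nat_set_iff_bounded by blast
    have "a k = B k" if "N + 1 \<le> k" for k
    proof (rule ccontr)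
      assume "a k \<noteq> B k"
      then have "k < N" using N by blast
      then show False using that by simp
    qed
    then have "a \<in> below (N + 1)" using a by (simp add: below_iff)
    then show "a \<in> (\<Union>n. below (n + 1))" by blast
  qed (auto simp: below_iff SA_simps)
  show "\<one>\<^bsub>SA\<^esub> \<in> below (0 + 1)"
    unfolding SA_simps S_one by (rule below_symb_in[OF s_Y[OF one_Diff_0[OF E_module]]]) simp
qed

section \<open>The kernel of evaluation and the quotient by it\<close>

definition ker where "ker = {x \<in> carrier H. ev x = \<zero>\<^bsub>S\<^esub>}"

lemma ker_ideal: "ideal ker H"
proof (rule idealI[OF HA.ring_axioms])
  have sm: "x \<in> ker \<longleftrightarrow> x \<in> up S \<and> ev x = \<zero>\<^bsub>S\<^esub>" for x by (simp add: ker_def H_carrier)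
  show "subgroup ker (add_monoid H)"
  proof (rule HA.add.subgroupI)
    show "ker \<subseteq> carrier H" by (auto simp: ker_def)
    have "\<zero>\<^bsub>H\<^esub> \<in> ker"
      using HA.zero_closed additive_map_zero[OF HA.abelian_group_axioms S.abelian_group_axioms ev_H_additive]
      by (simp only: sm H_carrier)
    then show "ker \<noteq> {}" by blast
    fix x assume x: "x \<in> ker"
    then show "\<ominus>\<^bsub>H\<^esub> x \<in> ker" using ev_H_minus H_closed(4) by (simp add: sm)
    fix y assume y: "y \<in> ker"
    then show "x \<oplus>\<^bsub>H\<^esub> y \<in> ker" using x ev_H(1) H_closed(1) by (simp add: sm)
  qed
  fix x y assume "x \<in> ker" "y \<in> carrier H"
  then have x: "x \<in> up S" "ev x = \<zero>\<^bsub>SA\<^esub>" and y: "y \<in> up S" by (simp_all add: sm H_carrier SA_simps)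
  have e: "ev y \<in> carrier SA" using ev_closed[OF y] by (simp only: SA_simps)
  have "ev (y \<otimes>\<^bsub>H\<^esub> x) = \<zero>\<^bsub>SA\<^esub>" "ev (x \<otimes>\<^bsub>H\<^esub> y) = \<zero>\<^bsub>SA\<^esub>"
    unfolding ev_mult[OF x(1) y] ev_mult[OF y x(1)] x(2) by (rule SAA.r_null[OF e], rule SAA.l_null[OF e])
  then show "y \<otimes>\<^bsub>H\<^esub> x \<in> ker" "x \<otimes>\<^bsub>H\<^esub> y \<in> ker"
    using H_closed(2) x(1) y by (simp_all only: sm SA_simps)
qed

text \<open>If \<open>ev x\<close> is zero, \<open>reducible\<close> exhibits \<open>x\<close> as a
  multiple of \<open>\<eta>\<close>; conversely the kernel is an ideal that contains
  \<open>\<eta>\<close>. The quotient can therefore be computed with \<open>ker\<close>.\<close>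

lemma ker_genideal: "Idl\<^bsub>H\<^esub> {\<eta>} = ker"
proof
  have o: "\<one>\<^bsub>H\<^esub> \<in> up S" by (rule H_closed(5))
  have "\<eta> \<otimes>\<^bsub>H\<^esub> \<one>\<^bsub>H\<^esub> = \<eta>" by (rule HA.r_one) (simp only: H_carrier eta_closed)
  then have "\<eta> \<in> ker" using ev_eta_mult[OF o] eta_closed by (simp add: ker_def H_carrier)
  then show "Idl\<^bsub>H\<^esub> {\<eta>} \<subseteq> ker" using ker_ideal unfolding genideal_def by blast
  show "ker \<subseteq> Idl\<^bsub>H\<^esub> {\<eta>}"
    unfolding genideal_def
  proof (intro subsetI InterI)
    fix x I assume x: "x \<in> ker" and "I \<in> {I. ideal I H \<and> {\<eta>} \<subseteq> I}"
    then have I: "ideal I H" "\<eta> \<in> I" by auto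
    have xu: "x \<in> up S" "ev x = \<zero>\<^bsub>S\<^esub>" using x by (simp_all add: ker_def H_carrier)
    obtain z where z: "z \<in> up S" "x = hat (ev x) \<oplus>\<^bsub>H\<^esub> \<eta> \<otimes>\<^bsub>H\<^esub> z"
      using reducible[OF xu(1)] unfolding reducible_def by blast
    have "hat (ev x) = \<zero>\<^bsub>H\<^esub>" unfolding xu(2) H_simps by (auto simp: hmonom_def)
    moreover have "\<eta> \<otimes>\<^bsub>H\<^esub> z \<in> carrier H" using H_closed(2)[OF eta_closed z(1)] by (simp only: H_carrier)
    ultimately have "x = \<eta> \<otimes>\<^bsub>H\<^esub> z" using z(2) HA.l_zero by metis
    then show "x \<in> I" using ideal.I_r_closed[OF I(1) I(2), of z] z(1) by (simp only: H_carrier)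
  qed
qed

abbreviation "Q \<equiv> quotient_algebra H ker"

lemma Q_simps:
  "carrier Q = a_rcosets\<^bsub>H\<^esub> ker" "mult Q = rcoset_mult H ker" "one Q = ker +>\<^bsub>H\<^esub> \<one>\<^bsub>H\<^esub>"
  "add Q = set_add H" "smult Q = (\<lambda>c U. \<Union>x\<in>U. ker +>\<^bsub>H\<^esub> (c \<odot>\<^bsub>H\<^esub> x))"
  by (simp_all add: quotient_algebra_def ring.defs module.defs FactRing_def)

text \<open>The form in which the isomorphism theorem is used: a coset amounts to its common value
  at hbar.\<close>

lemma coset_eq_iff:
  assumes x: "x \<in> up S" and y: "y \<in> up S"
  shows "ker +>\<^bsub>H\<^esub> x = ker +>\<^bsub>H\<^esub> y \<longleftrightarrow> ev x = ev y"
proof -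
  interpret I: ideal ker H by (rule ker_ideal)
  have c: "x \<in> carrier H" "y \<in> carrier H" using x y by (simp_all only: H_carrier)
  have e: "ev x \<in> carrier S" "ev y \<in> carrier S" using ev_closed x y by auto
  have "ker +>\<^bsub>H\<^esub> x = ker +>\<^bsub>H\<^esub> y \<longleftrightarrow> x \<ominus>\<^bsub>H\<^esub> y \<in> ker"
    using HA.quotient_eq_iff_same_a_r_cos[OF ker_ideal c] by auto
  also have "\<dots> \<longleftrightarrow> ev x \<oplus>\<^bsub>S\<^esub> \<ominus>\<^bsub>S\<^esub> ev y = \<zero>\<^bsub>S\<^esub>"
    using ev_H(1)[OF x H_closed(4)[OF y]] ev_H_minus[OF y] H_closed(1)[OF x H_closed(4)[OF y]]
    by (simp add: ker_def a_minus_def H_carrier)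
  also have "\<dots> \<longleftrightarrow> ev x = ev y"
    using e S.r_neg[OF e(2)] S.minus_equality[of "ev x" "\<ominus>\<^bsub>S\<^esub> ev y"] S.minus_minus[OF e(2)] by auto
  finally show ?thesis .
qed

text \<open>Inverse to the map induced by \<open>ev\<close>. \<open>hat\<close> itself is in general
  only linear: the product of \<open>hat a\<close> and \<open>hat b\<close> may contain powers of
  \<open>h\<close>, and modulo the kernel it equals \<open>hat\<close> of the star product.\<close>

lemma coset_hat_iso: "(\<lambda>a. ker +>\<^bsub>H\<^esub> hat a) \<in> algebra_iso K SA Q"
proof -
  interpret I: ideal ker H by (rule ker_ideal)
  let ?f = "\<lambda>a. ker +>\<^bsub>H\<^esub> hat a"
  have hc: "hat a \<in> carrier H" if "a \<in> carrier S" for a using hmonom_up[OF that] by (simp only: H_carrier)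
  have Q_carrier: "carrier Q = (\<lambda>x. ker +>\<^bsub>H\<^esub> x) ` up S"
    by (auto simp: Q_simps A_RCOSETS_def' H_carrier)
  have sm: "c \<odot>\<^bsub>Q\<^esub> (ker +>\<^bsub>H\<^esub> x) = ker +>\<^bsub>H\<^esub> (c \<odot>\<^bsub>H\<^esub> x)" if c: "c \<in> carrier K" and x: "x \<in> up S" for c x
  proof -
    \<comment> \<open>Scalar multiplication in the quotient is a union over representatives;
      linearity of \<open>ev\<close> shows that all of them give one coset.\<close>
    have "ker +>\<^bsub>H\<^esub> (c \<odot>\<^bsub>H\<^esub> y) = ker +>\<^bsub>H\<^esub> (c \<odot>\<^bsub>H\<^esub> x)" if "y \<in> ker +>\<^bsub>H\<^esub> x" for y
    proof -
      have xc: "x \<in> carrier H" using x by (simp only: H_carrier)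
      have "y \<in> carrier H" using that HA.a_r_coset_subset_G[OF I.a_subset xc] by blast
      then have y: "y \<in> up S" by (simp only: H_carrier)
      have "ev x = ev y" using I.a_repr_independence'[OF that xc] coset_eq_iff[OF x y] by blast
      then show ?thesis
        using coset_eq_iff[OF H_closed(3)[OF c y] H_closed(3)[OF c x]] ev_H(2)[OF c x] ev_H(2)[OF c y] by simp
    qed
    moreover have "x \<in> ker +>\<^bsub>H\<^esub> x" by (rule I.a_rcos_self) (use x in \<open>simp only: H_carrier\<close>)
    ultimately show ?thesis unfolding Q_simps by blast
  qed
  have "?f \<in> ring_hom SA Q"
  proof (rule ring_hom_memI)
    fix a assume "a \<in> carrier SA"
    then have a: "a \<in> carrier S" by (simp only: SA_simps)
    show "?f a \<in> carrier Q" using hmonom_up[OF a] by (simp add: Q_carrier)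
    fix b assume "b \<in> carrier SA"
    then have b: "b \<in> carrier S" by (simp only: SA_simps)
    have ab: "a \<otimes>\<^bsub>SA\<^esub> b \<in> carrier S"
      using SAA.m_closed[of a b] a b by (simp only: SA_simps)
    have "?f (a \<otimes>\<^bsub>SA\<^esub> b) = ker +>\<^bsub>H\<^esub> (hat a \<otimes>\<^bsub>H\<^esub> hat b)"
      using coset_eq_iff[OF hmonom_up[OF ab] H_closed(2)[OF hmonom_up[OF a] hmonom_up[OF b]]]
        star_hat[OF a b] ev_hat[OF ab] by metis
    then show "?f (a \<otimes>\<^bsub>SA\<^esub> b) = ?f a \<otimes>\<^bsub>Q\<^esub> ?f b"
      using I.rcoset_mult_add[OF hc[OF a] hc[OF b]] by (simp only: Q_simps)
    show "?f (a \<oplus>\<^bsub>SA\<^esub> b) = ?f a \<oplus>\<^bsub>Q\<^esub> ?f b"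
      using I.a_rcos_sum[OF hc[OF a] hc[OF b]] hat_add[OF a b] by (simp only: Q_simps SA_simps)
  qed (simp only: Q_simps SA_simps H_simps)
  moreover have "bij_betw ?f (carrier SA) (carrier Q)"
    unfolding bij_betw_def
  proof
    show "inj_on ?f (carrier SA)"
    proof (rule inj_onI)
      fix a b assume "a \<in> carrier SA" "b \<in> carrier SA" and e: "?f a = ?f b"
      then have a: "a \<in> carrier S" and b: "b \<in> carrier S" by (simp_all only: SA_simps)
      show "a = b" using e coset_eq_iff[OF hmonom_up[OF a] hmonom_up[OF b]] ev_hat[OF a] ev_hat[OF b] by simp
    qed
    show "?f ` carrier SA = carrier Q"
    proof (intro equalityI subsetI)
      fix X assume "X \<in> carrier Q"
      then obtain x where x: "x \<in> up S" "X = ker +>\<^bsub>H\<^esub> x" by (auto simp: Q_carrier)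
      \<comment> \<open>Every coset contains the constant polynomial whose coefficient is its value
        at hbar.\<close>
      have "X = ?f (ev x)"
        unfolding x(2) using coset_eq_iff[OF x(1) hmonom_up[OF ev_closed[OF x(1)]]] ev_hat[OF ev_closed[OF x(1)]] by simp
      then show "X \<in> ?f ` carrier SA" using ev_closed[OF x(1)] by (simp add: SA_simps)
    qed (auto simp: Q_carrier SA_simps intro!: imageI hmonom_up)
  qed
  moreover have "?f (c \<odot>\<^bsub>SA\<^esub> a) = c \<odot>\<^bsub>Q\<^esub> ?f a" if c: "c \<in> carrier K" and "a \<in> carrier SA" for c a
  proof -
    have a: "a \<in> carrier S" using that by (simp only: SA_simps)
    show ?thesis unfolding sm[OF c hmonom_up[OF a]] by (simp only: SA_simps hat_smult[OF c])
  qed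
  ultimately show ?thesis by (simp add: algebra_iso_def ring_iso_def)
qed

section \<open>Products of homogeneous symbols and the classical limit\<close>

lemma bilinear_symb_in:
  assumes "abelian_group G" "\<beta> n m U V \<in> carrier G" "U \<noteq> B n" "V \<noteq> B m"
  shows "bilinear_ext G (\<lambda>n. B n) \<beta> (\<iota> n U) (\<iota> m V) = \<beta> n m U V"
proof -
  interpret G: abelian_group G by fact
  have "{k. \<iota> n U k \<noteq> B k} = {n}" "{k. \<iota> m V k \<noteq> B k} = {m}" using assms(3,4) by (auto simp: symb_in_def)
  then show ?thesis using assms(2) by (simp add: bilinear_ext_def symb_in_def)
qed

text \<open>A zero symbol has empty support, so the sum is empty and \<open>\<beta>\<close> is never
  evaluated; this case has to be treated apart from the generic one.\<close>

lemma bilinear_symb_in_zero: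
  assumes "abelian_group G" "U = B n \<or> V = B m"
  shows "bilinear_ext G (\<lambda>n. B n) \<beta> (\<iota> n U) (\<iota> m V) = \<zero>\<^bsub>G\<^esub>"
proof -
  interpret G: abelian_group G by fact
  have "{k. \<iota> n U k \<noteq> B k} = {} \<or> {k. \<iota> m V k \<noteq> B k} = {}" using assms(2) by (auto simp: symb_in_def)
  then show ?thesis by (auto simp: bilinear_ext_def)
qed

text \<open>The product of symbols is declared with sums in \<open>symb_module\<close>. They are
  rewritten as sums in \<open>S\<close>, where the star product lives, so that the two can be
  compared.\<close>

lemma S_mult: "mult S = bilinear_ext S (\<lambda>n. B n) (\<lambda>n m U V. \<iota> (n + m) (symbol_mult K \<Omega> E n m U V))"
proof -
  have "finsum (symb_module K \<Omega> E) f A = finsum S f A" for f :: "nat \<Rightarrow> nat \<Rightarrow> ('e \<Rightarrow> 'e) set" and A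
    by (rule finsum_add_monoid) (simp_all add: symb_algebra_def)
  then have "bilinear_ext (symb_module K \<Omega> E) z \<beta> = bilinear_ext S z \<beta>"
    for z :: "nat \<Rightarrow> ('e \<Rightarrow> 'e) set" and \<beta>
    by (intro ext) (simp only: bilinear_ext_def)
  moreover have "mult S = bilinear_ext (symb_module K \<Omega> E) (\<lambda>n. B n) (\<lambda>n m U V. \<iota> (n + m) (symbol_mult K \<Omega> E n m U V))"
    by (simp add: symb_algebra_def)
  ultimately show ?thesis by (simp only:)
qed

text \<open>The term k = 0 involves no truncation and is the product of symbols; every other term
  has a factor \<open>hbar\<close> that can be taken out of the sum.\<close>

lemma star_minus_mult:
  assumes U: "U \<in> Y n" and V: "V \<in> Y m"
  shows "(\<iota> n U \<otimes>\<^bsub>SA\<^esub> \<iota> m V) \<ominus>\<^bsub>S\<^esub> (\<iota> n U \<otimes>\<^bsub>S\<^esub> \<iota> m V) \<in> (\<lambda>a. hbar \<odot>\<^bsub>S\<^esub> a) ` below (m + n)"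
proof (cases "U = B n \<or> V = B m")
  case True
  have "(\<iota> n U \<otimes>\<^bsub>SA\<^esub> \<iota> m V) \<ominus>\<^bsub>S\<^esub> (\<iota> n U \<otimes>\<^bsub>S\<^esub> \<iota> m V) = hbar \<odot>\<^bsub>S\<^esub> \<zero>\<^bsub>S\<^esub>"
    unfolding SA_simps S_mult bilinear_symb_in_zero[OF S.abelian_group_axioms True]
    using S.smult_r_null[OF hbar] by (simp add: a_minus_def)
  then show ?thesis using below_zero by blast
next
  case False
  let ?t = "\<lambda>k. hbar [^]\<^bsub>K\<^esub> k \<odot>\<^bsub>S\<^esub> st_term n m U V k"
  let ?f = "q n U \<otimes>\<^bsub>R\<^esub> q m V"
  have tc: "?t k \<in> carrier S" if "k \<le> n + m" for k
    by (rule S.smult_closed[OF pow_closed st_term_closed[OF U V that]])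
  have t0: "st_term n m U V 0 \<in> carrier S" by (rule st_term_closed[OF U V]) simp
  have star: "\<iota> n U \<otimes>\<^bsub>SA\<^esub> \<iota> m V = (\<Oplus>\<^bsub>S\<^esub>k\<in>{..n + m}. ?t k)"
    unfolding SA_simps
    by (rule bilinear_symb_in[OF S.abelian_group_axioms]) (use tc False in \<open>auto intro!: S.finsum_closed\<close>)
  have sym: "\<iota> (n + m) (symbol_mult K \<Omega> E n m U V) = st_term n m U V 0"
    using mult_symbol[OF q_F[OF U] q_F[OF V]] unfolding s_q[OF U] s_q[OF V]
    by (simp add: star_term_def tr_top)
  have mult: "\<iota> n U \<otimes>\<^bsub>S\<^esub> \<iota> m V = st_term n m U V 0"
    unfolding S_mult sym[symmetric]
    by (rule bilinear_symb_in[OF S.abelian_group_axioms]) (use False t0 sym in auto)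
  have t0': "?t 0 = st_term n m U V 0" using S.smult_one[OF t0] by simp
  show ?thesis
  proof (cases "n + m")
    \<comment> \<open>Only the term k = 0 exists and \<open>below 0\<close> is the zero submodule,
      so the difference has to be zero.\<close>
    case 0
    then have "(\<iota> n U \<otimes>\<^bsub>SA\<^esub> \<iota> m V) \<ominus>\<^bsub>S\<^esub> (\<iota> n U \<otimes>\<^bsub>S\<^esub> \<iota> m V) = hbar \<odot>\<^bsub>S\<^esub> \<zero>\<^bsub>S\<^esub>"
      unfolding star mult using t0 t0' S.smult_r_null[OF hbar] by (simp add: a_minus_def S.r_neg)
    then show ?thesis using below_zero by blast
  next
    case (Suc N)
    \<comment> \<open>One factor \<open>hbar\<close> is removed and the index shifted by one: the
      term k + 1 has degree at most \<open>n + m - 1\<close>, as \<open>below (m + n)\<close>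
      demands.\<close>
    let ?w = "\<Oplus>\<^bsub>S\<^esub>k\<in>{..N}. hbar [^]\<^bsub>K\<^esub> k \<odot>\<^bsub>S\<^esub> st_term n m U V (Suc k)"
    have wb: "hbar [^]\<^bsub>K\<^esub> k \<odot>\<^bsub>S\<^esub> st_term n m U V (Suc k) \<in> below (m + n)" if "k \<in> {..N}" for k
      by (intro below_smult pow_closed st_term_below[OF U V]) (use that Suc in auto)
    have w: "?w \<in> below (m + n)" by (rule below_finsum[OF wb])
    have "hbar \<odot>\<^bsub>S\<^esub> ?w = (\<Oplus>\<^bsub>S\<^esub>k\<in>{..N}. hbar \<odot>\<^bsub>S\<^esub> (hbar [^]\<^bsub>K\<^esub> k \<odot>\<^bsub>S\<^esub> st_term n m U V (Suc k)))"
      by (rule S.finsum_smult_ldistr[OF _ hbar]) (use wb in \<open>auto simp: below_iff\<close>)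
    also have "\<dots> = (\<Oplus>\<^bsub>S\<^esub>k\<in>{..N}. ?t (Suc k))"
    proof (rule S.finsum_cong')
      fix k assume "k \<in> {..N}"
      then have "st_term n m U V (Suc k) \<in> carrier S" using Suc by (intro st_term_closed[OF U V]) simp
      then show "hbar \<odot>\<^bsub>S\<^esub> (hbar [^]\<^bsub>K\<^esub> k \<odot>\<^bsub>S\<^esub> st_term n m U V (Suc k)) = ?t (Suc k)"
        using S.smult_assoc1[OF hbar pow_closed, of "st_term n m U V (Suc k)" k] R.m_comm[OF hbar pow_closed, of k] by simp
    next
      show "(\<lambda>k. ?t (Suc k)) \<in> {..N} \<rightarrow> carrier S" by (intro funcsetI tc) (use Suc in simp)
    qed simp
    finally have e: "(\<Oplus>\<^bsub>S\<^esub>k\<in>{..N}. ?t (Suc k)) = hbar \<odot>\<^bsub>S\<^esub> ?w" by simp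
    have "(\<Oplus>\<^bsub>S\<^esub>k\<in>{..n + m}. ?t k) = (\<Oplus>\<^bsub>S\<^esub>k\<in>{..N}. ?t (Suc k)) \<oplus>\<^bsub>S\<^esub> ?t 0"
      unfolding Suc by (rule S.finsum_Suc2) (intro funcsetI tc, use Suc in simp)
    then have s: "(\<Oplus>\<^bsub>S\<^esub>k\<in>{..n + m}. ?t k) = hbar \<odot>\<^bsub>S\<^esub> ?w \<oplus>\<^bsub>S\<^esub> st_term n m U V 0" by (simp only: e t0')
    have hw: "hbar \<odot>\<^bsub>S\<^esub> ?w \<in> carrier S" using w by (intro S.smult_closed[OF hbar]) (simp add: below_iff)
    have "(\<iota> n U \<otimes>\<^bsub>SA\<^esub> \<iota> m V) \<ominus>\<^bsub>S\<^esub> (\<iota> n U \<otimes>\<^bsub>S\<^esub> \<iota> m V) = hbar \<odot>\<^bsub>S\<^esub> ?w"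
      unfolding star mult s using hw t0 by (simp add: a_minus_def S.a_assoc S.r_neg)
    then show ?thesis using w by blast
  qed
qed

end

theorem proposition5p35:
  fixes K :: "'k ring" and \<Omega> :: "('k, 'w) dga" and E :: "('w, 'e) module"
    and q :: "nat \<Rightarrow> ('e \<Rightarrow> 'e) set \<Rightarrow> 'e \<Rightarrow> 'e" and hbar :: 'k
  assumes "exterior_algebra K \<Omega>"
    and "left_module (deg0 \<Omega>) E"
    and "full_quantization K \<Omega> E q"
    and "hbar \<in> carrier K"
  shows "filtered_algebra K (star_algebra K \<Omega> E q hbar) (\<lambda>n. symb_below K \<Omega> E (n + 1))
    \<and> (\<exists>f. f \<in> algebra_iso K (star_algebra K \<Omega> E q hbar)
              (quotient_algebra (formal_star_algebra K \<Omega> E q)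
                 (Idl\<^bsub>formal_star_algebra K \<Omega> E q\<^esub> {h_minus K \<Omega> E q hbar})))
    \<and> (\<forall>n m. \<forall>a \<in> Symb K \<Omega> E n. \<forall>b \<in> Symb K \<Omega> E m.
         (symb_in K \<Omega> E n a \<otimes>\<^bsub>star_algebra K \<Omega> E q hbar\<^esub> symb_in K \<Omega> E m b)
           \<ominus>\<^bsub>symb_algebra K \<Omega> E\<^esub>
         (symb_in K \<Omega> E n a \<otimes>\<^bsub>symb_algebra K \<Omega> E\<^esub> symb_in K \<Omega> E m b)
         \<in> (\<lambda>s. hbar \<odot>\<^bsub>symb_algebra K \<Omega> E\<^esub> s) ` symb_below K \<Omega> E (m + n))"
proof -
  interpret star_point K \<Omega> E q hbar
    by (intro star_point.intro star_setting.intro jet_algebra.intro star_point_axioms.intro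
        star_setting_axioms.intro assms)
  \<comment> \<open>\<open>ker_genideal\<close> turns the ideal generated by \<open>h - hbar\<close>
    into the kernel of evaluation, for which the isomorphism was constructed.\<close>
  show ?thesis
    using SA_filtered coset_hat_iso star_minus_mult unfolding ker_genideal by blast
qed

end
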